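(* Let $(\mathsf L,\mathsf R)$ be the LOFS on the $\mathbf{Ord}$-category $\mathbf{Top}_0$ of $T_0$ topological spaces induced by the filter monad (described in the context). Then $(\mathsf L,\mathsf R)$ is not cofibrantly $(\mathsf E,\mathsf M)$-generated (by a small internal category in $\mathbf{Ord}\text-\mathbf{Cat}$ over $\mathbb S\mathrm q(\mathbf{Top}_0)$), for any cocontinuous $\mathbf{Ord}$-enriched AWFS $(\mathsf E,\mathsf M)$ on $\mathbf{Ord}$. In particular it is neither cofibrantly KZ-generated nor cofibrantly generated. Furthermore, its underlying weak factorisation system is not cofibrantly generated, i.e. there is no small set $\mathcal I$ of continuous maps such that the right class of the underlying weak factorisation system is the class of maps with the right lifting property against every member of $\mathcal I$.
   Context: $\mathbf{Ord}$ is the category of posets; $\mathbf 2=(0\to1)$. $\mathbf{Top}_0$ is made an $\mathbf{Ord}$-category by setting $f\le g$, for parallel continuous maps, iff $f(x)\sqsupseteq g(x)$ for all $x$, where $x\sqsubseteq y$ is the specialisation order (each neighbourhood of $x$ is a neighbourhood of $y$). AWFS. An $\mathbf{Ord}$-enriched algebraic weak factorisation system (AWFS) $(\mathsf L,\mathsf R)$ on an $\mathbf{Ord}$-category $\mathcal C$ is an $\mathbf{Ord}$-functorial factorisation $f=(A\xrightarrow{Lf}Kf\xrightarrow{Rf}B)$ of arrows $f\colon A\to B$, with natural $\Sigma_f=(1,\sigma_f)\colon Lf\to L^2f$ and $\Pi_f=(\pi_f,1)\colon R^2f\to Rf$ making $\mathsf L=(L,\Phi,\Sigma)$ an enriched comonad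 and $\mathsf R=(R,\Lambda,\Pi)$ an enriched monad on $\mathcal C^{\mathbf 2}$, where $\Phi_f=(1,Rf)\colon Lf\to f$ and $\Lambda_f=(Lf,1)\colon f\to Rf$, and such that $(\sigma_f,\pi_f)\colon LRf\to RLf$ is a mixed distributive law. Then $\mathsf R$-algebras compose, giving an internal category $\mathsf R\text-\mathbb A\mathrm{lg}=(\mathsf R\text-\mathrm{Alg}\rightrightarrows\mathcal C)$ over the internal category $\mathbb S\mathrm q(\mathcal C)=(\mathcal C^{\mathbf 2}\rightrightarrows\mathcal C)$ of squares. The AWFS is cocontinuous if its monad is cocontinuous. It is a LOFS (lax orthogonal) if $\mathsf L$ and $\mathsf R$ are lax idempotent, where a 2-monad $(T,i,m)$ is lax idempotent if $Ti\dashv m$ with identity unit, and dually (reversing 1-cells) for 2-comonads. The underlying weak factorisation system $(\mathcal L,\mathcal R)$ has as left class the morphisms admitting a coalgebra structure for the copointed endofunctor $(L,\Phi)$ and as right class those admitting an algebra structure for the pointed endofunctor $(R,\Lambda)$. The LOFS on $\mathbf{Top}_0$. For a $T_0$ space $X$, $FX$ is the space of all filters (including the improper one) of open subsets of $X$, with basic open sets $U^\#=\{\varphi:U\in\varphi\}$ for $U\subseteq X$ open; $(Fh)(\varphi)=\{V: h^{-1}(V)\in\varphi\}$; the unit $\eta_X(x)$ is the filter of open neighbourhoods of $x$; the multiplication is given by $U\in\mu_X(\Psi)\iff U^\#\in\Psi$. With the ordering on parallel continuous maps given by $f\le g$ iff $f(x)\sqsupseteq g(x)$ for all $x$ (the reverse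 of the pointwise specialisation order), the filter monad $\mathsf F$ is lax idempotent. The induced LOFS $(\mathsf L,\mathsf R)$ factors $f\colon A\to B$ through the subspace $Kf=\{(\varphi,b)\in FA\times B: Ff(\varphi)\le\eta_B(b)\}$, i.e. $\eta_B(b)\subseteq Ff(\varphi)$ (the comma object of $Ff$ and $\eta_B$), with $Lf(a)=(\eta_A(a),f(a))$ and $Rf(\varphi,b)=b$; the comultiplication and multiplication are the unique ones making $\mathsf L$ and $\mathsf R$ a lax idempotent comonad and monad. Its fibrant replacement monad (restriction of $\mathsf R$ to $\mathbf{Top}_0/1\cong\mathbf{Top}_0$) is the filter monad, and a continuous map is an $\mathsf L$-coalgebra iff it is a topological embedding. Cofibrant generation. Given an $\mathbf{Ord}$-enriched AWFS $(\mathsf E,\mathsf M)$ on $\mathbf{Ord}$, extended pointwise to $[\mathcal J^{\mathrm{op}},\mathbf{Ord}]$, and an $\mathbf{Ord}$-functor $U\colon\mathcal J\to\mathcal C^{\mathbf 2}$ with $\mathcal J$ small, $\mathcal J^{\pitchfork_{\mathsf M}}$ is the pullback of $\mathsf M\text-\mathrm{Alg}\to[\mathcal J^{\mathrm{op}},\mathbf{Ord}]^{\mathbf 2}$ along the functor sending $f\colon A\to B$ to the comparison $\mathcal C(\mathrm{cod}\,Uj,A)\to\mathcal C^{\mathbf 2}(Uj,f)=\mathcal C(\mathrm{dom}\,Uj,A)\times_{\mathcal C(\mathrm{dom}\,Uj,B)}\mathcal C(\mathrm{cod}\,Uj,B)$. For an internal category $\mathbb J=(\mathcal J\rightrightarrows\mathcal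 J_0)$ in small $\mathbf{Ord}$-categories with an internal functor to $\mathbb S\mathrm q(\mathcal C)$, $\mathbb J^{\pitchfork\pitchfork_{\mathsf M}}$ is the internal category over $\mathbb S\mathrm q(\mathcal C)$, with object part $\mathcal C$, whose arrow part is the full subcategory of $\mathcal J^{\pitchfork_{\mathsf M}}$ on those $f$ for which, for all composable $i,j$ ($\mathrm{cod}\,i=\mathrm{dom}\,j$), the $\mathsf M$-algebra structure associated with the vertical composite $j\bullet i$ equals the composite of the structure for $j$ with the pullback of the one for $i$. $(\mathsf L,\mathsf R)$ is cofibrantly $(\mathsf E,\mathsf M)$-generated by $\mathbb J$ if $\mathsf R\text-\mathbb A\mathrm{lg}\cong\mathbb J^{\pitchfork\pitchfork_{\mathsf M}}$ over $\mathbb S\mathrm q(\mathcal C)$. "Cofibrantly KZ-generated" is the case where $\mathsf M$-algebras are RALIs (morphisms $f$ with a left adjoint $\ell\dashv f$ such that $f\ell=1$, the unit being the identity); "cofibrantly generated" is the case where $\mathsf M$-algebras are split epimorphisms (morphisms with a chosen section). *)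

theory Defs
  imports "HOL-Analysis.Analysis" "HOL-Library.Equipollence"
begin

section \<open>Size\<close>

text \<open>Sizes are measured against a type \<open>'u\<close> which plays the part of a Grothendieck universe
  (its cardinality is assumed strongly inaccessible). A set is small if it has fewer elements than
  \<open>'u\<close>; the elements themselves may be of any type.\<close>

definition small :: "'u itself \<Rightarrow> 'x set \<Rightarrow> bool" where
  "small (U :: 'u itself) S \<longleftrightarrow> S \<prec> (UNIV :: 'u set)"

definition universe :: "'u itself \<Rightarrow> bool" where
  "universe (U :: 'u itself) \<longleftrightarrow>
     small U (UNIV :: nat set) \<and>
     (\<forall>S :: 'u set. small U S \<longrightarrow> small U (Pow S)) \<and>
     (\<forall>\<S> :: 'u set set. small U \<S> \<and> (\<forall>S\<in>\<S>. small U S) \<longrightarrow> small U (\<Union>\<S>))"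

section \<open>Categories enriched in posets\<close>

record ('o, 'a) ordcat =
  Obj :: "'o set"
  Arr :: "'a set"
  Dom :: "'a \<Rightarrow> 'o"
  Cod :: "'a \<Rightarrow> 'o"
  Idt :: "'o \<Rightarrow> 'a"
  Comp :: "'a \<Rightarrow> 'a \<Rightarrow> 'a"
  Le :: "'a \<Rightarrow> 'a \<Rightarrow> bool"

text \<open>\<open>Comp C g f\<close> is \<open>g \<circ> f\<close>. The relation \<open>Le C\<close> is meaningful for parallel arrows only.\<close>

definition homset :: "('o, 'a) ordcat \<Rightarrow> 'o \<Rightarrow> 'o \<Rightarrow> 'a set" where
  "homset C X Y = {f \<in> Arr C. Dom C f = X \<and> Cod C f = Y}"

locale ord_category =
  fixes C :: "('o, 'a) ordcat"
  assumes dom_obj: "f \<in> Arr C \<Longrightarrow> Dom C f \<in> Obj C"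
    and cod_obj: "f \<in> Arr C \<Longrightarrow> Cod C f \<in> Obj C"
    and idt_hom: "X \<in> Obj C \<Longrightarrow> Idt C X \<in> homset C X X"
    and comp_hom: "\<lbrakk>f \<in> homset C X Y; g \<in> homset C Y Z\<rbrakk> \<Longrightarrow> Comp C g f \<in> homset C X Z"
    and comp_idt: "f \<in> homset C X Y \<Longrightarrow> Comp C f (Idt C X) = f"
    and idt_comp: "f \<in> homset C X Y \<Longrightarrow> Comp C (Idt C Y) f = f"
    and comp_assoc: "\<lbrakk>f \<in> homset C W X; g \<in> homset C X Y; h \<in> homset C Y Z\<rbrakk>
      \<Longrightarrow> Comp C h (Comp C g f) = Comp C (Comp C h g) f"
    and le_refl: "f \<in> Arr C \<Longrightarrow> Le C f f"
    and le_trans: "\<lbrakk>f \<in> homset C X Y; g \<in> homset C X Y; h \<in> homset C X Y; Le C f g; Le C g h\<rbrakk>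
      \<Longrightarrow> Le C f h"
    and le_antisym: "\<lbrakk>f \<in> homset C X Y; g \<in> homset C X Y; Le C f g; Le C g f\<rbrakk> \<Longrightarrow> f = g"
    and comp_mono: "\<lbrakk>f \<in> homset C X Y; f' \<in> homset C X Y; g \<in> homset C Y Z; g' \<in> homset C Y Z;
      Le C f f'; Le C g g'\<rbrakk> \<Longrightarrow> Le C (Comp C g f) (Comp C g' f')"

definition small_cat :: "'u itself \<Rightarrow> ('o, 'a) ordcat \<Rightarrow> bool" where
  "small_cat U C \<longleftrightarrow> small U (Obj C) \<and> small U (Arr C)"

definition op_cat :: "('o, 'a) ordcat \<Rightarrow> ('o, 'a) ordcat" where
  "op_cat C = \<lparr>Obj = Obj C, Arr = Arr C, Dom = Cod C, Cod = Dom C, Idt = Idt C,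
     Comp = (\<lambda>g f. Comp C f g), Le = Le C\<rparr>"

record ('o, 'a, 'p, 'b) ofunctor =
  onObj :: "'o \<Rightarrow> 'p"
  onArr :: "'a \<Rightarrow> 'b"

locale ord_functor =
  fixes C :: "('o, 'a) ordcat" and D :: "('p, 'b) ordcat" and F :: "('o, 'a, 'p, 'b) ofunctor"
  assumes obj_map: "X \<in> Obj C \<Longrightarrow> onObj F X \<in> Obj D"
    and hom_map: "f \<in> homset C X Y \<Longrightarrow> onArr F f \<in> homset D (onObj F X) (onObj F Y)"
    and idt_map: "X \<in> Obj C \<Longrightarrow> onArr F (Idt C X) = Idt D (onObj F X)"
    and comp_map: "\<lbrakk>f \<in> homset C X Y; g \<in> homset C Y Z\<rbrakk>
      \<Longrightarrow> onArr F (Comp C g f) = Comp D (onArr F g) (onArr F f)"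
    and le_map: "\<lbrakk>f \<in> homset C X Y; g \<in> homset C X Y; Le C f g\<rbrakk> \<Longrightarrow> Le D (onArr F f) (onArr F g)"

definition fid :: "('o, 'a, 'o, 'a) ofunctor" where
  "fid = \<lparr>onObj = (\<lambda>X. X), onArr = (\<lambda>f. f)\<rparr>"

definition fcomp :: "('p, 'b, 'q, 'c) ofunctor \<Rightarrow> ('o, 'a, 'p, 'b) ofunctor
    \<Rightarrow> ('o, 'a, 'q, 'c) ofunctor" where
  "fcomp G F = \<lparr>onObj = (\<lambda>X. onObj G (onObj F X)), onArr = (\<lambda>f. onArr G (onArr F f))\<rparr>"

definition feq :: "('o, 'a) ordcat \<Rightarrow> ('o, 'a, 'p, 'b) ofunctor \<Rightarrow> ('o, 'a, 'p, 'b) ofunctor \<Rightarrow> bool" where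
  "feq C F G \<longleftrightarrow> (\<forall>X\<in>Obj C. onObj F X = onObj G X) \<and> (\<forall>f\<in>Arr C. onArr F f = onArr G f)"

text \<open>As hom-posets have no nontrivial equalities of 2-cells, an enriched natural transformation
  is just a natural one.\<close>

definition nat_trans :: "('o, 'a) ordcat \<Rightarrow> ('p, 'b) ordcat \<Rightarrow> ('o, 'a, 'p, 'b) ofunctor
    \<Rightarrow> ('o, 'a, 'p, 'b) ofunctor \<Rightarrow> ('o \<Rightarrow> 'b) \<Rightarrow> bool" where
  "nat_trans C D F G \<tau> \<longleftrightarrow>
     (\<forall>X\<in>Obj C. \<tau> X \<in> homset D (onObj F X) (onObj G X)) \<and>
     (\<forall>f\<in>Arr C. Comp D (\<tau> (Cod C f)) (onArr F f) = Comp D (onArr G f) (\<tau> (Dom C f)))"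

subsection \<open>Commutative squares\<close>

text \<open>\<open>Square f g h k\<close> is the arrow \<open>(h, k) : f \<rightarrow> g\<close> of the arrow category, with \<open>k \<circ> f = g \<circ> h\<close>.\<close>

datatype 'a square = Square (sdom: 'a) (scod: 'a) (stop: 'a) (sbot: 'a)

definition arrow_cat :: "('o, 'a) ordcat \<Rightarrow> ('a, 'a square) ordcat" where
  "arrow_cat C =
     \<lparr>Obj = Arr C,
      Arr = {Square f g h k | f g h k. f \<in> Arr C \<and> g \<in> Arr C \<and>
               h \<in> homset C (Dom C f) (Dom C g) \<and> k \<in> homset C (Cod C f) (Cod C g) \<and>
               Comp C k f = Comp C g h},
      Dom = sdom, Cod = scod,
      Idt = (\<lambda>f. Square f f (Idt C (Dom C f)) (Idt C (Cod C f))),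
      Comp = (\<lambda>t s. Square (sdom s) (scod t) (Comp C (stop t) (stop s)) (Comp C (sbot t) (sbot s))),
      Le = (\<lambda>s t. Le C (stop s) (stop t) \<and> Le C (sbot s) (sbot t))\<rparr>"

subsection \<open>The category of small posets\<close>

text \<open>A poset is given by its order relation \<open>r\<close>, whose carrier is \<open>Field r\<close>. The elements are drawn
  from an arbitrary type \<open>'x\<close>; as soon as \<open>'x\<close> is at least as large as \<open>'u\<close> this is, up to
  equivalence, the category of all small posets.\<close>

datatype ('s, 'x) smap = SMap (src: 's) (tgt: 's) (fn: "'x \<Rightarrow> 'x")

definition Ord_cat :: "'u itself \<Rightarrow> ('x rel, ('x rel, 'x) smap) ordcat" where
  "Ord_cat U =
     \<lparr>Obj = {r. Partial_order r \<and> small U (Field r)},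
      Arr = {SMap r s h | r s h. Partial_order r \<and> small U (Field r) \<and>
               Partial_order s \<and> small U (Field s) \<and>
               h \<in> extensional (Field r) \<and> (\<forall>(x, y)\<in>r. (h x, h y) \<in> s)},
      Dom = src, Cod = tgt,
      Idt = (\<lambda>r. SMap r r (\<lambda>x\<in>Field r. x)),
      Comp = (\<lambda>g f. SMap (src f) (tgt g) (compose (Field (src f)) (fn g) (fn f))),
      Le = (\<lambda>f g. \<forall>x\<in>Field (src f). (fn f x, fn g x) \<in> tgt f)\<rparr>"

subsection \<open>Weighted colimits\<close>

text \<open>A cocone with weight \<open>W : D\<^sup>o\<^sup>p \<rightarrow> Ord\<close> and vertex \<open>c\<close> on \<open>G : D \<rightarrow> X\<close> is a natural
  transformation \<open>\<kappa> : W \<Rightarrow> X(G -, c)\<close>.\<close>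

definition weighted_cocone :: "('d, 'e) ordcat \<Rightarrow> ('d, 'e, 'w rel, ('w rel, 'w) smap) ofunctor
    \<Rightarrow> ('o, 'a) ordcat \<Rightarrow> ('d, 'e, 'o, 'a) ofunctor \<Rightarrow> 'o \<Rightarrow> ('d \<Rightarrow> 'w \<Rightarrow> 'a) \<Rightarrow> bool" where
  "weighted_cocone D W X G c \<kappa> \<longleftrightarrow> c \<in> Obj X \<and>
     (\<forall>d\<in>Obj D. \<forall>x\<in>Field (onObj W d). \<kappa> d x \<in> homset X (onObj G d) c) \<and>
     (\<forall>d\<in>Obj D. \<forall>(x, y)\<in>onObj W d. Le X (\<kappa> d x) (\<kappa> d y)) \<and>
     (\<forall>e\<in>Arr D. \<forall>x\<in>Field (onObj W (Cod D e)).
        \<kappa> (Dom D e) (fn (onArr W e) x) = Comp X (\<kappa> (Cod D e) x) (onArr G e))"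

text \<open>Universality: composing with \<open>\<kappa>\<close> is an isomorphism of posets from \<open>X(c, c')\<close> to
  \<open>[D\<^sup>o\<^sup>p, Ord](W, X(G -, c'))\<close> for every \<open>c'\<close>.\<close>

definition weighted_colimit :: "('d, 'e) ordcat \<Rightarrow> ('d, 'e, 'w rel, ('w rel, 'w) smap) ofunctor
    \<Rightarrow> ('o, 'a) ordcat \<Rightarrow> ('d, 'e, 'o, 'a) ofunctor \<Rightarrow> 'o \<Rightarrow> ('d \<Rightarrow> 'w \<Rightarrow> 'a) \<Rightarrow> bool" where
  "weighted_colimit D W X G c \<kappa> \<longleftrightarrow> weighted_cocone D W X G c \<kappa> \<and>
     (\<forall>c' \<kappa>'. weighted_cocone D W X G c' \<kappa>' \<longrightarrow>
        (\<exists>!u. u \<in> homset X c c' \<and>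
           (\<forall>d\<in>Obj D. \<forall>x\<in>Field (onObj W d). \<kappa>' d x = Comp X u (\<kappa> d x)))) \<and>
     (\<forall>c'\<in>Obj X. \<forall>u\<in>homset X c c'. \<forall>v\<in>homset X c c'.
        (\<forall>d\<in>Obj D. \<forall>x\<in>Field (onObj W d). Le X (Comp X u (\<kappa> d x)) (Comp X v (\<kappa> d x)))
        \<longrightarrow> Le X u v)"

definition cocontinuous :: "'u itself \<Rightarrow> ('o, 'a) ordcat \<Rightarrow> ('p, 'b) ordcat
    \<Rightarrow> ('o, 'a, 'p, 'b) ofunctor \<Rightarrow> bool" where
  "cocontinuous (U :: 'u itself) X Y T \<longleftrightarrow>
     (\<forall>(D :: ('u, 'u) ordcat) (W :: ('u, 'u, 'u rel, ('u rel, 'u) smap) ofunctor) G c \<kappa>.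
        ord_category D \<and> small_cat U D \<and> ord_functor (op_cat D) (Ord_cat U) W \<and>
        ord_functor D X G \<and> weighted_colimit D W X G c \<kappa> \<longrightarrow>
        weighted_colimit D W Y (fcomp T G) (onObj T c) (\<lambda>d x. onArr T (\<kappa> d x)))"

section \<open>Monads, comonads and distributive laws\<close>

locale ord_monad =
  fixes C :: "('o, 'a) ordcat" and T :: "('o, 'a, 'o, 'a) ofunctor" and \<eta> \<mu> :: "'o \<Rightarrow> 'a"
  assumes functor_T: "ord_functor C C T"
    and unit_nat: "nat_trans C C fid T \<eta>"
    and mult_nat: "nat_trans C C (fcomp T T) T \<mu>"
    and unit_left: "X \<in> Obj C \<Longrightarrow> Comp C (\<mu> X) (\<eta> (onObj T X)) = Idt C (onObj T X)"
    and unit_right: "X \<in> Obj C \<Longrightarrow> Comp C (\<mu> X) (onArr T (\<eta> X)) = Idt C (onObj T X)"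
    and mult_assoc: "X \<in> Obj C \<Longrightarrow>
      Comp C (\<mu> X) (\<mu> (onObj T X)) = Comp C (\<mu> X) (onArr T (\<mu> X))"

locale ord_comonad =
  fixes C :: "('o, 'a) ordcat" and G :: "('o, 'a, 'o, 'a) ofunctor" and \<epsilon> \<delta> :: "'o \<Rightarrow> 'a"
  assumes functor_G: "ord_functor C C G"
    and counit_nat: "nat_trans C C G fid \<epsilon>"
    and comult_nat: "nat_trans C C G (fcomp G G) \<delta>"
    and counit_left: "X \<in> Obj C \<Longrightarrow> Comp C (\<epsilon> (onObj G X)) (\<delta> X) = Idt C (onObj G X)"
    and counit_right: "X \<in> Obj C \<Longrightarrow> Comp C (onArr G (\<epsilon> X)) (\<delta> X) = Idt C (onObj G X)"
    and comult_assoc: "X \<in> Obj C \<Longrightarrow>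
      Comp C (\<delta> (onObj G X)) (\<delta> X) = Comp C (onArr G (\<delta> X)) (\<delta> X)"

text \<open>A mixed distributive law \<open>\<lambda> : G T \<Rightarrow> T G\<close> of the comonad \<open>G\<close> over the monad \<open>T\<close>.\<close>

locale mixed_distributive_law =
  fixes C :: "('o, 'a) ordcat" and G :: "('o, 'a, 'o, 'a) ofunctor" and \<epsilon> \<delta> :: "'o \<Rightarrow> 'a"
    and T :: "('o, 'a, 'o, 'a) ofunctor" and \<eta> \<mu> :: "'o \<Rightarrow> 'a" and l :: "'o \<Rightarrow> 'a"
  assumes law_nat: "nat_trans C C (fcomp G T) (fcomp T G) l"
    and law_unit: "X \<in> Obj C \<Longrightarrow> Comp C (l X) (onArr G (\<eta> X)) = \<eta> (onObj G X)"
    and law_mult: "X \<in> Obj C \<Longrightarrow> Comp C (l X) (onArr G (\<mu> X)) =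
      Comp C (\<mu> (onObj G X)) (Comp C (onArr T (l X)) (l (onObj T X)))"
    and law_counit: "X \<in> Obj C \<Longrightarrow> Comp C (onArr T (\<epsilon> X)) (l X) = \<epsilon> (onObj T X)"
    and law_comult: "X \<in> Obj C \<Longrightarrow> Comp C (onArr T (\<delta> X)) (l X) =
      Comp C (l (onObj G X)) (Comp C (onArr G (l X)) (\<delta> (onObj T X)))"

definition em_algebra :: "('o, 'a) ordcat \<Rightarrow> ('o, 'a, 'o, 'a) ofunctor \<Rightarrow> ('o \<Rightarrow> 'a) \<Rightarrow> ('o \<Rightarrow> 'a)
    \<Rightarrow> 'o \<Rightarrow> 'a \<Rightarrow> bool" where
  "em_algebra C T \<eta> \<mu> X a \<longleftrightarrow> X \<in> Obj C \<and> a \<in> homset C (onObj T X) X \<and>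
     Comp C a (\<eta> X) = Idt C X \<and> Comp C a (\<mu> X) = Comp C a (onArr T a)"

section \<open>Algebraic weak factorisation systems\<close>

text \<open>\<open>KF\<close> sends \<open>f\<close> to the middle object of its factorisation and \<open>(h, k) : f \<rightarrow> g\<close> to the
  induced arrow \<open>K(h, k) : Kf \<rightarrow> Kg\<close>; \<open>comul f\<close> and \<open>mul f\<close> are \<open>\<sigma>\<^sub>f : Kf \<rightarrow> KLf\<close> and
  \<open>\<pi>\<^sub>f : KRf \<rightarrow> Kf\<close>.\<close>

record ('o, 'a) awfs =
  KF :: "('a, 'a square, 'o, 'a) ofunctor"
  Lm :: "'a \<Rightarrow> 'a"
  Rm :: "'a \<Rightarrow> 'a"
  comul :: "'a \<Rightarrow> 'a"
  mul :: "'a \<Rightarrow> 'a"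

definition L_functor :: "('o, 'a) awfs \<Rightarrow> ('a, 'a square, 'a, 'a square) ofunctor" where
  "L_functor W = \<lparr>onObj = Lm W,
     onArr = (\<lambda>s. Square (Lm W (sdom s)) (Lm W (scod s)) (stop s) (onArr (KF W) s))\<rparr>"

definition R_functor :: "('o, 'a) awfs \<Rightarrow> ('a, 'a square, 'a, 'a square) ofunctor" where
  "R_functor W = \<lparr>onObj = Rm W,
     onArr = (\<lambda>s. Square (Rm W (sdom s)) (Rm W (scod s)) (onArr (KF W) s) (sbot s))\<rparr>"

definition Phi :: "('o, 'a) ordcat \<Rightarrow> ('o, 'a) awfs \<Rightarrow> 'a \<Rightarrow> 'a square" where
  "Phi C W f = Square (Lm W f) f (Idt C (Dom C f)) (Rm W f)"

definition Lambda :: "('o, 'a) ordcat \<Rightarrow> ('o, 'a) awfs \<Rightarrow> 'a \<Rightarrow> 'a square" where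
  "Lambda C W f = Square f (Rm W f) (Lm W f) (Idt C (Cod C f))"

definition Sigma_sq :: "('o, 'a) ordcat \<Rightarrow> ('o, 'a) awfs \<Rightarrow> 'a \<Rightarrow> 'a square" where
  "Sigma_sq C W f = Square (Lm W f) (Lm W (Lm W f)) (Idt C (Dom C f)) (comul W f)"

definition Pi_sq :: "('o, 'a) ordcat \<Rightarrow> ('o, 'a) awfs \<Rightarrow> 'a \<Rightarrow> 'a square" where
  "Pi_sq C W f = Square (Rm W (Rm W f)) (Rm W f) (mul W f) (Idt C (Cod C f))"

definition Delta_sq :: "('o, 'a) awfs \<Rightarrow> 'a \<Rightarrow> 'a square" where
  "Delta_sq W f = Square (Lm W (Rm W f)) (Rm W (Lm W f)) (comul W f) (mul W f)"

locale ord_awfs =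
  fixes C :: "('o, 'a) ordcat" and W :: "('o, 'a) awfs"
  assumes functor_K: "ord_functor (arrow_cat C) C (KF W)"
    and L_hom: "f \<in> Arr C \<Longrightarrow> Lm W f \<in> homset C (Dom C f) (onObj (KF W) f)"
    and R_hom: "f \<in> Arr C \<Longrightarrow> Rm W f \<in> homset C (onObj (KF W) f) (Cod C f)"
    and factorisation: "f \<in> Arr C \<Longrightarrow> Comp C (Rm W f) (Lm W f) = f"
    and L_comonad: "ord_comonad (arrow_cat C) (L_functor W) (Phi C W) (Sigma_sq C W)"
    and R_monad: "ord_monad (arrow_cat C) (R_functor W) (Lambda C W) (Pi_sq C W)"
    and distributive: "mixed_distributive_law (arrow_cat C)
      (L_functor W) (Phi C W) (Sigma_sq C W) (R_functor W) (Lambda C W) (Pi_sq C W) (Delta_sq W)"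

definition cocontinuous_awfs :: "'u itself \<Rightarrow> ('o, 'a) ordcat \<Rightarrow> ('o, 'a) awfs \<Rightarrow> bool" where
  "cocontinuous_awfs U C W \<longleftrightarrow> cocontinuous U (arrow_cat C) (arrow_cat C) (R_functor W)"

section \<open>Internal categories in Ord-categories\<close>

text \<open>\<open>Hor\<close> is the Ord-category of objects, \<open>Ver\<close> the Ord-category of arrows; the composition
  functor \<open>VComp\<close> is defined on the pullback \<open>composable\<close>, with \<open>(j, i)\<close> sent to \<open>j \<bullet> i\<close>.\<close>

record ('v, 'va, 'o, 'a) intcat =
  Ver :: "('v, 'va) ordcat"
  Hor :: "('o, 'a) ordcat"
  VDom :: "('v, 'va, 'o, 'a) ofunctor"
  VCod :: "('v, 'va, 'o, 'a) ofunctor"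
  VIdt :: "('o, 'a, 'v, 'va) ofunctor"
  VComp :: "('v \<times> 'v, 'va \<times> 'va, 'v, 'va) ofunctor"

definition composable :: "('v, 'va, 'o, 'a) intcat \<Rightarrow> ('v \<times> 'v, 'va \<times> 'va) ordcat" where
  "composable J =
     \<lparr>Obj = {(j, i). j \<in> Obj (Ver J) \<and> i \<in> Obj (Ver J) \<and> onObj (VCod J) i = onObj (VDom J) j},
      Arr = {(b, a). b \<in> Arr (Ver J) \<and> a \<in> Arr (Ver J) \<and> onArr (VCod J) a = onArr (VDom J) b},
      Dom = map_prod (Dom (Ver J)) (Dom (Ver J)), Cod = map_prod (Cod (Ver J)) (Cod (Ver J)),
      Idt = map_prod (Idt (Ver J)) (Idt (Ver J)),
      Comp = (\<lambda>(b', a') (b, a). (Comp (Ver J) b' b, Comp (Ver J) a' a)),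
      Le = (\<lambda>(b, a) (b', a'). Le (Ver J) b b' \<and> Le (Ver J) a a')\<rparr>"

definition fpair :: "('o, 'a, 'p, 'b) ofunctor \<Rightarrow> ('o \<times> 'o, 'a \<times> 'a, 'p \<times> 'p, 'b \<times> 'b) ofunctor" where
  "fpair F = \<lparr>onObj = map_prod (onObj F) (onObj F), onArr = map_prod (onArr F) (onArr F)\<rparr>"

locale internal_category =
  fixes J :: "('v, 'va, 'o, 'a) intcat"
  assumes cat_Ver: "ord_category (Ver J)"
    and cat_Hor: "ord_category (Hor J)"
    and functor_VDom: "ord_functor (Ver J) (Hor J) (VDom J)"
    and functor_VCod: "ord_functor (Ver J) (Hor J) (VCod J)"
    and functor_VIdt: "ord_functor (Hor J) (Ver J) (VIdt J)"
    and functor_VComp: "ord_functor (composable J) (Ver J) (VComp J)"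
    and vdom_vidt: "feq (Hor J) (fcomp (VDom J) (VIdt J)) fid"
    and vcod_vidt: "feq (Hor J) (fcomp (VCod J) (VIdt J)) fid"
    and vdom_vcomp_obj: "(j, i) \<in> Obj (composable J) \<Longrightarrow>
      onObj (VDom J) (onObj (VComp J) (j, i)) = onObj (VDom J) i"
    and vdom_vcomp_arr: "(b, a) \<in> Arr (composable J) \<Longrightarrow>
      onArr (VDom J) (onArr (VComp J) (b, a)) = onArr (VDom J) a"
    and vcod_vcomp_obj: "(j, i) \<in> Obj (composable J) \<Longrightarrow>
      onObj (VCod J) (onObj (VComp J) (j, i)) = onObj (VCod J) j"
    and vcod_vcomp_arr: "(b, a) \<in> Arr (composable J) \<Longrightarrow>
      onArr (VCod J) (onArr (VComp J) (b, a)) = onArr (VCod J) b"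
    and vcomp_vidt_obj: "j \<in> Obj (Ver J) \<Longrightarrow>
      onObj (VComp J) (j, onObj (VIdt J) (onObj (VDom J) j)) = j"
    and vcomp_vidt_arr: "b \<in> Arr (Ver J) \<Longrightarrow>
      onArr (VComp J) (b, onArr (VIdt J) (onArr (VDom J) b)) = b"
    and vidt_vcomp_obj: "j \<in> Obj (Ver J) \<Longrightarrow>
      onObj (VComp J) (onObj (VIdt J) (onObj (VCod J) j), j) = j"
    and vidt_vcomp_arr: "b \<in> Arr (Ver J) \<Longrightarrow>
      onArr (VComp J) (onArr (VIdt J) (onArr (VCod J) b), b) = b"
    and vcomp_assoc_obj: "\<lbrakk>(k, j) \<in> Obj (composable J); (j, i) \<in> Obj (composable J)\<rbrakk> \<Longrightarrow>
      onObj (VComp J) (k, onObj (VComp J) (j, i)) = onObj (VComp J) (onObj (VComp J) (k, j), i)"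
    and vcomp_assoc_arr: "\<lbrakk>(c, b) \<in> Arr (composable J); (b, a) \<in> Arr (composable J)\<rbrakk> \<Longrightarrow>
      onArr (VComp J) (c, onArr (VComp J) (b, a)) = onArr (VComp J) (onArr (VComp J) (c, b), a)"

definition small_intcat :: "'u itself \<Rightarrow> ('v, 'va, 'o, 'a) intcat \<Rightarrow> bool" where
  "small_intcat U J \<longleftrightarrow> small_cat U (Ver J) \<and> small_cat U (Hor J)"

record ('v, 'va, 'o, 'a, 'w, 'wa, 'p, 'b) intfunctor =
  onVer :: "('v, 'va, 'w, 'wa) ofunctor"
  onHor :: "('o, 'a, 'p, 'b) ofunctor"

locale internal_functor =
  fixes J :: "('v, 'va, 'o, 'a) intcat" and K :: "('w, 'wa, 'p, 'b) intcat"
    and F :: "('v, 'va, 'o, 'a, 'w, 'wa, 'p, 'b) intfunctor"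
  assumes functor_onVer: "ord_functor (Ver J) (Ver K) (onVer F)"
    and functor_onHor: "ord_functor (Hor J) (Hor K) (onHor F)"
    and vdom_map: "feq (Ver J) (fcomp (VDom K) (onVer F)) (fcomp (onHor F) (VDom J))"
    and vcod_map: "feq (Ver J) (fcomp (VCod K) (onVer F)) (fcomp (onHor F) (VCod J))"
    and vidt_map: "feq (Hor J) (fcomp (VIdt K) (onHor F)) (fcomp (onVer F) (VIdt J))"
    and vcomp_map: "feq (composable J) (fcomp (VComp K) (fpair (onVer F))) (fcomp (onVer F) (VComp J))"

definition ifid :: "('v, 'va, 'o, 'a, 'v, 'va, 'o, 'a) intfunctor" where
  "ifid = \<lparr>onVer = fid, onHor = fid\<rparr>"

definition ifcomp :: "('w, 'wa, 'p, 'b, 'x, 'xa, 'q, 'c) intfunctor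
    \<Rightarrow> ('v, 'va, 'o, 'a, 'w, 'wa, 'p, 'b) intfunctor
    \<Rightarrow> ('v, 'va, 'o, 'a, 'x, 'xa, 'q, 'c) intfunctor" where
  "ifcomp G F = \<lparr>onVer = fcomp (onVer G) (onVer F), onHor = fcomp (onHor G) (onHor F)\<rparr>"

definition ifeq :: "('v, 'va, 'o, 'a) intcat \<Rightarrow> ('v, 'va, 'o, 'a, 'w, 'wa, 'p, 'b) intfunctor
    \<Rightarrow> ('v, 'va, 'o, 'a, 'w, 'wa, 'p, 'b) intfunctor \<Rightarrow> bool" where
  "ifeq J F G \<longleftrightarrow> feq (Ver J) (onVer F) (onVer G) \<and> feq (Hor J) (onHor F) (onHor G)"

text \<open>Isomorphism of internal categories \<open>A\<close> and \<open>B\<close> over a common base, to which they are mapped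
  by \<open>P\<close> and \<open>Q\<close>.\<close>

definition iso_over :: "('v, 'va, 'o, 'a) intcat \<Rightarrow> ('v, 'va, 'o, 'a, 'x, 'xa, 'q, 'c) intfunctor
    \<Rightarrow> ('w, 'wa, 'p, 'b) intcat \<Rightarrow> ('w, 'wa, 'p, 'b, 'x, 'xa, 'q, 'c) intfunctor \<Rightarrow> bool" where
  "iso_over A P B Q \<longleftrightarrow> (\<exists>T T'. internal_functor A B T \<and> internal_functor B A T' \<and>
     ifeq A (ifcomp T' T) ifid \<and> ifeq B (ifcomp T T') ifid \<and> ifeq A (ifcomp Q T) P)"

definition sq :: "('o, 'a) ordcat \<Rightarrow> ('a, 'a square, 'o, 'a) intcat" where
  "sq C =
     \<lparr>Ver = arrow_cat C, Hor = C,
      VDom = \<lparr>onObj = Dom C, onArr = stop\<rparr>, VCod = \<lparr>onObj = Cod C, onArr = sbot\<rparr>,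
      VIdt = \<lparr>onObj = Idt C, onArr = (\<lambda>h. Square (Idt C (Dom C h)) (Idt C (Cod C h)) h h)\<rparr>,
      VComp = \<lparr>onObj = (\<lambda>(g, f). Comp C g f),
        onArr = (\<lambda>(t, s). Square (Comp C (sdom t) (sdom s)) (Comp C (scod t) (scod s))
                  (stop s) (sbot t))\<rparr>\<rparr>"

section \<open>Arrows with structure\<close>

text \<open>All internal categories over \<open>sq C\<close> used below have as arrow part arrows \<open>f\<close> of \<open>C\<close> equipped
  with a structure \<open>p\<close>, and as morphisms those squares that preserve structure; the order on these is
  that of squares. Such an internal category is given by: which \<open>p\<close> are structures on \<open>f\<close>
  (\<open>carries\<close>), which squares preserve them (\<open>preserves\<close>), the structure of an identity and the
  structure of a composite \<open>g \<circ> f\<close> (\<open>comp_struct (g, q) (f, p)\<close>).\<close>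

record ('o, 'a, 'p) arrow_struct =
  carries :: "'a \<Rightarrow> 'p \<Rightarrow> bool"
  preserves :: "'a \<times> 'p \<Rightarrow> 'a \<times> 'p \<Rightarrow> 'a square \<Rightarrow> bool"
  idt_struct :: "'o \<Rightarrow> 'p"
  comp_struct :: "'a \<times> 'p \<Rightarrow> 'a \<times> 'p \<Rightarrow> 'p"

type_synonym ('a, 'p) strmor = "('a \<times> 'p) \<times> ('a \<times> 'p) \<times> 'a square"

definition struct_cat :: "('o, 'a) ordcat \<Rightarrow> ('o, 'a, 'p) arrow_struct
    \<Rightarrow> ('a \<times> 'p, ('a, 'p) strmor) ordcat" where
  "struct_cat C A =
     \<lparr>Obj = {(f, p). f \<in> Arr C \<and> carries A f p},
      Arr = {(x, y, s). fst x \<in> Arr C \<and> carries A (fst x) (snd x) \<and>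
               fst y \<in> Arr C \<and> carries A (fst y) (snd y) \<and>
               s \<in> homset (arrow_cat C) (fst x) (fst y) \<and> preserves A x y s},
      Dom = (\<lambda>(x, y, s). x), Cod = (\<lambda>(x, y, s). y),
      Idt = (\<lambda>x. (x, x, Idt (arrow_cat C) (fst x))),
      Comp = (\<lambda>(y', z, t) (x, y, s). (x, z, Comp (arrow_cat C) t s)),
      Le = (\<lambda>(x, y, s) (x', y', s'). Le (arrow_cat C) s s')\<rparr>"

definition struct_vcomp :: "('o, 'a) ordcat \<Rightarrow> ('o, 'a, 'p) arrow_struct \<Rightarrow> 'a \<times> 'p \<Rightarrow> 'a \<times> 'p \<Rightarrow> 'a \<times> 'p" where
  "struct_vcomp C A y x = (Comp C (fst y) (fst x), comp_struct A y x)"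

definition struct_intcat :: "('o, 'a) ordcat \<Rightarrow> ('o, 'a, 'p) arrow_struct
    \<Rightarrow> ('a \<times> 'p, ('a, 'p) strmor, 'o, 'a) intcat" where
  "struct_intcat C A =
     \<lparr>Ver = struct_cat C A, Hor = C,
      VDom = \<lparr>onObj = (\<lambda>(f, p). Dom C f), onArr = (\<lambda>(x, y, s). stop s)\<rparr>,
      VCod = \<lparr>onObj = (\<lambda>(f, p). Cod C f), onArr = (\<lambda>(x, y, s). sbot s)\<rparr>,
      VIdt = \<lparr>onObj = (\<lambda>X. (Idt C X, idt_struct A X)),
        onArr = (\<lambda>h. ((Idt C (Dom C h), idt_struct A (Dom C h)), (Idt C (Cod C h), idt_struct A (Cod C h)),
                  onArr (VIdt (sq C)) h))\<rparr>,
      VComp = \<lparr>onObj = (\<lambda>(y, x). struct_vcomp C A y x),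
        onArr = (\<lambda>((y, y', t), (x, x', s)). (struct_vcomp C A y x, struct_vcomp C A y' x',
                  onArr (VComp (sq C)) (t, s)))\<rparr>\<rparr>"

definition forget :: "('a \<times> 'p, ('a, 'p) strmor, 'o, 'a, 'a, 'a square, 'o, 'a) intfunctor" where
  "forget = \<lparr>onVer = \<lparr>onObj = fst, onArr = (\<lambda>(x, y, s). s)\<rparr>, onHor = fid\<rparr>"

subsection \<open>Algebras of an algebraic weak factorisation system\<close>

text \<open>An \<open>R\<close>-algebra structure on \<open>f\<close> is a square \<open>Rf \<rightarrow> f\<close>. Its codomain part is an identity by
  the unit law, so only the domain part \<open>p : Kf \<rightarrow> dom f\<close> is recorded.\<close>

definition alg_square :: "('o, 'a) ordcat \<Rightarrow> ('o, 'a) awfs \<Rightarrow> 'a \<times> 'a \<Rightarrow> 'a square" where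
  "alg_square C W = (\<lambda>(f, p). Square (Rm W f) f p (Idt C (Cod C f)))"

definition awfs_struct :: "('o, 'a) ordcat \<Rightarrow> ('o, 'a) awfs \<Rightarrow> ('o, 'a, 'a) arrow_struct" where
  "awfs_struct C W =
     \<lparr>carries = (\<lambda>f p. em_algebra (arrow_cat C) (R_functor W) (Lambda C W) (Pi_sq C W) f
                   (alg_square C W (f, p))),
      preserves = (\<lambda>x y s. Comp (arrow_cat C) s (alg_square C W x) =
                     Comp (arrow_cat C) (alg_square C W y) (onArr (R_functor W) s)),
      idt_struct = (\<lambda>X. Rm W (Idt C X)),
      comp_struct = (\<lambda>(g, q) (f, p).
        (let gf = Comp C g f;
             t = Comp C q (onArr (KF W) (Square gf g f (Idt C (Cod C g))))
         in Comp C p (Comp C (onArr (KF W) (Square (Lm W gf) f (Idt C (Dom C f)) t)) (comul W gf))))\<rparr>"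

definition rali_struct :: "('o, 'a) ordcat \<Rightarrow> ('o, 'a, 'a) arrow_struct" where
  "rali_struct C =
     \<lparr>carries = (\<lambda>f l. l \<in> homset C (Cod C f) (Dom C f) \<and> Comp C f l = Idt C (Cod C f) \<and>
                   Le C (Comp C l f) (Idt C (Dom C f))),
      preserves = (\<lambda>(f, l) (g, m) s. Comp C (stop s) l = Comp C m (sbot s)),
      idt_struct = Idt C,
      comp_struct = (\<lambda>(g, m) (f, l). Comp C l m)\<rparr>"

definition split_epi_struct :: "('o, 'a) ordcat \<Rightarrow> ('o, 'a, 'a) arrow_struct" where
  "split_epi_struct C =
     \<lparr>carries = (\<lambda>f l. l \<in> homset C (Cod C f) (Dom C f) \<and> Comp C f l = Idt C (Cod C f)),
      preserves = (\<lambda>(f, l) (g, m) s. Comp C (stop s) l = Comp C m (sbot s)),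
      idt_struct = Idt C,
      comp_struct = (\<lambda>(g, m) (f, l). Comp C l m)\<rparr>"

section \<open>Cofibrant generation\<close>

text \<open>Elements of hom-posets \<open>C(X, Y)\<close>, and of the posets \<open>C\<^sup>2(u, f)\<close> of squares from \<open>u\<close> to \<open>f\<close>.\<close>

datatype 'a hom_elem = HArr 'a | HSqr 'a 'a

definition hom_poset :: "('o, 'a) ordcat \<Rightarrow> 'o \<Rightarrow> 'o \<Rightarrow> 'a hom_elem rel" where
  "hom_poset C X Y = {(HArr h, HArr h') | h h'. h \<in> homset C X Y \<and> h' \<in> homset C X Y \<and> Le C h h'}"

definition sq_poset :: "('o, 'a) ordcat \<Rightarrow> 'a \<Rightarrow> 'a \<Rightarrow> 'a hom_elem rel" where
  "sq_poset C u f = {(HSqr h k, HSqr h' k') | h k h' k'.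
     Square u f h k \<in> Arr (arrow_cat C) \<and> Square u f h' k' \<in> Arr (arrow_cat C) \<and>
     Le (arrow_cat C) (Square u f h k) (Square u f h' k')}"

definition on_arr :: "('a \<Rightarrow> 'b) \<Rightarrow> 'a hom_elem \<Rightarrow> 'b" where
  "on_arr F e = (case e of HArr h \<Rightarrow> F h | HSqr h k \<Rightarrow> undefined)"

definition on_sqr :: "('a \<Rightarrow> 'a \<Rightarrow> 'b) \<Rightarrow> 'a hom_elem \<Rightarrow> 'b" where
  "on_sqr F e = (case e of HArr h \<Rightarrow> undefined | HSqr h k \<Rightarrow> F h k)"

type_synonym 'a hmap = "('a hom_elem rel, 'a hom_elem) smap"

definition hmap :: "'a hom_elem rel \<Rightarrow> 'a hom_elem rel \<Rightarrow> ('a hom_elem \<Rightarrow> 'a hom_elem) \<Rightarrow> 'a hmap" where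
  "hmap r s h = SMap r s (restrict h (Field r))"

text \<open>The comparison map \<open>C(cod u, dom f) \<rightarrow> C\<^sup>2(u, f)\<close> and its functoriality in
  \<open>t : u' \<rightarrow> u\<close> and \<open>s : f \<rightarrow> f'\<close>.\<close>

definition comparison :: "('o, 'a) ordcat \<Rightarrow> 'a \<Rightarrow> 'a \<Rightarrow> 'a hmap" where
  "comparison C u f = hmap (hom_poset C (Cod C u) (Dom C f)) (sq_poset C u f)
     (on_arr (\<lambda>d. HSqr (Comp C d u) (Comp C f d)))"

definition comparison_sq :: "('o, 'a) ordcat \<Rightarrow> 'a square \<Rightarrow> 'a square \<Rightarrow> 'a hmap square" where
  "comparison_sq C t s = Square (comparison C (scod t) (sdom s)) (comparison C (sdom t) (scod s))
     (hmap (hom_poset C (Cod C (scod t)) (Dom C (sdom s))) (hom_poset C (Cod C (sdom t)) (Dom C (scod s)))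
        (on_arr (\<lambda>d. HArr (Comp C (stop s) (Comp C d (sbot t))))))
     (hmap (sq_poset C (scod t) (sdom s)) (sq_poset C (sdom t) (scod s))
        (on_sqr (\<lambda>h k. HSqr (Comp C (stop s) (Comp C h (stop t))) (Comp C (sbot s) (Comp C k (sbot t))))))"

text \<open>\<open>comparison (v \<circ> u) f\<close> is \<open>comparison v f\<close> followed by a map \<open>C\<^sup>2(v, f) \<rightarrow> C\<^sup>2(v \<circ> u, f)\<close>
  which is a pullback of \<open>comparison u f\<close>; and \<open>comparison u (g \<circ> f)\<close> is \<open>comparison u f\<close>
  followed by a map \<open>C\<^sup>2(u, f) \<rightarrow> C\<^sup>2(u, g \<circ> f)\<close> which is a pullback of \<open>comparison u g\<close>.
  These are the two pullback squares.\<close>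

definition pre_pullback :: "('o, 'a) ordcat \<Rightarrow> 'a \<Rightarrow> 'a \<Rightarrow> 'a \<Rightarrow> 'a hmap square" where
  "pre_pullback C v u f = Square
     (hmap (sq_poset C v f) (sq_poset C (Comp C v u) f) (on_sqr (\<lambda>h k. HSqr (Comp C h u) k)))
     (comparison C u f)
     (hmap (sq_poset C v f) (hom_poset C (Cod C u) (Dom C f)) (on_sqr (\<lambda>h k. HArr h)))
     (hmap (sq_poset C (Comp C v u) f) (sq_poset C u f) (on_sqr (\<lambda>h k. HSqr h (Comp C k v))))"

definition post_pullback :: "('o, 'a) ordcat \<Rightarrow> 'a \<Rightarrow> 'a \<Rightarrow> 'a \<Rightarrow> 'a hmap square" where
  "post_pullback C u g f = Square
     (hmap (sq_poset C u f) (sq_poset C u (Comp C g f)) (on_sqr (\<lambda>h k. HSqr h (Comp C g k))))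
     (comparison C u g)
     (hmap (sq_poset C u f) (hom_poset C (Cod C u) (Dom C g)) (on_sqr (\<lambda>h k. HArr k)))
     (hmap (sq_poset C u (Comp C g f)) (sq_poset C u g) (on_sqr (\<lambda>h k. HSqr (Comp C f h) k)))"

text \<open>If \<open>s : f \<rightarrow> g\<close> is a pullback square and \<open>q\<close> is a structure on \<open>g\<close>, the pullback of \<open>q\<close>
  along \<open>s\<close> is the unique structure on \<open>f\<close> for which \<open>s\<close> preserves structure.\<close>

definition pulled_back :: "('o, 'a, 'p) arrow_struct \<Rightarrow> 'a square \<Rightarrow> 'p \<Rightarrow> 'a \<times> 'p" where
  "pulled_back A s q =
     (sdom s, THE p. carries A (sdom s) p \<and> preserves A (sdom s, p) (scod s, q) s)"

text \<open>The internal category \<open>J\<close> \<open>\<pitchfork>\<pitchfork>\<^sub>M\<close> for an internal functor \<open>P : J \<rightarrow> sq C\<close> and a structure \<open>M\<close>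
  on arrows of \<open>Ord\<close>. An \<open>M\<close>-algebra in presheaves (for \<open>M\<close> extended pointwise) is a family of
  algebras such that the action of each arrow of the indexing category preserves structure; thus a
  structure on \<open>f\<close> is a family \<open>\<phi>\<close>, with \<open>\<phi> j\<close> an \<open>M\<close>-structure on \<open>comparison (P j) f\<close>. For
  an identity \<open>f\<close> this comparison map is invertible and so carries just one structure.\<close>

definition lift_struct :: "('o, 'a) ordcat \<Rightarrow> ('a hom_elem rel, 'a hmap, 'p) arrow_struct
    \<Rightarrow> ('v, 'va, 'x, 'xa) intcat \<Rightarrow> ('v, 'va, 'x, 'xa, 'a, 'a square, 'o, 'a) intfunctor
    \<Rightarrow> ('o, 'a, 'v \<Rightarrow> 'p) arrow_struct" where
  "lift_struct C M J P =
    (let u = onObj (onVer P); c = (\<lambda>j f. comparison C (u j) f) in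
     \<lparr>carries = (\<lambda>f \<phi>. \<phi> \<in> extensional (Obj (Ver J)) \<and>
        (\<forall>j\<in>Obj (Ver J). carries M (c j f) (\<phi> j)) \<and>
        (\<forall>a\<in>Arr (Ver J). preserves M
           (c (Cod (Ver J) a) f, \<phi> (Cod (Ver J) a)) (c (Dom (Ver J) a) f, \<phi> (Dom (Ver J) a))
           (comparison_sq C (onArr (onVer P) a) (Idt (arrow_cat C) f))) \<and>
        (\<forall>(j, i)\<in>Obj (composable J). \<phi> (onObj (VComp J) (j, i)) =
           comp_struct M (pulled_back M (pre_pullback C (u j) (u i) f) (\<phi> i)) (c j f, \<phi> j))),
      preserves = (\<lambda>(f, \<phi>) (g, \<psi>) s. \<forall>j\<in>Obj (Ver J).
        preserves M (c j f, \<phi> j) (c j g, \<psi> j) (comparison_sq C (Idt (arrow_cat C) (u j)) s)),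
      idt_struct = (\<lambda>X. \<lambda>j\<in>Obj (Ver J). THE p. carries M (c j (Idt C X)) p),
      comp_struct = (\<lambda>(g, \<psi>) (f, \<phi>). \<lambda>j\<in>Obj (Ver J).
        comp_struct M (pulled_back M (post_pullback C (u j) g f) (\<psi> j)) (c j f, \<phi> j))\<rparr>)"

text \<open>Every small internal category is isomorphic to one whose objects and arrows are elements of
  \<open>'u\<close>. In \<open>A\<close> we pass the structure of arrows of \<open>C\<close> (such as \<open>R\<close>-algebra structure) and in
  \<open>M\<close> that of arrows of \<open>Ord\<close>.\<close>

definition cofibrantly_generated :: "'u itself \<Rightarrow> ('o, 'a) ordcat \<Rightarrow> ('o, 'a, 'q) arrow_struct
    \<Rightarrow> ('a hom_elem rel, 'a hmap, 'p) arrow_struct \<Rightarrow> bool" where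
  "cofibrantly_generated (U :: 'u itself) C A M \<longleftrightarrow>
     (\<exists>(J :: ('u, 'u, 'u, 'u) intcat) P.
        internal_category J \<and> small_intcat U J \<and> internal_functor J (sq C) P \<and>
        iso_over (struct_intcat C A) forget (struct_intcat C (lift_struct C M J P)) forget)"

definition has_rlp :: "('o, 'a) ordcat \<Rightarrow> 'a \<Rightarrow> 'a \<Rightarrow> bool" where
  "has_rlp C i f \<longleftrightarrow> (\<forall>h k. Square i f h k \<in> Arr (arrow_cat C) \<longrightarrow>
     (\<exists>d\<in>homset C (Cod C i) (Dom C f). Comp C d i = h \<and> Comp C f d = k))"

section \<open>The filter monad on T0 spaces\<close>

definition specialises :: "'b topology \<Rightarrow> 'b \<Rightarrow> 'b \<Rightarrow> bool" where
  "specialises X x y \<longleftrightarrow> (\<forall>V. openin X V \<and> x \<in> V \<longrightarrow> y \<in> V)"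

text \<open>Arrows are ordered by the opposite of the pointwise specialisation order.\<close>

definition Top0 :: "'u itself \<Rightarrow> ('u topology, ('u topology, 'u) smap) ordcat" where
  "Top0 U =
     \<lparr>Obj = {X. t0_space X \<and> small U (topspace X)},
      Arr = {SMap X Y h | X Y h. t0_space X \<and> small U (topspace X) \<and>
               t0_space Y \<and> small U (topspace Y) \<and>
               h \<in> extensional (topspace X) \<and> continuous_map X Y h},
      Dom = src, Cod = tgt,
      Idt = (\<lambda>X. SMap X X (\<lambda>x\<in>topspace X. x)),
      Comp = (\<lambda>g f. SMap (src f) (tgt g) (compose (topspace (src f)) (fn g) (fn f))),
      Le = (\<lambda>f g. \<forall>x\<in>topspace (src f). specialises (tgt f) (fn g x) (fn f x))\<rparr>"

definition open_filters :: "'b topology \<Rightarrow> 'b set set set" where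
  "open_filters X = {\<phi>. \<phi> \<subseteq> {V. openin X V} \<and> topspace X \<in> \<phi> \<and>
     (\<forall>V\<in>\<phi>. \<forall>W. openin X W \<and> V \<subseteq> W \<longrightarrow> W \<in> \<phi>) \<and> (\<forall>V\<in>\<phi>. \<forall>W\<in>\<phi>. V \<inter> W \<in> \<phi>)}"

definition sharp :: "'b topology \<Rightarrow> 'b set \<Rightarrow> 'b set set set" where
  "sharp X V = {\<phi> \<in> open_filters X. V \<in> \<phi>}"

definition filter_space :: "'b topology \<Rightarrow> 'b set set topology" where
  "filter_space X = topology_generated_by {sharp X V | V. openin X V}"

definition filter_map :: "'b topology \<Rightarrow> 'c topology \<Rightarrow> ('b \<Rightarrow> 'c) \<Rightarrow> 'b set set \<Rightarrow> 'c set set" where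
  "filter_map X Y h \<phi> = {V. openin Y V \<and> {x \<in> topspace X. h x \<in> V} \<in> \<phi>}"

definition filter_unit :: "'b topology \<Rightarrow> 'b \<Rightarrow> 'b set set" where
  "filter_unit X x = {V. openin X V \<and> x \<in> V}"

definition filter_mult :: "'b topology \<Rightarrow> 'b set set set set \<Rightarrow> 'b set set" where
  "filter_mult X \<Psi> = {V. openin X V \<and> sharp X V \<in> \<Psi>}"

subsection \<open>The induced lax orthogonal factorisation system\<close>

text \<open>\<open>K_space A B f\<close> is \<open>Kf\<close> for \<open>f : A \<rightarrow> B\<close>, with \<open>Lf = K_left A B f\<close> and \<open>Rf = snd\<close>.
  It is not literally an object of \<open>Top0\<close>, its points having a different type, but it is
  homeomorphic to one.\<close>

definition K_space :: "'b topology \<Rightarrow> 'c topology \<Rightarrow> ('b \<Rightarrow> 'c) \<Rightarrow> ('b set set \<times> 'c) topology" where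
  "K_space A B f = subtopology (prod_topology (filter_space A) B)
     {(\<phi>, b). filter_unit B b \<subseteq> filter_map A B f \<phi>}"

definition K_left :: "'b topology \<Rightarrow> 'c topology \<Rightarrow> ('b \<Rightarrow> 'c) \<Rightarrow> 'b \<Rightarrow> 'b set set \<times> 'c" where
  "K_left A B f a = (filter_unit A a, f a)"

text \<open>\<open>K_map A A' h k\<close> is \<open>K(h, k) : Kf \<rightarrow> Kg\<close> for a square \<open>(h, k)\<close> from \<open>f : A \<rightarrow> B\<close> to
  \<open>g : A' \<rightarrow> B'\<close>.\<close>

definition K_map :: "'b topology \<Rightarrow> 'c topology \<Rightarrow> ('b \<Rightarrow> 'c) \<Rightarrow> ('d \<Rightarrow> 'e)
    \<Rightarrow> 'b set set \<times> 'd \<Rightarrow> 'c set set \<times> 'e" where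
  "K_map A A' h k = (\<lambda>(\<phi>, b). (filter_map A A' h \<phi>, k b))"

text \<open>The comultiplication \<open>\<sigma>\<^sub>f : Kf \<rightarrow> KLf\<close> is forced by the counit laws; the multiplication
  \<open>\<pi>\<^sub>f : KRf \<rightarrow> Kf\<close> is induced by \<open>\<mu>\<^sub>A \<circ> F(fst) : F(Kf) \<rightarrow> F(A)\<close>.\<close>

definition K_comult :: "'b set set \<times> 'c \<Rightarrow> 'b set set \<times> 'b set set \<times> 'c" where
  "K_comult = (\<lambda>(\<phi>, b). (\<phi>, (\<phi>, b)))"

definition K_mult :: "'b topology \<Rightarrow> 'c topology \<Rightarrow> ('b \<Rightarrow> 'c)
    \<Rightarrow> ('b set set \<times> 'c) set set \<times> 'c \<Rightarrow> 'b set set \<times> 'c" where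
  "K_mult A B f = (\<lambda>(\<Psi>, b).
     (filter_mult A (filter_map (K_space A B f) (filter_space A) fst \<Psi>), b))"

text \<open>Algebras for the pointed endofunctor and for the monad underlying \<open>R\<close>; as before only the
  domain part \<open>p : Kf \<rightarrow> A\<close> of the structure is recorded.\<close>

definition pointed_algebra :: "'b topology \<Rightarrow> 'c topology \<Rightarrow> ('b \<Rightarrow> 'c) \<Rightarrow> ('b set set \<times> 'c \<Rightarrow> 'b) \<Rightarrow> bool" where
  "pointed_algebra A B f p \<longleftrightarrow> continuous_map (K_space A B f) A p \<and>
     (\<forall>z\<in>topspace (K_space A B f). f (p z) = snd z) \<and>
     (\<forall>a\<in>topspace A. p (K_left A B f a) = a)"

definition monad_algebra :: "'b topology \<Rightarrow> 'c topology \<Rightarrow> ('b \<Rightarrow> 'c) \<Rightarrow> ('b set set \<times> 'c \<Rightarrow> 'b) \<Rightarrow> bool" where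
  "monad_algebra A B f p \<longleftrightarrow> pointed_algebra A B f p \<and>
     (\<forall>z\<in>topspace (K_space (K_space A B f) B snd).
        p (K_mult A B f z) = p (K_map (K_space A B f) A p (\<lambda>b. b) z))"

definition filter_struct :: "('u topology, ('u topology, 'u) smap, 'u set set \<times> 'u \<Rightarrow> 'u) arrow_struct" where
  "filter_struct =
     \<lparr>carries = (\<lambda>f p. p \<in> extensional (topspace (K_space (src f) (tgt f) (fn f))) \<and>
        monad_algebra (src f) (tgt f) (fn f) p),
      preserves = (\<lambda>(f, p) (g, q) s. \<forall>z\<in>topspace (K_space (src f) (tgt f) (fn f)).
        fn (stop s) (p z) = q (K_map (src f) (src g) (fn (stop s)) (fn (sbot s)) z)),
      idt_struct = (\<lambda>X. restrict snd (topspace (K_space X X (\<lambda>x\<in>topspace X. x)))),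
      comp_struct = (\<lambda>(g, q) (f, p).
        restrict
          (\<lambda>z. p (K_map (src f) (src f) (\<lambda>a. a)
                 (\<lambda>w. q (K_map (src f) (src g) (fn f) (\<lambda>c. c) w)) (K_comult z)))
          (topspace (K_space (src f) (tgt g) (compose (topspace (src f)) (fn g) (fn f)))))\<rparr>"

definition filter_right_class :: "'u itself \<Rightarrow> ('u topology, 'u) smap set" where
  "filter_right_class U = {f \<in> Arr (Top0 U). \<exists>p. pointed_algebra (src f) (tgt f) (fn f) p}"

end

(* The space X is a long chain with a top point w that is both isolated and a limit of smaller
   points, so X is not a retract of its filter space. The initial segments of X with w added are
   continuous lattices, so their maps to the point are R-algebras, and the inclusions between them
   are algebra morphisms. If the chain is long compared with the domains and codomains of the
   generators, every square from a generator u to X -> 1 factors through a segment; hence the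
   comparison map of u with X -> 1 is the colimit of those with the segments. M-algebra structures
   pass to this colimit when the monad of (E,M) is cocontinuous, and so do compatibility with the
   morphisms of J and with its composition. Thus if R were generated by J, X -> 1 would be an
   R-algebra, which it is not. The same factorisation refutes generation by lifting properties. *)

theory Submission
  imports Defs
begin

section \<open>Arrow categories, pullbacks and colimits\<close>

lemma homsetD: "f \<in> homset C X Y \<Longrightarrow> f \<in> Arr C \<and> Dom C f = X \<and> Cod C f = Y"
  by (simp add: homset_def)

lemma homset_arr: "f \<in> homset C X Y \<Longrightarrow> f \<in> Arr C"
  by (simp add: homset_def)

lemma homset_self: "f \<in> Arr C \<Longrightarrow> f \<in> homset C (Dom C f) (Cod C f)"
  by (simp add: homset_def)

lemma arrow_cat_simps [simp]:
  "Obj (arrow_cat C) = Arr C" "Dom (arrow_cat C) = sdom" "Cod (arrow_cat C) = scod"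
  "Idt (arrow_cat C) f = Square f f (Idt C (Dom C f)) (Idt C (Cod C f))"
  "Comp (arrow_cat C) t s = Square (sdom s) (scod t) (Comp C (stop t) (stop s)) (Comp C (sbot t) (sbot s))"
  "Le (arrow_cat C) s t \<longleftrightarrow> Le C (stop s) (stop t) \<and> Le C (sbot s) (sbot t)"
  by (simp_all add: arrow_cat_def)

lemma Square_arr_iff:
  "Square f g h k \<in> Arr (arrow_cat C) \<longleftrightarrow> f \<in> Arr C \<and> g \<in> Arr C \<and>
     h \<in> homset C (Dom C f) (Dom C g) \<and> k \<in> homset C (Cod C f) (Cod C g) \<and>
     Comp C k f = Comp C g h"
  by (auto simp: arrow_cat_def)

lemma Square_hom_iff:
  "s \<in> homset (arrow_cat C) f g \<longleftrightarrow> sdom s = f \<and> scod s = g \<and> f \<in> Arr C \<and> g \<in> Arr C \<and>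
     stop s \<in> homset C (Dom C f) (Dom C g) \<and> sbot s \<in> homset C (Cod C f) (Cod C g) \<and>
     Comp C (sbot s) f = Comp C g (stop s)"
  by (cases s) (auto simp: homset_def[of "arrow_cat C"] Square_arr_iff)

lemma Square_homI:
  "\<lbrakk>f \<in> Arr C; g \<in> Arr C; h \<in> homset C (Dom C f) (Dom C g); k \<in> homset C (Cod C f) (Cod C g);
    Comp C k f = Comp C g h\<rbrakk> \<Longrightarrow> Square f g h k \<in> homset (arrow_cat C) f g"
  by (simp add: Square_hom_iff)

context ord_category
begin

abbreviation comp (infixl "\<cdot>" 70) where "g \<cdot> f \<equiv> Comp C g f"

lemma Idt_arr: "X \<in> Obj C \<Longrightarrow> Idt C X \<in> Arr C"
  and Dom_Idt: "X \<in> Obj C \<Longrightarrow> Dom C (Idt C X) = X"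
  and Cod_Idt: "X \<in> Obj C \<Longrightarrow> Cod C (Idt C X) = X"
  using idt_hom by (auto simp: homset_def)

lemma comp_arr:
  assumes "f \<in> Arr C" "g \<in> Arr C" "Dom C g = Cod C f"
  shows "g \<cdot> f \<in> Arr C" "Dom C (g \<cdot> f) = Dom C f" "Cod C (g \<cdot> f) = Cod C g"
  using comp_hom[of f "Dom C f" "Cod C f" g "Cod C g"] assms by (auto simp: homset_def)

lemma assoc_arr:
  "\<lbrakk>f \<in> Arr C; g \<in> Arr C; h \<in> Arr C; Dom C g = Cod C f; Dom C h = Cod C g\<rbrakk> \<Longrightarrow> h \<cdot> g \<cdot> f = h \<cdot> (g \<cdot> f)"
  using comp_assoc[of f "Dom C f" "Cod C f" g "Cod C g" h "Cod C h"] by (auto simp: homset_def)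

lemma id_right: "\<lbrakk>f \<in> Arr C; Dom C f = X\<rbrakk> \<Longrightarrow> f \<cdot> Idt C X = f"
  using comp_idt homset_self by fastforce

lemma id_left: "\<lbrakk>f \<in> Arr C; Cod C f = X\<rbrakk> \<Longrightarrow> Idt C X \<cdot> f = f"
  using idt_comp homset_self by fastforce

lemmas cat_simps = Idt_arr Dom_Idt Cod_Idt comp_arr assoc_arr id_right id_left dom_obj cod_obj

lemma arrow_category: "ord_category (arrow_cat C)"
proof
  fix f assume "f \<in> Arr (arrow_cat C)"
  then show "Dom (arrow_cat C) f \<in> Obj (arrow_cat C)" "Cod (arrow_cat C) f \<in> Obj (arrow_cat C)"
    "Le (arrow_cat C) f f"
    by (cases f; auto simp: Square_arr_iff homset_def le_refl)+
next
  fix X assume "X \<in> Obj (arrow_cat C)"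
  then show "Idt (arrow_cat C) X \<in> homset (arrow_cat C) X X"
    by (auto simp: Square_hom_iff cat_simps idt_hom)
next
  fix s X Y t Z assume "s \<in> homset (arrow_cat C) X Y" "t \<in> homset (arrow_cat C) Y Z"
  then obtain h k h' k' where st: "s = Square X Y h k" "t = Square Y Z h' k'"
    and 1: "X \<in> Arr C" "Y \<in> Arr C" "Z \<in> Arr C" "h \<in> homset C (Dom C X) (Dom C Y)" "k \<in> homset C (Cod C X) (Cod C Y)"
      "h' \<in> homset C (Dom C Y) (Dom C Z)" "k' \<in> homset C (Cod C Y) (Cod C Z)"
      "k \<cdot> X = Y \<cdot> h" "k' \<cdot> Y = Z \<cdot> h'"
    unfolding Square_hom_iff by (metis square.collapse)
  have "k' \<cdot> k \<cdot> X = k' \<cdot> (Y \<cdot> h)" using 1 by (simp add: homset_def assoc_arr)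
  also have "\<dots> = k' \<cdot> Y \<cdot> h" using 1(1-7) by (simp add: homset_def assoc_arr)
  also have "\<dots> = Z \<cdot> (h' \<cdot> h)" using 1 by (simp add: homset_def assoc_arr)
  finally show "Comp (arrow_cat C) t s \<in> homset (arrow_cat C) X Z"
    using 1 comp_hom by (auto simp: Square_hom_iff st)
next
  fix f X Y assume "f \<in> homset (arrow_cat C) X Y"
  then show "Comp (arrow_cat C) f (Idt (arrow_cat C) X) = f" "Comp (arrow_cat C) (Idt (arrow_cat C) Y) f = f"
    unfolding Square_hom_iff by (auto simp: comp_idt idt_comp square.expand)
next
  fix f W X g Y h Z
  assume "f \<in> homset (arrow_cat C) W X" "g \<in> homset (arrow_cat C) X Y" "h \<in> homset (arrow_cat C) Y Z"
  then show "Comp (arrow_cat C) h (Comp (arrow_cat C) g f) = Comp (arrow_cat C) (Comp (arrow_cat C) h g) f"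
    unfolding Square_hom_iff
    using comp_assoc[of "stop f" "Dom C W" "Dom C X" "stop g" "Dom C Y" "stop h" "Dom C Z"]
      comp_assoc[of "sbot f" "Cod C W" "Cod C X" "sbot g" "Cod C Y" "sbot h" "Cod C Z"] by simp
next
  fix f X Y g h
  assume 1: "f \<in> homset (arrow_cat C) X Y" "g \<in> homset (arrow_cat C) X Y" "h \<in> homset (arrow_cat C) X Y"
    "Le (arrow_cat C) f g" "Le (arrow_cat C) g h"
  then show "Le (arrow_cat C) f h"
    using le_trans[of "stop f" "Dom C X" "Dom C Y" "stop g" "stop h"]
      le_trans[of "sbot f" "Cod C X" "Cod C Y" "sbot g" "sbot h"] by (simp add: Square_hom_iff)
next
  fix f X Y g
  assume "f \<in> homset (arrow_cat C) X Y" "g \<in> homset (arrow_cat C) X Y"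
    "Le (arrow_cat C) f g" "Le (arrow_cat C) g f"
  then show "f = g"
    using le_antisym[of "stop f" "Dom C X" "Dom C Y" "stop g"]
      le_antisym[of "sbot f" "Cod C X" "Cod C Y" "sbot g"] by (simp add: Square_hom_iff square.expand)
next
  fix f X Y f' g Z g'
  assume "f \<in> homset (arrow_cat C) X Y" "f' \<in> homset (arrow_cat C) X Y"
    "g \<in> homset (arrow_cat C) Y Z" "g' \<in> homset (arrow_cat C) Y Z"
    "Le (arrow_cat C) f f'" "Le (arrow_cat C) g g'"
  then show "Le (arrow_cat C) (Comp (arrow_cat C) g f) (Comp (arrow_cat C) g' f')"
    using comp_mono[of "stop f" "Dom C X" "Dom C Y" "stop f'" "stop g" "Dom C Z" "stop g'"]
      comp_mono[of "sbot f" "Cod C X" "Cod C Y" "sbot f'" "sbot g" "Cod C Z" "sbot g'"]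
    by (simp add: Square_hom_iff)
qed

end

definition pullback_square :: "('o, 'a) ordcat \<Rightarrow> 'a square \<Rightarrow> bool" where
  "pullback_square C s \<longleftrightarrow> s \<in> Arr (arrow_cat C) \<and>
     (\<forall>Y. \<forall>x\<in>homset C Y (Cod C (sdom s)). \<forall>y\<in>homset C Y (Dom C (scod s)).
        Comp C (sbot s) x = Comp C (scod s) y \<longrightarrow>
        (\<exists>z\<in>homset C Y (Dom C (sdom s)). Comp C (sdom s) z = x \<and> Comp C (stop s) z = y)) \<and>
     (\<forall>Y. \<forall>z\<in>homset C Y (Dom C (sdom s)). \<forall>z'\<in>homset C Y (Dom C (sdom s)).
        Le C (Comp C (sdom s) z) (Comp C (sdom s) z') \<and> Le C (Comp C (stop s) z) (Comp C (stop s) z')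
        \<longrightarrow> Le C z z')"

definition poset_cocone :: "('o, 'a) ordcat \<Rightarrow> 'i rel \<Rightarrow> ('i \<Rightarrow> 'o) \<Rightarrow> ('i \<Rightarrow> 'i \<Rightarrow> 'a) \<Rightarrow> 'o \<Rightarrow> ('i \<Rightarrow> 'a) \<Rightarrow> bool" where
  "poset_cocone X r G t c \<kappa> \<longleftrightarrow> c \<in> Obj X \<and> (\<forall>a\<in>Field r. \<kappa> a \<in> homset X (G a) c) \<and>
     (\<forall>(a, b)\<in>r. Comp X (\<kappa> b) (t a b) = \<kappa> a)"

definition poset_diagram :: "('o, 'a) ordcat \<Rightarrow> 'i rel \<Rightarrow> ('i \<Rightarrow> 'o) \<Rightarrow> ('i \<Rightarrow> 'i \<Rightarrow> 'a) \<Rightarrow> bool" where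
  "poset_diagram X r G t \<longleftrightarrow> (\<forall>a\<in>Field r. G a \<in> Obj X \<and> t a a = Idt X (G a)) \<and>
     (\<forall>(a, b)\<in>r. t a b \<in> homset X (G a) (G b)) \<and>
     (\<forall>(a, b)\<in>r. \<forall>c. (b, c) \<in> r \<longrightarrow> Comp X (t b c) (t a b) = t a c)"

definition poset_colimit :: "('o, 'a) ordcat \<Rightarrow> 'i rel \<Rightarrow> ('i \<Rightarrow> 'o) \<Rightarrow> ('i \<Rightarrow> 'i \<Rightarrow> 'a) \<Rightarrow> 'o \<Rightarrow> ('i \<Rightarrow> 'a) \<Rightarrow> bool" where
  "poset_colimit X r G t c \<kappa> \<longleftrightarrow> poset_diagram X r G t \<and> poset_cocone X r G t c \<kappa> \<and>
     (\<forall>c' \<kappa>'. poset_cocone X r G t c' \<kappa>' \<longrightarrow>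
        (\<exists>u\<in>homset X c c'. \<forall>a\<in>Field r. Comp X u (\<kappa> a) = \<kappa>' a)) \<and>
     (\<forall>c'. \<forall>u\<in>homset X c c'. \<forall>v\<in>homset X c c'.
        (\<forall>a\<in>Field r. Le X (Comp X u (\<kappa> a)) (Comp X v (\<kappa> a))) \<longrightarrow> Le X u v)"

lemma (in ord_category) colimit_unique:
  assumes "poset_colimit C r G t c \<kappa>" "u \<in> homset C c c'" "v \<in> homset C c c'"
    "\<And>a. a \<in> Field r \<Longrightarrow> u \<cdot> \<kappa> a = v \<cdot> \<kappa> a"
  shows "u = v"
proof -
  have "\<And>a. a \<in> Field r \<Longrightarrow> Le C (u \<cdot> \<kappa> a) (v \<cdot> \<kappa> a) \<and> Le C (v \<cdot> \<kappa> a) (u \<cdot> \<kappa> a)"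
  proof -
    fix a assume "a \<in> Field r"
    then have "\<kappa> a \<in> homset C (G a) c" using assms(1) by (simp add: poset_colimit_def poset_cocone_def)
    then have "v \<cdot> \<kappa> a \<in> Arr C" using assms(3) comp_hom homsetD by metis
    then show "Le C (u \<cdot> \<kappa> a) (v \<cdot> \<kappa> a) \<and> Le C (v \<cdot> \<kappa> a) (u \<cdot> \<kappa> a)"
      using assms(4)[OF \<open>a \<in> Field r\<close>] le_refl by simp
  qed
  then have "Le C u v" "Le C v u" using assms(1-3) unfolding poset_colimit_def by blast+
  then show ?thesis using le_antisym assms(2,3) by blast
qed

lemma (in ord_category) pullback_unique:
  assumes "pullback_square C s" "z \<in> homset C Y (Dom C (sdom s))" "z' \<in> homset C Y (Dom C (sdom s))"
    "sdom s \<cdot> z = sdom s \<cdot> z'" "stop s \<cdot> z = stop s \<cdot> z'"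
  shows "z = z'"
proof -
  have "sdom s \<in> Arr C" "stop s \<in> homset C (Dom C (sdom s)) (Dom C (scod s))"
    using assms(1) unfolding pullback_square_def by (cases s; simp add: Square_arr_iff)+
  then have "sdom s \<cdot> z' \<in> Arr C" "stop s \<cdot> z' \<in> Arr C"
    using assms(3) by (simp_all add: homset_def comp_arr)
  then have "Le C z z'" "Le C z' z"
    using assms le_refl unfolding pullback_square_def by (metis (no_types, lifting))+
  then show ?thesis using le_antisym assms(2,3) by blast
qed

section \<open>Algebraic structures on arrows\<close>

definition alg_sq :: "('o, 'a) ordcat \<Rightarrow> ('a, 'a square, 'a, 'a square) ofunctor \<Rightarrow> 'a \<Rightarrow> 'a \<Rightarrow> 'a square" where
  "alg_sq C T f p = Square (onObj T f) f p (Idt C (Cod C f))"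

text \<open>A structure on \<open>f\<close> is a square \<open>T f \<rightarrow> f\<close> over the identity, subject to conditions: for an AWFS,
  \<open>T\<close> is \<open>R\<close>; for split epimorphisms and RALIs, \<open>T f\<close> is the identity of the codomain of \<open>f\<close>.\<close>

locale algebraic_struct = ord_category C for C :: "('o, 'a) ordcat" +
  fixes T :: "('a, 'a square, 'a, 'a square) ofunctor"
    and M :: "('o, 'a, 'a) arrow_struct"
    and r :: "'i rel"
  assumes functor_T: "ord_functor (arrow_cat C) (arrow_cat C) T"
    and cod_T: "f \<in> Arr C \<Longrightarrow> Cod C (onObj T f) = Cod C f"
    and sbot_T: "s \<in> Arr (arrow_cat C) \<Longrightarrow> sbot (onArr T s) = sbot s"
    and colimit_T: "poset_colimit (arrow_cat C) r D d g \<kappa> \<Longrightarrow>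
      poset_colimit (arrow_cat C) r (\<lambda>a. onObj T (D a)) (\<lambda>a b. onArr T (d a b)) (onObj T g) (\<lambda>a. onArr T (\<kappa> a))"
    and carries_alg: "\<lbrakk>f \<in> Arr C; carries M f p\<rbrakk> \<Longrightarrow> alg_sq C T f p \<in> Arr (arrow_cat C)"
    and preserves_iff: "\<lbrakk>alg_sq C T f p \<in> Arr (arrow_cat C); alg_sq C T g q \<in> Arr (arrow_cat C);
      s \<in> homset (arrow_cat C) f g\<rbrakk> \<Longrightarrow>
      preserves M (f, p) (g, q) s \<longleftrightarrow> stop s \<cdot> p = q \<cdot> stop (onArr T s)"
    and carries_pullback: "\<lbrakk>pullback_square C s; carries M (scod s) q;
      alg_sq C T (sdom s) p \<in> Arr (arrow_cat C); stop s \<cdot> p = q \<cdot> stop (onArr T s)\<rbrakk> \<Longrightarrow> carries M (sdom s) p"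
    and carries_colimit: "\<lbrakk>poset_colimit (arrow_cat C) r D d g \<kappa>;
      \<And>a. a \<in> Field r \<Longrightarrow> carries M (D a) (pD a); alg_sq C T g q \<in> Arr (arrow_cat C);
      \<And>a. a \<in> Field r \<Longrightarrow> stop (\<kappa> a) \<cdot> pD a = q \<cdot> stop (onArr T (\<kappa> a))\<rbrakk> \<Longrightarrow> carries M g q"
    and comp_alg: "\<lbrakk>f \<in> Arr C; g \<in> Arr C; carries M f p; carries M g q; Cod C f = Dom C g\<rbrakk>
      \<Longrightarrow> alg_sq C T (g \<cdot> f) (comp_struct M (g, q) (f, p)) \<in> Arr (arrow_cat C)"
    and comp_natural: "\<lbrakk>carries M f p; carries M g q; Cod C f = Dom C g;
      carries M f' p'; carries M g' q'; Cod C f' = Dom C g';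
      s \<in> homset (arrow_cat C) f f'; t \<in> homset (arrow_cat C) g g'; stop t = sbot s;
      stop s \<cdot> p = p' \<cdot> stop (onArr T s); stop t \<cdot> q = q' \<cdot> stop (onArr T t)\<rbrakk>
      \<Longrightarrow> stop s \<cdot> comp_struct M (g, q) (f, p) = comp_struct M (g', q') (f', p') \<cdot>
            stop (onArr T (Square (g \<cdot> f) (g' \<cdot> f') (stop s) (sbot t)))"
begin

sublocale ar: ord_category "arrow_cat C" by (rule arrow_category)

definition wf_alg :: "'a \<Rightarrow> 'a \<Rightarrow> bool" where
  "wf_alg f p \<longleftrightarrow> alg_sq C T f p \<in> homset (arrow_cat C) (onObj T f) f"

definition alg_mor :: "'a \<Rightarrow> 'a \<Rightarrow> 'a \<Rightarrow> 'a \<Rightarrow> 'a square \<Rightarrow> bool" where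
  "alg_mor f p g q s \<longleftrightarrow> wf_alg f p \<and> wf_alg g q \<and> s \<in> homset (arrow_cat C) f g \<and>
     stop s \<cdot> p = q \<cdot> stop (onArr T s)"

lemma wf_alg_iff: "wf_alg f p \<longleftrightarrow> alg_sq C T f p \<in> Arr (arrow_cat C)"
  by (simp add: wf_alg_def homset_def alg_sq_def)

lemma wf_algD:
  assumes "wf_alg f p"
  shows "f \<in> Arr C" "onObj T f \<in> Arr C" "p \<in> homset C (Dom C (onObj T f)) (Dom C f)"
    "f \<cdot> p = onObj T f"
proof -
  have *: "onObj T f \<in> Arr C \<and> f \<in> Arr C \<and> p \<in> homset C (Dom C (onObj T f)) (Dom C f) \<and>
    Idt C (Cod C f) \<cdot> onObj T f = f \<cdot> p"
    using assms by (simp add: wf_alg_iff alg_sq_def Square_arr_iff)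
  then show "f \<in> Arr C" "onObj T f \<in> Arr C" "p \<in> homset C (Dom C (onObj T f)) (Dom C f)" by auto
  then show "f \<cdot> p = onObj T f" using * cod_T id_left by metis
qed

lemma wf_algI:
  assumes "f \<in> Arr C" "p \<in> homset C (Dom C (onObj T f)) (Dom C f)" "f \<cdot> p = onObj T f"
  shows "wf_alg f p"
proof -
  have "onObj T f \<in> Arr C" using ord_functor.obj_map[OF functor_T] assms by simp
  then show ?thesis using assms cod_T[of f]
    by (simp add: wf_alg_iff alg_sq_def Square_arr_iff id_left idt_hom cod_obj)
qed

lemma T_hom: "s \<in> homset (arrow_cat C) f g \<Longrightarrow> onArr T s \<in> homset (arrow_cat C) (onObj T f) (onObj T g)"
  using ord_functor.hom_map[OF functor_T] .

lemma alg_mor_square: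
  assumes "wf_alg f p" "wf_alg g q" "s \<in> homset (arrow_cat C) f g"
  shows "alg_mor f p g q s \<longleftrightarrow>
    Comp (arrow_cat C) s (alg_sq C T f p) = Comp (arrow_cat C) (alg_sq C T g q) (onArr T s)"
proof -
  have s: "s \<in> Arr (arrow_cat C)" "sbot s \<in> homset C (Cod C f) (Cod C g)"
    using homset_arr[OF assms(3)] assms(3)[unfolded Square_hom_iff] by blast+
  have "sbot s \<cdot> Idt C (Cod C f) = Idt C (Cod C g) \<cdot> sbot (onArr T s)"
    using s by (simp add: sbot_T comp_idt idt_comp)
  then show ?thesis using assms T_hom[OF assms(3)]
    by (auto simp: alg_mor_def alg_sq_def Square_hom_iff)
qed

lemma preserves_alg_mor:
  "\<lbrakk>wf_alg f p; wf_alg g q; s \<in> homset (arrow_cat C) f g\<rbrakk> \<Longrightarrow> preserves M (f, p) (g, q) s \<longleftrightarrow> alg_mor f p g q s"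
  using preserves_iff by (simp add: alg_mor_def wf_alg_iff)

lemma carries_wf: "\<lbrakk>f \<in> Arr C; carries M f p\<rbrakk> \<Longrightarrow> wf_alg f p"
  using carries_alg wf_alg_iff by blast

lemma alg_mor_comp:
  assumes "alg_mor f p g q s" "alg_mor g q h m t"
  shows "alg_mor f p h m (Comp (arrow_cat C) t s)"
proof -
  have wf: "wf_alg f p" "wf_alg g q" "wf_alg h m" and st: "s \<in> homset (arrow_cat C) f g" "t \<in> homset (arrow_cat C) g h"
    using assms by (auto simp: alg_mor_def)
  note F = ord_functor.comp_map[OF functor_T st]
  have T: "stop (onArr T s) \<in> homset C (Dom C (onObj T f)) (Dom C (onObj T g))"
    "stop (onArr T t) \<in> homset C (Dom C (onObj T g)) (Dom C (onObj T h))"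
    using T_hom[OF st(1)] T_hom[OF st(2)] unfolding Square_hom_iff by auto
  have S: "stop s \<in> homset C (Dom C f) (Dom C g)" "stop t \<in> homset C (Dom C g) (Dom C h)"
    using st unfolding Square_hom_iff by auto
  have "stop t \<cdot> stop s \<cdot> p = stop t \<cdot> (stop s \<cdot> p)"
    using comp_assoc[OF wf_algD(3)[OF wf(1)] S] by simp
  also have "\<dots> = stop t \<cdot> q \<cdot> stop (onArr T s)"
    using assms(1) comp_assoc[OF T(1) wf_algD(3)[OF wf(2)] S(2)] by (simp add: alg_mor_def)
  also have "\<dots> = m \<cdot> (stop (onArr T t) \<cdot> stop (onArr T s))"
    using assms(2) comp_assoc[OF T wf_algD(3)[OF wf(3)]] by (simp add: alg_mor_def)
  finally show ?thesis using wf ar.comp_hom[OF st] F by (simp add: alg_mor_def)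
qed

lemma cartesian_alg:
  assumes s: "pullback_square C s" "alg_mor (sdom s) p (scod s) q s"
    and t: "t \<in> homset (arrow_cat C) h (sdom s)" "alg_mor h m (scod s) q (Comp (arrow_cat C) s t)"
  shows "alg_mor h m (sdom s) p t"
proof -
  let ?g = "sdom s"
  have wf: "wf_alg ?g p" "wf_alg (scod s) q" "wf_alg h m" and sh: "s \<in> homset (arrow_cat C) ?g (scod s)"
    using s t by (auto simp: alg_mor_def)
  note g = wf_algD[OF wf(1)] and h = wf_algD[OF wf(3)] and q = wf_algD[OF wf(2)]
  have T: "stop (onArr T t) \<in> homset C (Dom C (onObj T h)) (Dom C (onObj T ?g))"
    "stop (onArr T s) \<in> homset C (Dom C (onObj T ?g)) (Dom C (onObj T (scod s)))"
    "onObj T ?g \<cdot> stop (onArr T t) = sbot (onArr T t) \<cdot> onObj T h"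
    using T_hom[OF t(1)] T_hom[OF sh] unfolding Square_hom_iff by auto
  have S: "stop t \<in> homset C (Dom C h) (Dom C ?g)" "stop s \<in> homset C (Dom C ?g) (Dom C (scod s))"
    "sbot t \<in> homset C (Cod C h) (Cod C ?g)" "?g \<cdot> stop t = sbot t \<cdot> h"
    using t(1) sh unfolding Square_hom_iff by auto
  have z: "stop t \<cdot> m \<in> homset C (Dom C (onObj T h)) (Dom C ?g)"
    using comp_hom[OF h(3) S(1)] .
  have z': "p \<cdot> stop (onArr T t) \<in> homset C (Dom C (onObj T h)) (Dom C ?g)"
    using comp_hom[OF T(1) g(3)] .
  have "?g \<cdot> (stop t \<cdot> m) = sbot t \<cdot> h \<cdot> m"
    using comp_assoc[OF h(3) S(1) homset_self[OF g(1)]] S(4) by simp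
  also have "\<dots> = sbot t \<cdot> onObj T h"
    using comp_assoc[OF h(3) homset_self[OF h(1)] S(3)] h(4) by simp
  also have "\<dots> = onObj T ?g \<cdot> stop (onArr T t)"
    using T(3) sbot_T[OF homset_arr[OF t(1)]] by simp
  also have "\<dots> = ?g \<cdot> (p \<cdot> stop (onArr T t))"
    using comp_assoc[OF T(1) g(3) homset_self[OF g(1)]] g(4) by simp
  finally have 1: "?g \<cdot> (stop t \<cdot> m) = ?g \<cdot> (p \<cdot> stop (onArr T t))" .
  have "stop s \<cdot> (stop t \<cdot> m) = stop s \<cdot> stop t \<cdot> m"
    using comp_assoc[OF h(3) S(1) S(2)] by simp
  also have "\<dots> = q \<cdot> (stop (onArr T s) \<cdot> stop (onArr T t))"
    using t(2) ord_functor.comp_map[OF functor_T t(1) sh] by (simp add: alg_mor_def)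
  also have "\<dots> = stop s \<cdot> p \<cdot> stop (onArr T t)"
    using s(2) comp_assoc[OF T(1) T(2) q(3)] by (simp add: alg_mor_def)
  also have "\<dots> = stop s \<cdot> (p \<cdot> stop (onArr T t))"
    using comp_assoc[OF T(1) g(3) S(2)] by simp
  finally have "stop t \<cdot> m = p \<cdot> stop (onArr T t)"
    using pullback_unique[OF s(1) z z' 1] by simp
  then show ?thesis using wf t(1) by (simp add: alg_mor_def)
qed

lemma pullback_alg:
  assumes s: "pullback_square C s" and q: "carries M (scod s) q"
  shows "\<exists>!p. carries M (sdom s) p \<and> preserves M (sdom s, p) (scod s, q) s"
proof -
  have sh: "s \<in> homset (arrow_cat C) (sdom s) (scod s)"
    using s by (simp add: pullback_square_def homset_def)
  then have gA: "sdom s \<in> Arr C" "scod s \<in> Arr C" and sb: "sbot s \<in> homset C (Cod C (sdom s)) (Cod C (scod s))"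
    by (simp_all add: Square_hom_iff)
  note wq = carries_wf[OF gA(2) q]
  note q' = wf_algD[OF wq]
  have T: "stop (onArr T s) \<in> homset C (Dom C (onObj T (sdom s))) (Dom C (onObj T (scod s)))"
    "onObj T (scod s) \<cdot> stop (onArr T s) = sbot s \<cdot> onObj T (sdom s)" "onObj T (sdom s) \<in> Arr C"
    using T_hom[OF sh] sbot_T[OF homset_arr[OF sh]] unfolding Square_hom_iff by auto
  have x: "onObj T (sdom s) \<in> homset C (Dom C (onObj T (sdom s))) (Cod C (sdom s))"
    using homset_self[OF T(3)] cod_T[OF gA(1)] by simp
  have y: "q \<cdot> stop (onArr T s) \<in> homset C (Dom C (onObj T (sdom s))) (Dom C (scod s))"
    using comp_hom[OF T(1) q'(3)] .
  have "scod s \<cdot> (q \<cdot> stop (onArr T s)) = sbot s \<cdot> onObj T (sdom s)"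
    using comp_assoc[OF T(1) q'(3) homset_self[OF gA(2)]] q'(4) T(2) by simp
  then obtain p where p: "p \<in> homset C (Dom C (onObj T (sdom s))) (Dom C (sdom s))"
    "sdom s \<cdot> p = onObj T (sdom s)" "stop s \<cdot> p = q \<cdot> stop (onArr T s)"
    using s x y unfolding pullback_square_def by metis
  have wp: "wf_alg (sdom s) p" using wf_algI gA p by blast
  have cp: "carries M (sdom s) p" using carries_pullback[OF s q] wp p(3) wf_alg_iff by blast
  have "preserves M (sdom s, p) (scod s, q) s"
    using preserves_alg_mor[OF wp wq sh] wp wq sh p(3) by (simp add: alg_mor_def)
  moreover have "p' = p" if "carries M (sdom s) p'" "preserves M (sdom s, p') (scod s, q) s" for p'
  proof -
    note wp' = carries_wf[OF gA(1) that(1)]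
    then have "stop s \<cdot> p' = q \<cdot> stop (onArr T s)"
      using preserves_alg_mor[OF wp' wq sh] that(2) by (simp add: alg_mor_def)
    then show ?thesis
      using pullback_unique[OF s wf_algD(3)[OF wp'] p(1)] wf_algD(4)[OF wp'] p by simp
  qed
  ultimately show ?thesis using cp by blast
qed

lemma pulled_back_eq:
  assumes "pullback_square C s" "carries M (scod s) q"
  obtains p where "pulled_back M s q = (sdom s, p)" "carries M (sdom s) p" "alg_mor (sdom s) p (scod s) q s"
proof -
  let ?p = "THE p. carries M (sdom s) p \<and> preserves M (sdom s, p) (scod s, q) s"
  have *: "carries M (sdom s) ?p \<and> preserves M (sdom s, ?p) (scod s, q) s"
    using theI'[OF pullback_alg[OF assms]] .
  have sh: "s \<in> homset (arrow_cat C) (sdom s) (scod s)"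
    using assms by (simp add: pullback_square_def homset_def)
  then have "sdom s \<in> Arr C" "scod s \<in> Arr C" by (simp_all add: Square_hom_iff)
  then have "alg_mor (sdom s) ?p (scod s) q s"
    using * preserves_alg_mor[OF _ _ sh] carries_wf assms(2) by blast
  then show ?thesis using that * by (simp add: pulled_back_def)
qed

context
  fixes G t g \<kappa> p
  assumes colim: "poset_colimit (arrow_cat C) r G t g \<kappa>"
    and pG: "\<And>a. a \<in> Field r \<Longrightarrow> carries M (G a) (p a)"
    and pt: "\<And>a b. (a, b) \<in> r \<Longrightarrow> alg_mor (G a) (p a) (G b) (p b) (t a b)"
begin

lemma colim_leg:
  assumes "a \<in> Field r" shows "\<kappa> a \<in> homset (arrow_cat C) (G a) g" "G a \<in> Arr C" "wf_alg (G a) (p a)"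
proof -
  show "\<kappa> a \<in> homset (arrow_cat C) (G a) g" and 1: "G a \<in> Arr C"
    using colim assms by (auto simp: poset_colimit_def poset_cocone_def poset_diagram_def)
  then show "wf_alg (G a) (p a)" using carries_wf pG[OF assms] by blast
qed

lemma colim_arr: "g \<in> Arr C"
  using colim by (auto simp: poset_colimit_def poset_cocone_def)

lemma colimit_alg_exists:
  "\<exists>q. carries M g q \<and> (\<forall>a\<in>Field r. alg_mor (G a) (p a) g q (\<kappa> a))"
proof -
  let ?A = "arrow_cat C"
  let ?k = "\<lambda>a. Comp ?A (\<kappa> a) (alg_sq C T (G a) (p a))"
  note cT = colimit_T[OF colim]
  have "poset_cocone ?A r (\<lambda>a. onObj T (G a)) (\<lambda>a b. onArr T (t a b)) g ?k"
    unfolding poset_cocone_def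
  proof (intro conjI ballI)
    show "g \<in> Obj ?A" using colim_arr by simp
    show "?k a \<in> homset ?A (onObj T (G a)) g" if "a \<in> Field r" for a
      using ar.comp_hom[OF _ colim_leg(1)[OF that]] colim_leg(3)[OF that] by (simp add: wf_alg_def)
    fix ab assume "ab \<in> r"
    then obtain a b where ab: "ab = (a, b)" "(a, b) \<in> r" by (cases ab) auto
    then have F: "a \<in> Field r" "b \<in> Field r" by (auto simp: Field_def)
    have tab: "t a b \<in> homset ?A (G a) (G b)" "Comp ?A (\<kappa> b) (t a b) = \<kappa> a"
      using colim ab(2) by (auto simp: poset_colimit_def poset_diagram_def poset_cocone_def simp del: arrow_cat_simps)
    have al: "alg_sq C T (G b) (p b) \<in> homset ?A (onObj T (G b)) (G b)"
      "alg_sq C T (G a) (p a) \<in> homset ?A (onObj T (G a)) (G a)"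
      using colim_leg(3) F by (auto simp: wf_alg_def)
    have "Comp ?A (?k b) (onArr T (t a b)) = Comp ?A (\<kappa> b) (Comp ?A (alg_sq C T (G b) (p b)) (onArr T (t a b)))"
      using ar.comp_assoc[OF T_hom[OF tab(1)] al(1) colim_leg(1)[OF F(2)]] by (rule sym)
    also have "\<dots> = Comp ?A (\<kappa> b) (Comp ?A (t a b) (alg_sq C T (G a) (p a)))"
      using pt[OF ab(2)] alg_mor_square[OF colim_leg(3)[OF F(1)] colim_leg(3)[OF F(2)] tab(1)] by metis
    also have "\<dots> = ?k a"
      using ar.comp_assoc[OF al(2) tab(1) colim_leg(1)[OF F(2)]] tab(2) by metis
    finally show "case ab of (a, b) \<Rightarrow> Comp ?A (?k b) (onArr T (t a b)) = ?k a" using ab by simp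
  qed
  then obtain u where u: "u \<in> homset ?A (onObj T g) g"
    "\<And>a. a \<in> Field r \<Longrightarrow> Comp ?A u (onArr T (\<kappa> a)) = ?k a"
    using cT unfolding poset_colimit_def by blast
  have uh: "stop u \<in> homset C (Dom C (onObj T g)) (Dom C g)" "sbot u \<in> homset C (Cod C g) (Cod C g)"
    "sbot u \<cdot> onObj T g = g \<cdot> stop u"  "onObj T g \<in> Arr C"
    using u(1) cod_T[OF colim_arr] by (auto simp: Square_hom_iff)
  let ?I = "Idt C (Cod C g)"
  have I: "?I \<in> Arr C" "?I \<in> homset C (Cod C g) (Cod C g)" "Dom C ?I = Cod C g" "Cod C ?I = Cod C g"
    using colim_arr by (simp_all add: cat_simps idt_hom)
  have bot: "sbot u \<cdot> sbot (\<kappa> a) = sbot (\<kappa> a)" if a: "a \<in> Field r" for a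
  proof -
    have "sbot (\<kappa> a) \<in> homset C (Cod C (G a)) (Cod C g)" using colim_leg(1)[OF a] by (simp add: Square_hom_iff)
    moreover have "\<kappa> a \<in> Arr (arrow_cat C)" using homset_arr[OF colim_leg(1)[OF a]] .
    ultimately show ?thesis using u(2)[OF a] by (simp add: alg_sq_def comp_idt sbot_T)
  qed
  have "Square g ?I (sbot u \<cdot> g) (sbot u) = Square g ?I g ?I"
  proof (rule ar.colimit_unique[OF colim])
    show "Square g ?I (sbot u \<cdot> g) (sbot u) \<in> homset ?A g ?I"
      using I uh colim_arr comp_hom[OF homset_self[OF colim_arr] uh(2)]
      by (intro Square_homI) (auto simp: homset_def cat_simps)
    show "Square g ?I g ?I \<in> homset ?A g ?I"
      using I uh colim_arr by (intro Square_homI) (auto simp: homset_def cat_simps)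
    fix a assume a: "a \<in> Field r"
    have k: "stop (\<kappa> a) \<in> homset C (Dom C (G a)) (Dom C g)" "sbot (\<kappa> a) \<in> homset C (Cod C (G a)) (Cod C g)"
      "sbot (\<kappa> a) \<cdot> G a = g \<cdot> stop (\<kappa> a)" using colim_leg(1)[OF a] by (simp_all add: Square_hom_iff)
    have "sbot u \<cdot> g \<cdot> stop (\<kappa> a) = sbot u \<cdot> sbot (\<kappa> a) \<cdot> G a"
      using comp_assoc[OF k(1) homset_self[OF colim_arr] uh(2)] k(3)
        comp_assoc[OF homset_self[OF colim_leg(2)[OF a]] k(2) uh(2)] by simp
    then show "Comp ?A (Square g ?I (sbot u \<cdot> g) (sbot u)) (\<kappa> a) = Comp ?A (Square g ?I g ?I) (\<kappa> a)"
      using bot[OF a] k by (simp add: idt_comp)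
  qed
  then have "sbot u = ?I" by simp
  then have ua: "u = alg_sq C T g (stop u)"
    using u(1) by (simp add: alg_sq_def square.expand Square_hom_iff)
  then have wu: "wf_alg g (stop u)" using u(1) by (simp add: wf_alg_def)
  have mor: "alg_mor (G a) (p a) g (stop u) (\<kappa> a)" if a: "a \<in> Field r" for a
    using alg_mor_square[OF colim_leg(3)[OF a] wu colim_leg(1)[OF a]] u(2)[OF a] ua by metis
  then have "carries M g (stop u)"
    using carries_colimit[OF colim pG] wu unfolding wf_alg_iff alg_mor_def by blast
  then show ?thesis using mor by blast
qed

lemma colimit_alg_mor:
  assumes q: "\<And>a. a \<in> Field r \<Longrightarrow> alg_mor (G a) (p a) g q (\<kappa> a)" and w: "wf_alg g q" "wf_alg h m"
    and s: "s \<in> homset (arrow_cat C) g h"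
    and sk: "\<And>a. a \<in> Field r \<Longrightarrow> alg_mor (G a) (p a) h m (Comp (arrow_cat C) s (\<kappa> a))"
  shows "alg_mor g q h m s"
proof -
  let ?A = "arrow_cat C"
  have ga: "alg_sq C T g q \<in> homset ?A (onObj T g) g" "alg_sq C T h m \<in> homset ?A (onObj T h) h"
    using w by (auto simp: wf_alg_def)
  have "Comp ?A s (alg_sq C T g q) = Comp ?A (alg_sq C T h m) (onArr T s)"
  proof (rule ar.colimit_unique[OF colimit_T[OF colim] ar.comp_hom[OF ga(1) s] ar.comp_hom[OF T_hom[OF s] ga(2)]])
    fix a assume a: "a \<in> Field r"
    note k = colim_leg(1)[OF a]
    have "Comp ?A (Comp ?A s (alg_sq C T g q)) (onArr T (\<kappa> a)) = Comp ?A s (Comp ?A (alg_sq C T g q) (onArr T (\<kappa> a)))"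
      using ar.comp_assoc[OF T_hom[OF k] ga(1) s] by (rule sym)
    also have "\<dots> = Comp ?A s (Comp ?A (\<kappa> a) (alg_sq C T (G a) (p a)))"
      using q[OF a] alg_mor_square[OF colim_leg(3)[OF a] w(1) k] by metis
    also have "\<dots> = Comp ?A (Comp ?A s (\<kappa> a)) (alg_sq C T (G a) (p a))"
      using ar.comp_assoc[OF _ k s] colim_leg(3)[OF a] unfolding wf_alg_def by blast
    also have "\<dots> = Comp ?A (alg_sq C T h m) (onArr T (Comp ?A s (\<kappa> a)))"
      using sk[OF a] alg_mor_square[OF colim_leg(3)[OF a] w(2) ar.comp_hom[OF k s]] by metis
    also have "\<dots> = Comp ?A (alg_sq C T h m) (Comp ?A (onArr T s) (onArr T (\<kappa> a)))"
      using ord_functor.comp_map[OF functor_T k s] by metis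
    also have "\<dots> = Comp ?A (Comp ?A (alg_sq C T h m) (onArr T s)) (onArr T (\<kappa> a))"
      using ar.comp_assoc[OF T_hom[OF k] T_hom[OF s] ga(2)] .
    finally show "Comp ?A (Comp ?A s (alg_sq C T g q)) (onArr T (\<kappa> a)) =
      Comp ?A (Comp ?A (alg_sq C T h m) (onArr T s)) (onArr T (\<kappa> a))" .
  qed
  then show ?thesis using alg_mor_square[OF w s] by blast
qed

lemma colimit_alg_unique:
  assumes q: "\<And>a. a \<in> Field r \<Longrightarrow> alg_mor (G a) (p a) g q (\<kappa> a)" "wf_alg g q"
    and q': "\<And>a. a \<in> Field r \<Longrightarrow> alg_mor (G a) (p a) g q' (\<kappa> a)" "wf_alg g q'"
  shows "q = q'"
proof -
  let ?A = "arrow_cat C"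
  let ?i = "Idt ?A g"
  have g: "g \<in> Obj ?A" using colim_arr by simp
  have "alg_mor g q g q' ?i"
    using colimit_alg_mor[OF q q'(2) ar.idt_hom[OF g]] ar.idt_comp[OF colim_leg(1)] q'(1) by metis
  then have *: "stop ?i \<cdot> q = q' \<cdot> stop (onArr T ?i)" unfolding alg_mor_def by blast
  have "onObj T g \<in> Arr C" using wf_algD(2)[OF q(2)] .
  moreover have "onArr T ?i = Idt ?A (onObj T g)" using ord_functor.idt_map[OF functor_T g] .
  ultimately have "stop (onArr T ?i) = Idt C (Dom C (onObj T g))" by simp
  then show ?thesis using * wf_algD(3)[OF q(2)] wf_algD(3)[OF q'(2)] by (simp add: idt_comp comp_idt)
qed

end

end

section \<open>Small posets\<close>

lemma small_lepoll: "\<lbrakk>A \<lesssim> B; small U B\<rbrakk> \<Longrightarrow> small U A"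
  unfolding small_def by (rule lesspoll_trans1)

lemma small_subset: "\<lbrakk>A \<subseteq> B; small U B\<rbrakk> \<Longrightarrow> small U A"
  using small_lepoll subset_imp_lepoll by blast

lemma small_image: "small U A \<Longrightarrow> small U (f ` A)"
  using small_lepoll image_lepoll by blast

lemma finite_small:
  assumes "universe U" "finite A" shows "small U A"
proof -
  have "A \<lesssim> (UNIV :: nat set)" using assms(2) finite_lepoll_infinite infinite_UNIV_nat by blast
  then show ?thesis using small_lepoll assms(1) unfolding universe_def by blast
qed

lemma small_Pow:
  fixes U :: "'u itself"
  assumes "universe U" "small U A" shows "small U (Pow A)"
proof -
  obtain f :: "'a \<Rightarrow> 'u" where f: "inj_on f A"
    using assms(2) unfolding small_def lesspoll_def lepoll_def by blast
  have "small U (f ` A)" using small_image[OF assms(2)] .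
  then have "small U (Pow (f ` A))" using assms(1) unfolding universe_def by blast
  moreover have "Pow A \<lesssim> Pow (f ` A)"
    unfolding lepoll_def by (rule exI[of _ "image f"]) (use f inj_on_image_Pow in blast)
  ultimately show ?thesis using small_lepoll by blast
qed

lemma small_UN_base:
  fixes U :: "'u itself" and B :: "'i \<Rightarrow> 'u set"
  assumes "universe U" "small U I" "\<And>i. i \<in> I \<Longrightarrow> small U (B i)"
  shows "small U (\<Union>i\<in>I. B i)"
  using assms small_image[OF assms(2), of B] unfolding universe_def by blast

lemma small_times:
  fixes U :: "'u itself"
  assumes U: "universe U" and A: "small U A" and B: "small U B" shows "small U (A \<times> B)"
proof -
  obtain f :: "'a \<Rightarrow> 'u" and g :: "'b \<Rightarrow> 'u" and h :: "nat \<Rightarrow> 'u"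
    where fgh: "inj_on f A" "inj_on g B" "inj h"
    using lesspoll_imp_lepoll[OF A[unfolded small_def]] lesspoll_imp_lepoll[OF B[unfolded small_def]]
      lesspoll_imp_lepoll[OF U[unfolded universe_def small_def, THEN conjunct1]] unfolding lepoll_def by blast
  define Z where "Z = (\<Union>S\<in>{f ` A, g ` B, range h}. S)"
  have fin: "small U {f ` A, g ` B, range h}" by (rule finite_small[OF U]) simp
  have "small U (UNIV :: nat set)" using U unfolding universe_def by blast
  then have Z: "small U Z" unfolding Z_def
    using small_image[OF A] small_image[OF B] small_image
    by (intro small_UN_base[OF U fin]) auto
  have "infinite Z"
    unfolding Z_def using fgh(3) by (simp add: range_inj_infinite)
  then have "Z \<times> Z \<lesssim> Z"
    using eqpoll_iff_card_of_ordIso[THEN iffD2, OF card_of_Times_same_infinite] eqpoll_imp_lepoll by blast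
  moreover have "A \<times> B \<lesssim> Z \<times> Z"
    unfolding lepoll_def
    by (rule exI[of _ "map_prod f g"]) (use fgh in \<open>auto simp: Z_def inj_on_def\<close>)
  ultimately show ?thesis using Z small_lepoll lepoll_trans by blast
qed

lemma small_extensional_funcset:
  assumes "universe U" "small U A" "small U B" shows "small U (A \<rightarrow>\<^sub>E B)"
proof (rule small_lepoll[OF _ small_Pow[OF assms(1) small_times[OF assms]]])
  have "inj_on (\<lambda>f. (\<lambda>x. (x, f x)) ` A) (A \<rightarrow>\<^sub>E B)"
  proof (rule inj_onI)
    fix f g assume f: "f \<in> A \<rightarrow>\<^sub>E B" "g \<in> A \<rightarrow>\<^sub>E B" "(\<lambda>x. (x, f x)) ` A = (\<lambda>x. (x, g x)) ` A"
    have "f x = g x" if "x \<in> A" for x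
    proof -
      have "(x, f x) \<in> (\<lambda>x. (x, g x)) ` A" using that f(3) by blast
      then show ?thesis by auto
    qed
    then show "f = g" using PiE_ext[OF f(1,2)] by blast
  qed
  then show "(A \<rightarrow>\<^sub>E B) \<lesssim> Pow (A \<times> B)"
    unfolding lepoll_def by (intro exI[of _ "\<lambda>f. (\<lambda>x. (x, f x)) ` A"] conjI) (auto simp: PiE_iff)
qed

lemma Ord_cat_simps [simp]:
  "Dom (Ord_cat U) = src" "Cod (Ord_cat U) = tgt"
  "Idt (Ord_cat U) r = SMap r r (\<lambda>x\<in>Field r. x)"
  "Comp (Ord_cat U) g f = SMap (src f) (tgt g) (compose (Field (src f)) (fn g) (fn f))"
  "Le (Ord_cat U) f g \<longleftrightarrow> (\<forall>x\<in>Field (src f). (fn f x, fn g x) \<in> tgt f)"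
  by (simp_all add: Ord_cat_def)

lemma Ord_obj_iff: "r \<in> Obj (Ord_cat U) \<longleftrightarrow> Partial_order r \<and> small U (Field r)"
  by (simp add: Ord_cat_def)

lemma Ord_hom_iff:
  "f \<in> homset (Ord_cat U) r s \<longleftrightarrow> src f = r \<and> tgt f = s \<and> r \<in> Obj (Ord_cat U) \<and> s \<in> Obj (Ord_cat U) \<and>
     fn f \<in> extensional (Field r) \<and> (\<forall>x y. (x, y) \<in> r \<longrightarrow> (fn f x, fn f y) \<in> s)"
  by (cases f) (auto simp: homset_def Ord_cat_def)

lemma po_refl: "\<lbrakk>r \<in> Obj (Ord_cat U); x \<in> Field r\<rbrakk> \<Longrightarrow> (x, x) \<in> r"
  by (auto simp: Ord_obj_iff partial_order_on_def preorder_on_def refl_on_def)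

lemma po_trans: "\<lbrakk>r \<in> Obj (Ord_cat U); (x, y) \<in> r; (y, z) \<in> r\<rbrakk> \<Longrightarrow> (x, z) \<in> r"
  unfolding Ord_obj_iff partial_order_on_def preorder_on_def trans_def by blast

lemma po_antisym: "\<lbrakk>r \<in> Obj (Ord_cat U); (x, y) \<in> r; (y, x) \<in> r\<rbrakk> \<Longrightarrow> x = y"
  unfolding Ord_obj_iff partial_order_on_def antisym_def by blast

lemma Ord_fn_Field: "\<lbrakk>f \<in> homset (Ord_cat U) r s; x \<in> Field r\<rbrakk> \<Longrightarrow> fn f x \<in> Field s"
  using po_refl[of r U x] by (auto simp: Ord_hom_iff Field_def)

lemma Ord_fn_mono: "\<lbrakk>f \<in> homset (Ord_cat U) r s; (x, y) \<in> r\<rbrakk> \<Longrightarrow> (fn f x, fn f y) \<in> s"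
  by (simp add: Ord_hom_iff)

lemma Ord_hom_eqI:
  assumes "f \<in> homset (Ord_cat U) r s" "g \<in> homset (Ord_cat U) r s" "\<And>x. x \<in> Field r \<Longrightarrow> fn f x = fn g x"
  shows "f = g"
proof -
  have "fn f = fn g" using assms by (intro extensionalityI[of _ "Field r"]) (simp_all add: Ord_hom_iff)
  then show ?thesis using assms by (simp add: Ord_hom_iff smap.expand)
qed

lemma Field_mono: "(x, y) \<in> r \<Longrightarrow> x \<in> Field r \<and> y \<in> Field r"
  by (auto simp: Field_def)

lemma Ord_comp_fn: "x \<in> Field (src f) \<Longrightarrow> fn (Comp (Ord_cat U) g f) x = fn g (fn f x)"
  by (simp add: compose_def)

lemma Ord_category: "ord_category (Ord_cat U)"
proof
  let ?C = "Ord_cat U"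
  fix f :: "('a rel, 'a) smap" assume "f \<in> Arr ?C"
  then have f: "f \<in> homset ?C (src f) (tgt f)" by (simp add: homset_def)
  then show "Dom ?C f \<in> Obj ?C" "Cod ?C f \<in> Obj ?C" by (auto simp: Ord_hom_iff)
  show "Le ?C f f" using Ord_fn_Field[OF f] f po_refl[of "tgt f" U] by (auto simp: Ord_hom_iff)
next
  fix X :: "'a rel" assume "X \<in> Obj (Ord_cat U)"
  then show "Idt (Ord_cat U) X \<in> homset (Ord_cat U) X X"
    by (auto simp: Ord_hom_iff dest: Field_mono)
next
  fix f X Y and g :: "('a rel, 'a) smap" and Z assume "f \<in> homset (Ord_cat U) X Y" "g \<in> homset (Ord_cat U) Y Z"
  then show "Comp (Ord_cat U) g f \<in> homset (Ord_cat U) X Z"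
    by (auto simp: Ord_hom_iff compose_def dest: Field_mono)
next
  fix f :: "('a rel, 'a) smap" and X Y assume f: "f \<in> homset (Ord_cat U) X Y"
  have "compose (Field X) (fn f) (\<lambda>x\<in>Field X. x) = fn f"
    using f by (intro extensionalityI[of _ "Field X"]) (simp_all add: Ord_hom_iff compose_def)
  moreover have "compose (Field X) (\<lambda>x\<in>Field Y. x) (fn f) = fn f"
    using f Ord_fn_Field[OF f] by (intro extensionalityI[of _ "Field X"]) (simp_all add: Ord_hom_iff compose_def)
  ultimately show "Comp (Ord_cat U) f (Idt (Ord_cat U) X) = f" "Comp (Ord_cat U) (Idt (Ord_cat U) Y) f = f"
    using f by (simp_all add: Ord_hom_iff smap.expand)
next
  fix f W X g Y and h :: "('a rel, 'a) smap" and Z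
  assume "f \<in> homset (Ord_cat U) W X" "g \<in> homset (Ord_cat U) X Y" "h \<in> homset (Ord_cat U) Y Z"
  then show "Comp (Ord_cat U) h (Comp (Ord_cat U) g f) = Comp (Ord_cat U) (Comp (Ord_cat U) h g) f"
    using Ord_fn_Field[of f U W X] by (auto simp: Ord_hom_iff compose_def)
next
  fix f X Y g and h :: "('a rel, 'a) smap"
  assume 1: "f \<in> homset (Ord_cat U) X Y" "g \<in> homset (Ord_cat U) X Y" "h \<in> homset (Ord_cat U) X Y"
    "Le (Ord_cat U) f g" "Le (Ord_cat U) g h"
  then have "src f = X" "src g = X" "tgt f = Y" "tgt g = Y" "Y \<in> Obj (Ord_cat U)" by (auto simp: Ord_hom_iff)
  then show "Le (Ord_cat U) f h" using 1(4,5) po_trans[of Y U] by simp blast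
next
  fix f X Y and g :: "('a rel, 'a) smap"
  assume 1: "f \<in> homset (Ord_cat U) X Y" "g \<in> homset (Ord_cat U) X Y" "Le (Ord_cat U) f g" "Le (Ord_cat U) g f"
  then have "src f = X" "src g = X" "tgt f = Y" "tgt g = Y" "Y \<in> Obj (Ord_cat U)" by (auto simp: Ord_hom_iff)
  then show "f = g" using 1(3,4) po_antisym[of Y U] by (intro Ord_hom_eqI[OF 1(1,2)]) auto
next
  fix f X Y f' g Z and g' :: "('a rel, 'a) smap"
  assume 1: "f \<in> homset (Ord_cat U) X Y" "f' \<in> homset (Ord_cat U) X Y"
    "g \<in> homset (Ord_cat U) Y Z" "g' \<in> homset (Ord_cat U) Y Z" and 2: "Le (Ord_cat U) f f'" "Le (Ord_cat U) g g'"
  have e: "src f = X" "src f' = X" "tgt f = Y" "src g = Y" "tgt g = Z" "Z \<in> Obj (Ord_cat U)"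
    using 1 by (auto simp: Ord_hom_iff)
  have "(fn g (fn f x), fn g' (fn f' x)) \<in> Z" if x: "x \<in> Field X" for x
  proof (rule po_trans[OF e(6)])
    have "(fn f x, fn f' x) \<in> Y" using 2(1) x e by simp
    then show "(fn g (fn f x), fn g (fn f' x)) \<in> Z" using Ord_fn_mono[OF 1(3)] by blast
    show "(fn g (fn f' x), fn g' (fn f' x)) \<in> Z" using 2(2) e Ord_fn_Field[OF 1(2) x] by simp
  qed
  then show "Le (Ord_cat U) (Comp (Ord_cat U) g f) (Comp (Ord_cat U) g' f')"
    using e by (simp add: compose_def)
qed

lemma (in ord_category) arrow_colimitI:
  assumes D: "poset_diagram (arrow_cat C) r G t" and K: "poset_cocone (arrow_cat C) r G t g \<kappa>"
    and top: "poset_colimit C r (\<lambda>a. Dom C (G a)) (\<lambda>a b. stop (t a b)) (Dom C g) (\<lambda>a. stop (\<kappa> a))"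
    and bot: "poset_colimit C r (\<lambda>a. Cod C (G a)) (\<lambda>a b. sbot (t a b)) (Cod C g) (\<lambda>a. sbot (\<kappa> a))"
  shows "poset_colimit (arrow_cat C) r G t g \<kappa>"
  unfolding poset_colimit_def
proof (intro conjI allI ballI impI D K)
  let ?A = "arrow_cat C"
  have g: "g \<in> Arr C" using K by (simp add: poset_cocone_def)
  have k: "\<kappa> a \<in> homset ?A (G a) g" if "a \<in> Field r" for a using K that by (simp add: poset_cocone_def)
  {
    fix h \<kappa>' assume K': "poset_cocone ?A r G t h \<kappa>'"
    then have h: "h \<in> Arr C" and k': "\<And>a. a \<in> Field r \<Longrightarrow> \<kappa>' a \<in> homset ?A (G a) h"
      and kt: "\<And>a b. (a, b) \<in> r \<Longrightarrow> Comp ?A (\<kappa>' b) (t a b) = \<kappa>' a"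
      by (auto simp: poset_cocone_def simp del: arrow_cat_simps(5))
    have kt': "stop (\<kappa>' b) \<cdot> stop (t a b) = stop (\<kappa>' a)" "sbot (\<kappa>' b) \<cdot> sbot (t a b) = sbot (\<kappa>' a)"
      if "(a, b) \<in> r" for a b using arg_cong[OF kt[OF that], of stop] arg_cong[OF kt[OF that], of sbot] by simp_all
    have "poset_cocone C r (\<lambda>a. Dom C (G a)) (\<lambda>a b. stop (t a b)) (Dom C h) (\<lambda>a. stop (\<kappa>' a))"
      using k' kt' h by (auto simp: poset_cocone_def Square_hom_iff dom_obj)
    then obtain u1 where u1: "u1 \<in> homset C (Dom C g) (Dom C h)" "\<And>a. a \<in> Field r \<Longrightarrow> u1 \<cdot> stop (\<kappa> a) = stop (\<kappa>' a)"
      using top unfolding poset_colimit_def by blast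
    have "poset_cocone C r (\<lambda>a. Cod C (G a)) (\<lambda>a b. sbot (t a b)) (Cod C h) (\<lambda>a. sbot (\<kappa>' a))"
      using k' kt' h by (auto simp: poset_cocone_def Square_hom_iff cod_obj)
    then obtain u2 where u2: "u2 \<in> homset C (Cod C g) (Cod C h)" "\<And>a. a \<in> Field r \<Longrightarrow> u2 \<cdot> sbot (\<kappa> a) = sbot (\<kappa>' a)"
      using bot unfolding poset_colimit_def by blast
    have "u2 \<cdot> g = h \<cdot> u1"
    proof (rule colimit_unique[OF top])
      show "u2 \<cdot> g \<in> homset C (Dom C g) (Cod C h)" "h \<cdot> u1 \<in> homset C (Dom C g) (Cod C h)"
        using comp_hom[OF homset_self[OF g] u2(1)] comp_hom[OF u1(1) homset_self[OF h]] .
      fix a assume a: "a \<in> Field r"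
      have G: "G a \<in> Arr C" "stop (\<kappa> a) \<in> homset C (Dom C (G a)) (Dom C g)" "sbot (\<kappa> a) \<in> homset C (Cod C (G a)) (Cod C g)"
        "sbot (\<kappa> a) \<cdot> G a = g \<cdot> stop (\<kappa> a)" "sbot (\<kappa>' a) \<cdot> G a = h \<cdot> stop (\<kappa>' a)"
        using k[OF a] k'[OF a] by (auto simp: Square_hom_iff)
      have "u2 \<cdot> g \<cdot> stop (\<kappa> a) = u2 \<cdot> (sbot (\<kappa> a) \<cdot> G a)"
        using comp_assoc[OF G(2) homset_self[OF g] u2(1)] G(4) by simp
      also have "\<dots> = sbot (\<kappa>' a) \<cdot> G a" using comp_assoc[OF homset_self[OF G(1)] G(3) u2(1)] u2(2)[OF a] by simp
      also have "\<dots> = h \<cdot> u1 \<cdot> stop (\<kappa> a)"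
        using comp_assoc[OF G(2) u1(1) homset_self[OF h]] G(5) u1(2)[OF a] by simp
      finally show "u2 \<cdot> g \<cdot> stop (\<kappa> a) = h \<cdot> u1 \<cdot> stop (\<kappa> a)" .
    qed
    then have "Square g h u1 u2 \<in> homset ?A g h" by (rule Square_homI[OF g h u1(1) u2(1)])
    moreover have "Comp ?A (Square g h u1 u2) (\<kappa> a) = \<kappa>' a" if "a \<in> Field r" for a
      using k[OF that] k'[OF that] u1(2)[OF that] u2(2)[OF that] by (simp add: Square_hom_iff square.expand)
    ultimately show "\<exists>u\<in>homset ?A g h. \<forall>a\<in>Field r. Comp ?A u (\<kappa> a) = \<kappa>' a" by blast
  next
    fix h u v assume uv: "u \<in> homset ?A g h" "v \<in> homset ?A g h"
      and le: "\<forall>a\<in>Field r. Le ?A (Comp ?A u (\<kappa> a)) (Comp ?A v (\<kappa> a))"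
    have uv': "stop u \<in> homset C (Dom C g) (Dom C h)" "stop v \<in> homset C (Dom C g) (Dom C h)"
      "sbot u \<in> homset C (Cod C g) (Cod C h)" "sbot v \<in> homset C (Cod C g) (Cod C h)"
      using uv by (auto simp: Square_hom_iff)
    have "\<forall>a\<in>Field r. Le C (stop u \<cdot> stop (\<kappa> a)) (stop v \<cdot> stop (\<kappa> a)) \<and>
      Le C (sbot u \<cdot> sbot (\<kappa> a)) (sbot v \<cdot> sbot (\<kappa> a))" using le by simp
    then have "Le C (stop u) (stop v)" "Le C (sbot u) (sbot v)"
      using top bot uv' unfolding poset_colimit_def by blast+
    then show "Le ?A u v" by simp
  }
qed

lemma directed_union_colimit:
  fixes U :: "'u itself" and c :: "'x rel"
  assumes D: "poset_diagram (Ord_cat U) r G t" and K: "poset_cocone (Ord_cat U) r G t c \<kappa>"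
    and r: "\<And>a b. \<lbrakk>a \<in> Field r; b \<in> Field r\<rbrakk> \<Longrightarrow> \<exists>d. (a, d) \<in> r \<and> (b, d) \<in> r"
    and surj: "\<And>x. x \<in> Field c \<Longrightarrow> \<exists>a\<in>Field r. \<exists>y\<in>Field (G a). fn (\<kappa> a) y = x"
    and emb: "\<And>a y y'. \<lbrakk>a \<in> Field r; y \<in> Field (G a); y' \<in> Field (G a); (fn (\<kappa> a) y, fn (\<kappa> a) y') \<in> c\<rbrakk> \<Longrightarrow> (y, y') \<in> G a"
  shows "poset_colimit (Ord_cat U) r G t c \<kappa>"
  unfolding poset_colimit_def
proof (intro conjI allI ballI impI D K)
  let ?C = "Ord_cat U :: ('x rel, ('x rel, 'x) smap) ordcat"
  have c: "c \<in> Obj ?C" using K by (simp add: poset_cocone_def)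
  have k: "\<kappa> a \<in> homset ?C (G a) c" if "a \<in> Field r" for a using K that by (simp add: poset_cocone_def)
  have t: "t a b \<in> homset ?C (G a) (G b)" if "(a, b) \<in> r" for a b using D that unfolding poset_diagram_def by blast
  have leg: "fn (\<kappa>' b) (fn (t a b) y) = fn (\<kappa>' a) y"
    if "poset_cocone ?C r G t c' \<kappa>'" "(a, b) \<in> r" "y \<in> Field (G a)" for c' \<kappa>' a b y
  proof -
    have "Comp ?C (\<kappa>' b) (t a b) = \<kappa>' a" using that(1,2) unfolding poset_cocone_def by blast
    moreover have "src (t a b) = G a" using t[OF that(2)] by (simp add: Ord_hom_iff)
    ultimately show ?thesis using that(3) Ord_comp_fn by metis
  qed
  {
    fix c' \<kappa>' assume K': "poset_cocone ?C r G t c' \<kappa>'"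
    then have c': "c' \<in> Obj ?C" and k': "\<And>a. a \<in> Field r \<Longrightarrow> \<kappa>' a \<in> homset ?C (G a) c'"
      by (auto simp: poset_cocone_def)
    have mono: "(fn (\<kappa>' a) y, fn (\<kappa>' b) z) \<in> c'"
      if ab: "a \<in> Field r" "b \<in> Field r" "y \<in> Field (G a)" "z \<in> Field (G b)" "(fn (\<kappa> a) y, fn (\<kappa> b) z) \<in> c" for a b y z
    proof -
      obtain d where d: "(a, d) \<in> r" "(b, d) \<in> r" using r ab by blast
      then have dF: "d \<in> Field r" by (auto simp: Field_def)
      have "(fn (t a d) y, fn (t b d) z) \<in> G d"
        using emb[OF dF Ord_fn_Field[OF t[OF d(1)] ab(3)] Ord_fn_Field[OF t[OF d(2)] ab(4)]]
          leg[OF K d(1) ab(3)] leg[OF K d(2) ab(4)] ab(5) by simp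
      then show ?thesis
        using Ord_fn_mono[OF k'[OF dF]] leg[OF K' d(1) ab(3)] leg[OF K' d(2) ab(4)] by fastforce
    qed
    have "\<forall>x. \<exists>a y. x \<in> Field c \<longrightarrow> a \<in> Field r \<and> y \<in> Field (G a) \<and> fn (\<kappa> a) y = x" using surj by blast
    then obtain A Y where AY: "\<And>x. x \<in> Field c \<Longrightarrow> A x \<in> Field r \<and> Y x \<in> Field (G (A x)) \<and> fn (\<kappa> (A x)) (Y x) = x"
      by metis
    define u where "u = SMap c c' (\<lambda>x\<in>Field c. fn (\<kappa>' (A x)) (Y x))"
    have uh: "u \<in> homset ?C c c'"
      using c c' mono AY by (auto simp: u_def Ord_hom_iff dest: Field_mono)
    moreover have "Comp ?C u (\<kappa> a) = \<kappa>' a" if a: "a \<in> Field r" for a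
    proof (rule Ord_hom_eqI[OF ord_category.comp_hom[OF Ord_category k[OF a] uh] k'[OF a]])
      fix y assume y: "y \<in> Field (G a)"
      let ?x = "fn (\<kappa> a) y"
      have x: "?x \<in> Field c" using Ord_fn_Field[OF k[OF a] y] .
      have "(?x, ?x) \<in> c" using po_refl[OF c x] .
      then have "fn (\<kappa>' (A ?x)) (Y ?x) = fn (\<kappa>' a) y"
        using mono[of "A ?x" a "Y ?x" y] mono[of a "A ?x" y "Y ?x"] AY[OF x] a y po_antisym[OF c'] by simp
      moreover have "src (\<kappa> a) = G a" using k[OF a] by (simp add: Ord_hom_iff)
      ultimately show "fn (Comp ?C u (\<kappa> a)) y = fn (\<kappa>' a) y"
        using x y by (simp add: compose_def u_def)
    qed
    ultimately show "\<exists>u\<in>homset ?C c c'. \<forall>a\<in>Field r. Comp ?C u (\<kappa> a) = \<kappa>' a" by blast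
  next
    fix c' u v assume uv: "u \<in> homset ?C c c'" "v \<in> homset ?C c c'"
      and le: "\<forall>a\<in>Field r. Le ?C (Comp ?C u (\<kappa> a)) (Comp ?C v (\<kappa> a))"
    have "(fn u x, fn v x) \<in> c'" if x: "x \<in> Field c" for x
    proof -
      obtain a y where a: "a \<in> Field r" "y \<in> Field (G a)" "fn (\<kappa> a) y = x" using surj[OF x] by blast
      moreover have "src (\<kappa> a) = G a" "tgt u = c'" using k[OF a(1)] uv by (simp_all add: Ord_hom_iff)
      ultimately show ?thesis using le by (auto simp: compose_def)
    qed
    then show "Le ?C u v" using uv by (simp add: Ord_hom_iff)
  }
qed

section \<open>Comparison maps\<close>

lemma hmap_simps [simp]:
  "src (hmap r s h) = r" "tgt (hmap r s h) = s" "x \<in> Field r \<Longrightarrow> fn (hmap r s h) x = h x"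
  by (simp_all add: hmap_def)

lemma on_simps [simp]: "on_arr F (HArr h) = F h" "on_sqr F' (HSqr h k) = F' h k"
  by (simp_all add: on_arr_def on_sqr_def)

lemma hmap_hom:
  "\<lbrakk>r \<in> Obj (Ord_cat U); s \<in> Obj (Ord_cat U); \<And>x y. (x, y) \<in> r \<Longrightarrow> (h x, h y) \<in> s\<rbrakk>
    \<Longrightarrow> hmap r s h \<in> homset (Ord_cat U) r s"
  by (auto simp: Ord_hom_iff hmap_def dest: Field_mono)

locale small_hom_category = ord_category C for C :: "('o, 'a) ordcat" +
  fixes U :: "'u itself"
  assumes universe: "universe U" and hom_small: "small U (homset C X Y)"
begin

abbreviation (input) Q :: "('a hom_elem rel, 'a hmap) ordcat" where "Q \<equiv> Ord_cat U"

lemma Field_hom_poset: "Field (hom_poset C X Y) = HArr ` homset C X Y"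
  using le_refl[OF homset_arr[of _ C X Y]] unfolding hom_poset_def Field_def by blast

lemma Field_sq_poset: "Field (sq_poset C u f) = {HSqr h k |h k. Square u f h k \<in> Arr (arrow_cat C)}"
  using ord_category.le_refl[OF arrow_category] unfolding sq_poset_def Field_def by blast

lemma hom_poset_obj: "hom_poset C X Y \<in> Obj Q"
proof -
  have "trans (hom_poset C X Y)"
    unfolding trans_def hom_poset_def using le_trans by blast
  moreover have "antisym (hom_poset C X Y)"
    unfolding antisym_def hom_poset_def using le_antisym by blast
  moreover have "refl_on (Field (hom_poset C X Y)) (hom_poset C X Y)"
    unfolding Field_hom_poset refl_on_def
    using le_refl[OF homset_arr[of _ C X Y]] unfolding hom_poset_def by blast
  ultimately show ?thesis
    using small_image[OF hom_small, of HArr X Y] Field_mono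
    unfolding Ord_obj_iff Field_hom_poset[symmetric] partial_order_on_def preorder_on_def by fast
qed

lemma sq_poset_obj: "sq_poset C u f \<in> Obj Q"
proof -
  let ?S = "{HSqr h k |h k. Square u f h k \<in> Arr (arrow_cat C)}"
  have h: "Square u f h k \<in> homset (arrow_cat C) u f" if "Square u f h k \<in> Arr (arrow_cat C)" for h k
    using that by (simp add: homset_def)
  have "trans (sq_poset C u f)"
    unfolding trans_def sq_poset_def using ord_category.le_trans[OF arrow_category h h h] by blast
  moreover have "antisym (sq_poset C u f)"
    unfolding antisym_def sq_poset_def using ord_category.le_antisym[OF arrow_category h h] by blast
  moreover have "refl_on (Field (sq_poset C u f)) (sq_poset C u f)"
    unfolding Field_sq_poset refl_on_def
    using ord_category.le_refl[OF arrow_category] unfolding sq_poset_def by blast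
  moreover have "?S \<subseteq> (\<lambda>(h, k). HSqr h k) ` (homset C (Dom C u) (Dom C f) \<times> homset C (Cod C u) (Cod C f))"
    by (auto simp: Square_arr_iff)
  then have "small U ?S"
    by (rule small_subset[OF _ small_image[OF small_times[OF universe hom_small hom_small]]])
  ultimately show ?thesis
    using Field_mono
    unfolding Ord_obj_iff Field_sq_poset[symmetric] partial_order_on_def preorder_on_def by fast
qed

lemma in_hom_poset: "(x, y) \<in> hom_poset C X Y \<Longrightarrow>
    \<exists>h h'. x = HArr h \<and> y = HArr h' \<and> h \<in> homset C X Y \<and> h' \<in> homset C X Y \<and> Le C h h'"
  by (auto simp: hom_poset_def)

lemma in_sq_poset: "(x, y) \<in> sq_poset C u f \<Longrightarrow>
    \<exists>h k h' k'. x = HSqr h k \<and> y = HSqr h' k' \<and> Square u f h k \<in> Arr (arrow_cat C) \<and>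
      Square u f h' k' \<in> Arr (arrow_cat C) \<and> Le C h h' \<and> Le C k k'"
  by (auto simp: sq_poset_def)

lemma hom_mono:
  "\<lbrakk>f \<in> homset C X Y; f' \<in> homset C X Y; g \<in> homset C Y Z; Le C f f'\<rbrakk> \<Longrightarrow> Le C (g \<cdot> f) (g \<cdot> f')"
  "\<lbrakk>f \<in> homset C X Y; g \<in> homset C Y Z; g' \<in> homset C Y Z; Le C g g'\<rbrakk> \<Longrightarrow> Le C (g \<cdot> f) (g' \<cdot> f)"
  using comp_mono le_refl homset_arr by metis+

lemma fill_square:
  assumes "u \<in> Arr C" "f \<in> Arr C" "d \<in> homset C (Cod C u) (Dom C f)"
  shows "Square u f (d \<cdot> u) (f \<cdot> d) \<in> Arr (arrow_cat C)"
  using assms by (auto simp: Square_arr_iff homset_def cat_simps)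

lemma comparison_hom:
  assumes "u \<in> Arr C" "f \<in> Arr C"
  shows "comparison C u f \<in> homset Q (hom_poset C (Cod C u) (Dom C f)) (sq_poset C u f)"
  unfolding comparison_def
proof (rule hmap_hom[OF hom_poset_obj sq_poset_obj])
  fix x y assume "(x, y) \<in> hom_poset C (Cod C u) (Dom C f)"
  then obtain d d' where d: "x = HArr d" "y = HArr d'" "d \<in> homset C (Cod C u) (Dom C f)"
    "d' \<in> homset C (Cod C u) (Dom C f)" "Le C d d'" using in_hom_poset by blast
  then show "(on_arr (\<lambda>d. HSqr (d \<cdot> u) (f \<cdot> d)) x, on_arr (\<lambda>d. HSqr (d \<cdot> u) (f \<cdot> d)) y) \<in> sq_poset C u f"
    using fill_square[OF assms] hom_mono(1)[OF d(3,4) homset_self[OF assms(2)] d(5)]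
      hom_mono(2)[OF homset_self[OF assms(1)] d(3,4,5)]
    by (auto simp: sq_poset_def)
qed

lemma comparison_fn:
  "d \<in> homset C (Cod C u) (Dom C f) \<Longrightarrow> fn (comparison C u f) (HArr d) = HSqr (d \<cdot> u) (f \<cdot> d)"
  by (simp add: comparison_def Field_hom_poset)

lemma comparison_arr:
  assumes "u \<in> Arr C" "f \<in> Arr C"
  shows "comparison C u f \<in> Arr Q" "src (comparison C u f) = hom_poset C (Cod C u) (Dom C f)"
    "tgt (comparison C u f) = sq_poset C u f"
  using comparison_hom[OF assms] by (simp_all add: homset_def)

text \<open>The action of a pair of squares on \<open>C\<^sup>2(u, f)\<close> is composition in the arrow category.\<close>

lemma square_action:
  assumes "t \<in> homset (arrow_cat C) u' u" "s \<in> homset (arrow_cat C) f f'" "Square u f h k \<in> Arr (arrow_cat C)"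
  shows "Square u' f' (stop s \<cdot> (h \<cdot> stop t)) (sbot s \<cdot> (k \<cdot> sbot t)) \<in> Arr (arrow_cat C)"
proof -
  have "Square u f h k \<in> homset (arrow_cat C) u f" using assms(3) by (simp add: homset_def)
  then have "Comp (arrow_cat C) s (Comp (arrow_cat C) (Square u f h k) t) \<in> homset (arrow_cat C) u' f'"
    using ord_category.comp_hom[OF arrow_category] assms(1,2) by metis
  moreover have "sdom t = u'" "scod s = f'" using assms by (simp_all add: Square_hom_iff)
  ultimately show ?thesis using homset_arr by fastforce
qed

lemma comparison_sq_hom:
  assumes t: "t \<in> homset (arrow_cat C) u' u" and s: "s \<in> homset (arrow_cat C) f f'"
  shows "comparison_sq C t s \<in> homset (arrow_cat Q) (comparison C u f) (comparison C u' f')"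
proof -
  have t': "sdom t = u'" "scod t = u" "u \<in> Arr C" "u' \<in> Arr C" "stop t \<in> homset C (Dom C u') (Dom C u)"
    "sbot t \<in> homset C (Cod C u') (Cod C u)" "sbot t \<cdot> u' = u \<cdot> stop t"
    using t by (simp_all add: Square_hom_iff)
  have s': "sdom s = f" "scod s = f'" "f \<in> Arr C" "f' \<in> Arr C" "stop s \<in> homset C (Dom C f) (Dom C f')"
    "sbot s \<in> homset C (Cod C f) (Cod C f')" "sbot s \<cdot> f = f' \<cdot> stop s"
    using s by (simp_all add: Square_hom_iff)
  note c = comparison_arr[OF t'(3) s'(3)] comparison_arr[OF t'(4) s'(4)]
  let ?h = "on_arr (\<lambda>d. HArr (stop s \<cdot> (d \<cdot> sbot t)))"
  let ?k = "on_sqr (\<lambda>h k. HSqr (stop s \<cdot> (h \<cdot> stop t)) (sbot s \<cdot> (k \<cdot> sbot t)))"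
  have top: "stop s \<cdot> (d \<cdot> sbot t) \<in> homset C (Cod C u') (Dom C f')" if "d \<in> homset C (Cod C u) (Dom C f)" for d
    using comp_hom[OF comp_hom[OF t'(6) that] s'(5)] .
  have h: "hmap (hom_poset C (Cod C u) (Dom C f)) (hom_poset C (Cod C u') (Dom C f')) ?h \<in>
     homset Q (hom_poset C (Cod C u) (Dom C f)) (hom_poset C (Cod C u') (Dom C f'))"
  proof (rule hmap_hom[OF hom_poset_obj hom_poset_obj])
    fix x y assume "(x, y) \<in> hom_poset C (Cod C u) (Dom C f)"
    then obtain d d' where d: "x = HArr d" "y = HArr d'" "d \<in> homset C (Cod C u) (Dom C f)"
      "d' \<in> homset C (Cod C u) (Dom C f)" "Le C d d'" using in_hom_poset by blast
    have "Le C (stop s \<cdot> (d \<cdot> sbot t)) (stop s \<cdot> (d' \<cdot> sbot t))"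
      using hom_mono(1)[OF comp_hom[OF t'(6) d(3)] comp_hom[OF t'(6) d(4)] s'(5)] hom_mono(2)[OF t'(6) d(3-5)] by blast
    then show "(?h x, ?h y) \<in> hom_poset C (Cod C u') (Dom C f')"
      using d top by (auto simp: hom_poset_def)
  qed
  have k: "hmap (sq_poset C u f) (sq_poset C u' f') ?k \<in> homset Q (sq_poset C u f) (sq_poset C u' f')"
  proof (rule hmap_hom[OF sq_poset_obj sq_poset_obj])
    fix x y assume "(x, y) \<in> sq_poset C u f"
    then obtain h k h' k' where x: "x = HSqr h k" "y = HSqr h' k'" "Square u f h k \<in> Arr (arrow_cat C)"
      "Square u f h' k' \<in> Arr (arrow_cat C)" "Le C h h'" "Le C k k'" using in_sq_poset by blast
    then have hk: "h \<in> homset C (Dom C u) (Dom C f)" "h' \<in> homset C (Dom C u) (Dom C f)"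
      "k \<in> homset C (Cod C u) (Cod C f)" "k' \<in> homset C (Cod C u) (Cod C f)"
      by (simp_all add: Square_arr_iff)
    have "Le C (stop s \<cdot> (h \<cdot> stop t)) (stop s \<cdot> (h' \<cdot> stop t))"
      using hom_mono(1)[OF comp_hom[OF t'(5) hk(1)] comp_hom[OF t'(5) hk(2)] s'(5)]
        hom_mono(2)[OF t'(5) hk(1,2) x(5)] by blast
    moreover have "Le C (sbot s \<cdot> (k \<cdot> sbot t)) (sbot s \<cdot> (k' \<cdot> sbot t))"
      using hom_mono(1)[OF comp_hom[OF t'(6) hk(3)] comp_hom[OF t'(6) hk(4)] s'(6)]
        hom_mono(2)[OF t'(6) hk(3,4) x(6)] by blast
    ultimately show "(?k x, ?k y) \<in> sq_poset C u' f'"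
      using x square_action[OF t s] by (auto simp: sq_poset_def)
  qed
  have eq: "Comp Q (hmap (sq_poset C u f) (sq_poset C u' f') ?k) (comparison C u f) =
    Comp Q (comparison C u' f') (hmap (hom_poset C (Cod C u) (Dom C f)) (hom_poset C (Cod C u') (Dom C f')) ?h)"
  proof (rule Ord_hom_eqI[OF ord_category.comp_hom[OF Ord_category comparison_hom[OF t'(3) s'(3)] k]
        ord_category.comp_hom[OF Ord_category h comparison_hom[OF t'(4) s'(4)]]])
    fix x assume x: "x \<in> Field (hom_poset C (Cod C u) (Dom C f))"
    then obtain d where d: "x = HArr d" "d \<in> homset C (Cod C u) (Dom C f)" by (auto simp: Field_hom_poset)
    have sq: "HSqr (d \<cdot> u) (f \<cdot> d) \<in> Field (sq_poset C u f)"
      using fill_square[OF t'(3) s'(3) d(2)] by (auto simp: Field_sq_poset)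
    have "stop s \<cdot> (d \<cdot> u \<cdot> stop t) = stop s \<cdot> (d \<cdot> sbot t) \<cdot> u'"
    proof -
      have "stop s \<cdot> (d \<cdot> u \<cdot> stop t) = stop s \<cdot> (d \<cdot> (sbot t \<cdot> u'))"
        using comp_assoc[OF t'(5) homset_self[OF t'(3)] d(2)] t'(7) by simp
      also have "\<dots> = stop s \<cdot> (d \<cdot> sbot t \<cdot> u')" using comp_assoc[OF homset_self[OF t'(4)] t'(6) d(2)] by simp
      also have "\<dots> = stop s \<cdot> (d \<cdot> sbot t) \<cdot> u'"
        using comp_assoc[OF homset_self[OF t'(4)] comp_hom[OF t'(6) d(2)] s'(5)] .
      finally show ?thesis .
    qed
    moreover have "sbot s \<cdot> (f \<cdot> d \<cdot> sbot t) = f' \<cdot> (stop s \<cdot> (d \<cdot> sbot t))"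
    proof -
      have "sbot s \<cdot> (f \<cdot> d \<cdot> sbot t) = sbot s \<cdot> (f \<cdot> (d \<cdot> sbot t))"
        using comp_assoc[OF t'(6) d(2) homset_self[OF s'(3)]] by simp
      also have "\<dots> = sbot s \<cdot> f \<cdot> (d \<cdot> sbot t)" using comp_assoc[OF comp_hom[OF t'(6) d(2)] homset_self[OF s'(3)] s'(6)] .
      also have "\<dots> = f' \<cdot> (stop s \<cdot> (d \<cdot> sbot t))"
        using comp_assoc[OF comp_hom[OF t'(6) d(2)] s'(5) homset_self[OF s'(4)]] s'(7) by simp
      finally show ?thesis .
    qed
    ultimately show "fn (Comp Q (hmap (sq_poset C u f) (sq_poset C u' f') ?k) (comparison C u f)) x =
      fn (Comp Q (comparison C u' f') (hmap (hom_poset C (Cod C u) (Dom C f)) (hom_poset C (Cod C u') (Dom C f')) ?h)) x"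
      using x c(2) d(2) sq top[OF d(2)] by (simp add: compose_def d(1) comparison_fn)
  qed
  show ?thesis
    using h k eq c by (simp add: Square_hom_iff comparison_sq_def t'(1,2) s'(1,2))
qed

lemma comparison_sq_stop_fn:
  assumes "t \<in> homset (arrow_cat C) u' u" "s \<in> homset (arrow_cat C) f f'" "d \<in> homset C (Cod C u) (Dom C f)"
  shows "fn (stop (comparison_sq C t s)) (HArr d) = HArr (stop s \<cdot> (d \<cdot> sbot t))"
  using assms by (simp add: comparison_sq_def Square_hom_iff Field_hom_poset)

lemma comparison_sq_sbot_fn:
  assumes "t \<in> homset (arrow_cat C) u' u" "s \<in> homset (arrow_cat C) f f'" "Square u f h k \<in> Arr (arrow_cat C)"
  shows "fn (sbot (comparison_sq C t s)) (HSqr h k) = HSqr (stop s \<cdot> (h \<cdot> stop t)) (sbot s \<cdot> (k \<cdot> sbot t))"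
  using assms by (auto simp: comparison_sq_def Square_hom_iff Field_sq_poset)

lemma comparison_sq_comp:
  assumes t: "t \<in> homset (arrow_cat C) u' u" "t' \<in> homset (arrow_cat C) u'' u'"
    and s: "s \<in> homset (arrow_cat C) f f'" "s' \<in> homset (arrow_cat C) f' f''"
  shows "Comp (arrow_cat Q) (comparison_sq C t' s') (comparison_sq C t s) =
    comparison_sq C (Comp (arrow_cat C) t t') (Comp (arrow_cat C) s' s)" (is "?l = ?r")
proof -
  interpret Q: ord_category "Ord_cat U :: ('a hom_elem rel, 'a hmap) ordcat" by (rule Ord_category)
  interpret A: ord_category "arrow_cat C" by (rule arrow_category)
  note tt = A.comp_hom[OF t(2,1)] and ss = A.comp_hom[OF s]
  have l: "?l \<in> homset (arrow_cat Q) (comparison C u f) (comparison C u'' f'')"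
    using ord_category.comp_hom[OF Q.arrow_category comparison_sq_hom[OF t(1) s(1)] comparison_sq_hom[OF t(2) s(2)]] .
  have r: "?r \<in> homset (arrow_cat Q) (comparison C u f) (comparison C u'' f'')"
    using comparison_sq_hom[OF tt ss] .
  have 1: "u \<in> Arr C" "f \<in> Arr C" "stop t \<in> homset C (Dom C u') (Dom C u)" "sbot t \<in> homset C (Cod C u') (Cod C u)"
    "stop t' \<in> homset C (Dom C u'') (Dom C u')" "sbot t' \<in> homset C (Cod C u'') (Cod C u')"
    "stop s \<in> homset C (Dom C f) (Dom C f')" "sbot s \<in> homset C (Cod C f) (Cod C f')"
    "stop s' \<in> homset C (Dom C f') (Dom C f'')" "sbot s' \<in> homset C (Cod C f') (Cod C f'')"
    using t s by (simp_all add: Square_hom_iff)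
  note c = comparison_arr[OF 1(1,2)]
  have src: "src (stop (comparison_sq C t s)) = hom_poset C (Cod C u) (Dom C f)"
     "src (sbot (comparison_sq C t s)) = sq_poset C u f"
    using t(1) s(1) by (simp_all add: comparison_sq_def Square_hom_iff)
  have norm: "c' \<cdot> (c \<cdot> (b \<cdot> a) \<cdot> a') = c' \<cdot> c \<cdot> (b \<cdot> (a \<cdot> a'))"
    if "a' \<in> homset C V W" "a \<in> homset C W X" "b \<in> homset C X Y" "c \<in> homset C Y Z" "c' \<in> homset C Z Z'"
    for a a' b c c' V W X Y Z Z'
    using that by (simp add: homset_def cat_simps)
  have "stop ?l = stop ?r"
  proof (rule Ord_hom_eqI)
    show "stop ?l \<in> homset Q (hom_poset C (Cod C u) (Dom C f)) (src (comparison C u'' f''))"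
      "stop ?r \<in> homset Q (hom_poset C (Cod C u) (Dom C f)) (src (comparison C u'' f''))"
      using l r c unfolding Square_hom_iff Ord_cat_simps by auto
    fix x assume x: "x \<in> Field (hom_poset C (Cod C u) (Dom C f))"
    then obtain d where d: "x = HArr d" "d \<in> homset C (Cod C u) (Dom C f)" by (auto simp: Field_hom_poset)
    have d': "stop s \<cdot> (d \<cdot> sbot t) \<in> homset C (Cod C u') (Dom C f')"
      using comp_hom[OF comp_hom[OF 1(4) d(2)] 1(7)] .
    have "fn (stop ?l) x = HArr (stop s' \<cdot> (stop s \<cdot> (d \<cdot> sbot t) \<cdot> sbot t'))"
      using x comparison_sq_stop_fn[OF t(1) s(1) d(2)] comparison_sq_stop_fn[OF t(2) s(2) d']
      by (simp add: compose_def src d(1))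
    also have "\<dots> = HArr (stop s' \<cdot> stop s \<cdot> (d \<cdot> (sbot t \<cdot> sbot t')))"
      using norm[OF 1(6,4) d(2) 1(7,9)] by simp
    also have "\<dots> = fn (stop ?r) x"
      using comparison_sq_stop_fn[OF tt ss d(2)] d(1) by simp
    finally show "fn (stop ?l) x = fn (stop ?r) x" .
  qed
  moreover have "sbot ?l = sbot ?r"
  proof (rule Ord_hom_eqI)
    show "sbot ?l \<in> homset Q (sq_poset C u f) (tgt (comparison C u'' f''))"
      "sbot ?r \<in> homset Q (sq_poset C u f) (tgt (comparison C u'' f''))"
      using l r c unfolding Square_hom_iff Ord_cat_simps by auto
    fix x assume x: "x \<in> Field (sq_poset C u f)"
    then obtain h k where hk: "x = HSqr h k" "Square u f h k \<in> Arr (arrow_cat C)" by (auto simp: Field_sq_poset)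
    then have hk': "h \<in> homset C (Dom C u) (Dom C f)" "k \<in> homset C (Cod C u) (Cod C f)" by (auto simp: Square_arr_iff)
    have "fn (sbot ?l) x = HSqr (stop s' \<cdot> (stop s \<cdot> (h \<cdot> stop t) \<cdot> stop t')) (sbot s' \<cdot> (sbot s \<cdot> (k \<cdot> sbot t) \<cdot> sbot t'))"
      using x comparison_sq_sbot_fn[OF t(1) s(1) hk(2)] comparison_sq_sbot_fn[OF t(2) s(2) square_action[OF t(1) s(1) hk(2)]]
      by (simp add: compose_def src hk(1))
    also have "\<dots> = HSqr (stop s' \<cdot> stop s \<cdot> (h \<cdot> (stop t \<cdot> stop t'))) (sbot s' \<cdot> sbot s \<cdot> (k \<cdot> (sbot t \<cdot> sbot t')))"
      using norm[OF 1(5,3) hk'(1) 1(7,9)] norm[OF 1(6,4) hk'(2) 1(8,10)] by simp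
    also have "\<dots> = fn (sbot ?r) x"
      using comparison_sq_sbot_fn[OF tt ss hk(2)] hk(1) by simp
    finally show "fn (sbot ?l) x = fn (sbot ?r) x" .
  qed
  ultimately show ?thesis using l r by (simp add: square.expand Square_hom_iff)
qed

lemma comparison_sq_idt:
  assumes "u \<in> Arr C" "f \<in> Arr C"
  shows "comparison_sq C (Idt (arrow_cat C) u) (Idt (arrow_cat C) f) = Idt (arrow_cat Q) (comparison C u f)"
proof -
  interpret Q: ord_category "Ord_cat U :: ('a hom_elem rel, 'a hmap) ordcat" by (rule Ord_category)
  note c = comparison_arr[OF assms]
  have i: "Idt (arrow_cat C) g \<in> homset (arrow_cat C) g g" if "g \<in> Arr C" for g
    using that by (simp add: Square_hom_iff idt_hom dom_obj cod_obj id_left id_right)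
  have l: "comparison_sq C (Idt (arrow_cat C) u) (Idt (arrow_cat C) f) \<in> homset (arrow_cat Q) (comparison C u f) (comparison C u f)"
    (is "?l \<in> _") using comparison_sq_hom[OF i[OF assms(1)] i[OF assms(2)]] .
  have r: "Idt (arrow_cat Q) (comparison C u f) \<in> homset (arrow_cat Q) (comparison C u f) (comparison C u f)"
    (is "?r \<in> _") using ord_category.idt_hom[OF Q.arrow_category] c(1) unfolding arrow_cat_simps(1) .
  have "stop ?l = stop ?r"
  proof (rule Ord_hom_eqI)
    show "stop ?l \<in> homset Q (hom_poset C (Cod C u) (Dom C f)) (src (comparison C u f))"
      "stop ?r \<in> homset Q (hom_poset C (Cod C u) (Dom C f)) (src (comparison C u f))"
      using l r c unfolding Square_hom_iff Ord_cat_simps by auto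
    fix x assume x: "x \<in> Field (hom_poset C (Cod C u) (Dom C f))"
    then obtain d where d: "x = HArr d" "d \<in> homset C (Cod C u) (Dom C f)" by (auto simp: Field_hom_poset)
    then show "fn (stop ?l) x = fn (stop ?r) x"
      using comparison_sq_stop_fn[OF i[OF assms(1)] i[OF assms(2)] d(2)] x c by (simp add: comp_idt idt_comp)
  qed
  moreover have "sbot ?l = sbot ?r"
  proof (rule Ord_hom_eqI)
    show "sbot ?l \<in> homset Q (sq_poset C u f) (tgt (comparison C u f))"
      "sbot ?r \<in> homset Q (sq_poset C u f) (tgt (comparison C u f))"
      using l r c unfolding Square_hom_iff Ord_cat_simps by auto
    fix x assume x: "x \<in> Field (sq_poset C u f)"
    then obtain h k where hk: "x = HSqr h k" "Square u f h k \<in> Arr (arrow_cat C)" by (auto simp: Field_sq_poset)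
    then have hk': "h \<in> homset C (Dom C u) (Dom C f)" "k \<in> homset C (Cod C u) (Cod C f)" by (auto simp: Square_arr_iff)
    then show "fn (sbot ?l) x = fn (sbot ?r) x"
      using comparison_sq_sbot_fn[OF i[OF assms(1)] i[OF assms(2)] hk(2)] x c hk(1) by (simp add: comp_idt idt_comp)
  qed
  ultimately show ?thesis using l r by (simp add: square.expand Square_hom_iff)
qed

end

context small_hom_category
begin

lemma idsq_hom: "g \<in> Arr C \<Longrightarrow> Idt (arrow_cat C) g \<in> homset (arrow_cat C) g g"
  by (simp add: Square_hom_iff idt_hom dom_obj cod_obj id_left id_right)

lemma pre_pullback_maps:
  assumes u: "u \<in> Arr C" and v: "v \<in> Arr C" and uv: "Cod C u = Dom C v" and f: "f \<in> Arr C"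
  shows "sdom (pre_pullback C v u f) \<in> homset Q (sq_poset C v f) (sq_poset C (v \<cdot> u) f)"
    "stop (pre_pullback C v u f) \<in> homset Q (sq_poset C v f) (hom_poset C (Cod C u) (Dom C f))"
    "sbot (pre_pullback C v u f) \<in> homset Q (sq_poset C (v \<cdot> u) f) (sq_poset C u f)"
    "scod (pre_pullback C v u f) = comparison C u f"
proof -
  have u': "u \<in> homset C (Dom C u) (Dom C v)" using homset_self[OF u] uv by simp
  have vu: "v \<cdot> u \<in> Arr C" "Dom C (v \<cdot> u) = Dom C u" "Cod C (v \<cdot> u) = Cod C v"
    using comp_arr u v uv by metis+
  show "sdom (pre_pullback C v u f) \<in> homset Q (sq_poset C v f) (sq_poset C (v \<cdot> u) f)"
    unfolding pre_pullback_def square.sel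
  proof (rule hmap_hom[OF sq_poset_obj sq_poset_obj])
    fix x y assume "(x, y) \<in> sq_poset C v f"
    then obtain h k h' k' where x: "x = HSqr h k" "y = HSqr h' k'" "Square v f h k \<in> Arr (arrow_cat C)"
      "Square v f h' k' \<in> Arr (arrow_cat C)" "Le C h h'" "Le C k k'" using in_sq_poset by blast
    have s: "Square (v \<cdot> u) f (h \<cdot> u) k \<in> Arr (arrow_cat C)" if "Square v f h k \<in> Arr (arrow_cat C)" for h k
    proof -
      have "k \<cdot> v = f \<cdot> h" and hk: "h \<in> homset C (Dom C v) (Dom C f)" "k \<in> homset C (Cod C v) (Cod C f)"
        using that by (auto simp: Square_arr_iff)
      moreover have "k \<cdot> (v \<cdot> u) = k \<cdot> v \<cdot> u" "f \<cdot> (h \<cdot> u) = f \<cdot> h \<cdot> u"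
        using comp_assoc[OF u' homset_self[OF v] hk(2)] comp_assoc[OF u' hk(1) homset_self[OF f]] by simp_all
      ultimately have "k \<cdot> (v \<cdot> u) = f \<cdot> (h \<cdot> u)" by simp
      then show ?thesis using that u f vu comp_hom[OF u'] by (auto simp: Square_arr_iff)
    qed
    have hh: "h \<in> homset C (Dom C v) (Dom C f)" "h' \<in> homset C (Dom C v) (Dom C f)"
      using x by (auto simp: Square_arr_iff)
    show "(on_sqr (\<lambda>h. HSqr (h \<cdot> u)) x, on_sqr (\<lambda>h. HSqr (h \<cdot> u)) y) \<in> sq_poset C (v \<cdot> u) f"
      using s[OF x(3)] s[OF x(4)] hom_mono(2)[OF u' hh x(5)] x by (auto simp: sq_poset_def)
  qed
  show "stop (pre_pullback C v u f) \<in> homset Q (sq_poset C v f) (hom_poset C (Cod C u) (Dom C f))"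
    unfolding pre_pullback_def square.sel
  proof (rule hmap_hom[OF sq_poset_obj hom_poset_obj])
    fix x y assume "(x, y) \<in> sq_poset C v f"
    then show "(on_sqr (\<lambda>h k. HArr h) x, on_sqr (\<lambda>h k. HArr h) y) \<in> hom_poset C (Cod C u) (Dom C f)"
      using uv by (auto dest!: in_sq_poset simp: hom_poset_def Square_arr_iff)
  qed
  show "sbot (pre_pullback C v u f) \<in> homset Q (sq_poset C (v \<cdot> u) f) (sq_poset C u f)"
    unfolding pre_pullback_def square.sel
  proof (rule hmap_hom[OF sq_poset_obj sq_poset_obj])
    fix x y assume "(x, y) \<in> sq_poset C (v \<cdot> u) f"
    then obtain h k h' k' where x: "x = HSqr h k" "y = HSqr h' k'" "Square (v \<cdot> u) f h k \<in> Arr (arrow_cat C)"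
      "Square (v \<cdot> u) f h' k' \<in> Arr (arrow_cat C)" "Le C h h'" "Le C k k'" using in_sq_poset by blast
    have s: "Square u f h (k \<cdot> v) \<in> Arr (arrow_cat C)" if "Square (v \<cdot> u) f h k \<in> Arr (arrow_cat C)" for h k
    proof -
      have k: "k \<in> homset C (Cod C v) (Cod C f)" "h \<in> homset C (Dom C u) (Dom C f)" "k \<cdot> (v \<cdot> u) = f \<cdot> h"
        using that vu by (auto simp: Square_arr_iff)
      have "k \<cdot> v \<cdot> u = f \<cdot> h" using comp_assoc[OF u' homset_self[OF v] k(1)] k(3) by simp
      then show ?thesis using k u f uv comp_hom[OF homset_self[OF v] k(1)] by (simp add: Square_arr_iff)
    qed
    have kk: "k \<in> homset C (Cod C v) (Cod C f)" "k' \<in> homset C (Cod C v) (Cod C f)"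
      using x vu by (auto simp: Square_arr_iff)
    show "(on_sqr (\<lambda>h k. HSqr h (k \<cdot> v)) x, on_sqr (\<lambda>h k. HSqr h (k \<cdot> v)) y) \<in> sq_poset C u f"
      using s[OF x(3)] s[OF x(4)] hom_mono(2)[OF homset_self[OF v] kk x(6)] x by (auto simp: sq_poset_def)
  qed
  show "scod (pre_pullback C v u f) = comparison C u f" by (simp add: pre_pullback_def)
qed

lemma pre_pullback_fn:
  "Square v f h k \<in> Arr (arrow_cat C) \<Longrightarrow> fn (sdom (pre_pullback C v u f)) (HSqr h k) = HSqr (h \<cdot> u) k"
  "Square v f h k \<in> Arr (arrow_cat C) \<Longrightarrow> fn (stop (pre_pullback C v u f)) (HSqr h k) = HArr h"
  "Square (v \<cdot> u) f h k \<in> Arr (arrow_cat C) \<Longrightarrow> fn (sbot (pre_pullback C v u f)) (HSqr h k) = HSqr h (k \<cdot> v)"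
  by (auto simp: pre_pullback_def Field_sq_poset)

lemma pre_pullback_hom:
  assumes u: "u \<in> Arr C" and v: "v \<in> Arr C" and uv: "Cod C u = Dom C v" and f: "f \<in> Arr C"
  shows "pre_pullback C v u f \<in> homset (arrow_cat Q) (sdom (pre_pullback C v u f)) (comparison C u f)"
proof -
  let ?P = "pre_pullback C v u f"
  note m = pre_pullback_maps[OF assms] and c = comparison_hom[OF u f]
  have "Comp Q (sbot ?P) (sdom ?P) = Comp Q (comparison C u f) (stop ?P)"
  proof (rule Ord_hom_eqI[OF ord_category.comp_hom[OF Ord_category m(1,3)]
      ord_category.comp_hom[OF Ord_category m(2) c]])
    fix x assume x: "x \<in> Field (sq_poset C v f)"
    then obtain h k where hk: "x = HSqr h k" "Square v f h k \<in> Arr (arrow_cat C)" by (auto simp: Field_sq_poset)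
    then have h: "h \<in> homset C (Cod C u) (Dom C f)" "k \<cdot> v = f \<cdot> h" using uv by (auto simp: Square_arr_iff)
    have "HSqr (h \<cdot> u) k \<in> Field (sq_poset C (v \<cdot> u) f)"
      using Ord_fn_Field[OF m(1) x] pre_pullback_fn(1)[OF hk(2)] hk(1) by simp
    then have "Square (v \<cdot> u) f (h \<cdot> u) k \<in> Arr (arrow_cat C)" by (auto simp: Field_sq_poset)
    moreover have "src (sdom ?P) = sq_poset C v f" "src (stop ?P) = sq_poset C v f"
      using m by (simp_all add: homset_def)
    ultimately show "fn (Comp Q (sbot ?P) (sdom ?P)) x = fn (Comp Q (comparison C u f) (stop ?P)) x"
      using pre_pullback_fn hk h x comparison_fn by (simp add: compose_def)
  qed
  moreover have S: "src (sdom ?P) = sq_poset C v f" "tgt (sdom ?P) = sq_poset C (v \<cdot> u) f"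
    using m(1) by (simp_all add: homset_def)
  ultimately show ?thesis
    using m(2,3) homset_arr[OF m(1)] comparison_arr(1)[OF u f]
    unfolding Square_hom_iff Ord_cat_simps(1,2) m(4) comparison_arr(2,3)[OF u f] S by blast
qed

lemma pre_pullback_square:
  assumes u: "u \<in> Arr C" and v: "v \<in> Arr C" and uv: "Cod C u = Dom C v" and f: "f \<in> Arr C"
  shows "pullback_square Q (pre_pullback C v u f)"
  unfolding pullback_square_def
proof (intro conjI allI ballI impI)
  let ?P = "pre_pullback C v u f"
  note m = pre_pullback_maps[OF assms] and c = comparison_hom[OF u f]
  have dc: "Dom Q (sdom ?P) = sq_poset C v f" "Cod Q (sdom ?P) = sq_poset C (v \<cdot> u) f"
     "Dom Q (scod ?P) = hom_poset C (Cod C u) (Dom C f)"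
    using m c by (simp_all add: homset_def)
  show "?P \<in> Arr (arrow_cat Q)" using homset_arr[OF pre_pullback_hom[OF assms]] .
  {
    fix Y x y
    assume x: "x \<in> homset Q Y (Cod Q (sdom ?P))" and y: "y \<in> homset Q Y (Dom Q (scod ?P))"
      and eq: "Comp Q (sbot ?P) x = Comp Q (scod ?P) y"
    note xd = x[unfolded dc] and yd = y[unfolded dc]
    have sxy: "src x = Y" "src y = Y" "Y \<in> Obj Q" using x y by (simp_all add: Ord_hom_iff)
    define z where "z = hmap Y (sq_poset C v f) (\<lambda>i. on_arr (\<lambda>d. on_sqr (\<lambda>h k. HSqr d k) (fn x i)) (fn y i))"
    have el: "\<exists>h k d. fn x i = HSqr h k \<and> fn y i = HArr d \<and> Square (v \<cdot> u) f h k \<in> Arr (arrow_cat C) \<and>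
      Square v f d k \<in> Arr (arrow_cat C) \<and> d \<cdot> u = h" if i: "i \<in> Field Y" for i
    proof -
      obtain h k where hk: "fn x i = HSqr h k" "Square (v \<cdot> u) f h k \<in> Arr (arrow_cat C)"
        using Ord_fn_Field[OF xd i] by (auto simp: Field_sq_poset)
      obtain d where d: "fn y i = HArr d" "d \<in> homset C (Cod C u) (Dom C f)"
        using Ord_fn_Field[OF yd i] by (auto simp: Field_hom_poset)
      have "fn (Comp Q (sbot ?P) x) i = fn (Comp Q (scod ?P) y) i" by (rule arg_cong[OF eq])
      then have "HSqr h (k \<cdot> v) = HSqr (d \<cdot> u) (f \<cdot> d)"
        using i sxy hk d pre_pullback_fn(3)[OF hk(2)] comparison_fn[OF d(2)] m(4) by (simp add: compose_def)
      then have "d \<cdot> u = h" "k \<cdot> v = f \<cdot> d" by auto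
      moreover have "k \<in> homset C (Cod C v) (Cod C f)"
        using hk(2) comp_arr(3)[OF u v] uv by (simp add: Square_arr_iff)
      ultimately show ?thesis using hk d uv v f by (auto simp: Square_arr_iff)
    qed
    have zh: "z \<in> homset Q Y (Dom Q (sdom ?P))" unfolding z_def dc
    proof (rule hmap_hom[OF sxy(3) sq_poset_obj])
      fix i j assume ij: "(i, j) \<in> Y"
      then have F: "i \<in> Field Y" "j \<in> Field Y" by (auto simp: Field_def)
      obtain h k d where i: "fn x i = HSqr h k" "fn y i = HArr d" "Square v f d k \<in> Arr (arrow_cat C)" using el[OF F(1)] by blast
      obtain h' k' d' where j: "fn x j = HSqr h' k'" "fn y j = HArr d'" "Square v f d' k' \<in> Arr (arrow_cat C)" using el[OF F(2)] by blast
      have "(HSqr h k, HSqr h' k') \<in> sq_poset C (v \<cdot> u) f" "(HArr d, HArr d') \<in> hom_poset C (Cod C u) (Dom C f)"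
        using Ord_fn_mono[OF xd ij] Ord_fn_mono[OF yd ij] i j by simp_all
      then have "Le C k k'" "Le C d d'" by (auto simp: sq_poset_def hom_poset_def)
      then show "(on_arr (\<lambda>d. on_sqr (\<lambda>h k. HSqr d k) (fn x i)) (fn y i),
          on_arr (\<lambda>d. on_sqr (\<lambda>h k. HSqr d k) (fn x j)) (fn y j)) \<in> sq_poset C v f"
        using i j by (auto simp: sq_poset_def)
    qed
    have zs: "src z = Y" by (simp add: z_def)
    have fz: "\<exists>d k. fn z i = HSqr d k \<and> fn x i = HSqr (d \<cdot> u) k \<and> fn y i = HArr d \<and> Square v f d k \<in> Arr (arrow_cat C)"
      if "i \<in> Field Y" for i using el[OF that] that by (auto simp: z_def)
    have "Comp Q (sdom ?P) z = x"
    proof (rule Ord_hom_eqI[OF ord_category.comp_hom[OF Ord_category zh[unfolded dc] m(1)] x[unfolded dc]])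
      fix i assume i: "i \<in> Field Y"
      then show "fn (Comp Q (sdom ?P) z) i = fn x i" using fz[OF i] pre_pullback_fn(1) zs by (auto simp: compose_def)
    qed
    moreover have "Comp Q (stop ?P) z = y"
    proof (rule Ord_hom_eqI[OF ord_category.comp_hom[OF Ord_category zh[unfolded dc] m(2)] y[unfolded dc]])
      fix i assume i: "i \<in> Field Y"
      then show "fn (Comp Q (stop ?P) z) i = fn y i" using fz[OF i] pre_pullback_fn(2) zs by (auto simp: compose_def)
    qed
    ultimately show "\<exists>z\<in>homset Q Y (Dom Q (sdom ?P)). Comp Q (sdom ?P) z = x \<and> Comp Q (stop ?P) z = y"
      using zh by blast
  next
    fix Y z z' assume z: "z \<in> homset Q Y (Dom Q (sdom ?P))" "z' \<in> homset Q Y (Dom Q (sdom ?P))"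
      and le: "Le Q (Comp Q (sdom ?P) z) (Comp Q (sdom ?P) z') \<and> Le Q (Comp Q (stop ?P) z) (Comp Q (stop ?P) z')"
    have sz: "src z = Y" "src z' = Y" "tgt z = sq_poset C v f" using z[unfolded dc] by (simp_all add: Ord_hom_iff)
    have tg: "tgt (sdom ?P) = sq_poset C (v \<cdot> u) f" "tgt (stop ?P) = hom_poset C (Cod C u) (Dom C f)"
      using m by (simp_all add: homset_def)
    have "(fn z i, fn z' i) \<in> sq_poset C v f" if i: "i \<in> Field Y" for i
    proof -
      obtain h k where a: "fn z i = HSqr h k" "Square v f h k \<in> Arr (arrow_cat C)"
        using Ord_fn_Field[OF z(1)[unfolded dc] i] by (auto simp: Field_sq_poset)
      obtain h' k' where b: "fn z' i = HSqr h' k'" "Square v f h' k' \<in> Arr (arrow_cat C)"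
        using Ord_fn_Field[OF z(2)[unfolded dc] i] by (auto simp: Field_sq_poset)
      have "(HSqr (h \<cdot> u) k, HSqr (h' \<cdot> u) k') \<in> sq_poset C (v \<cdot> u) f" "(HArr h, HArr h') \<in> hom_poset C (Cod C u) (Dom C f)"
        using le i sz a b pre_pullback_fn(1)[OF a(2)] pre_pullback_fn(1)[OF b(2)]
          pre_pullback_fn(2)[OF a(2)] pre_pullback_fn(2)[OF b(2)] by (auto simp: tg compose_def)
      then have "Le C k k'" "Le C h h'" by (auto simp: sq_poset_def hom_poset_def)
      then show ?thesis using a b by (auto simp: sq_poset_def)
    qed
    then show "Le Q z z'" using sz by simp
  }
qed

lemma pre_pullback_comparison:
  assumes u: "u \<in> Arr C" and v: "v \<in> Arr C" and uv: "Cod C u = Dom C v" and f: "f \<in> Arr C"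
  shows "Comp Q (sdom (pre_pullback C v u f)) (comparison C v f) = comparison C (v \<cdot> u) f"
proof -
  note m = pre_pullback_maps[OF assms] and c = comparison_hom[OF v f]
  have u': "u \<in> homset C (Dom C u) (Dom C v)" using homset_self[OF u] uv by simp
  have vu: "v \<cdot> u \<in> Arr C" "Dom C (v \<cdot> u) = Dom C u" "Cod C (v \<cdot> u) = Cod C v"
    using comp_arr u v uv by metis+
  show ?thesis
  proof (rule Ord_hom_eqI[OF ord_category.comp_hom[OF Ord_category c m(1)] comparison_hom[OF vu(1) f, unfolded vu]])
    fix x assume x: "x \<in> Field (hom_poset C (Cod C v) (Dom C f))"
    then obtain d where d: "x = HArr d" "d \<in> homset C (Cod C v) (Dom C f)" by (auto simp: Field_hom_poset)
    have "d \<cdot> v \<cdot> u = d \<cdot> (v \<cdot> u)" using comp_assoc[OF u' homset_self[OF v] d(2)] by simp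
    moreover have "src (comparison C v f) = hom_poset C (Cod C v) (Dom C f)" using comparison_arr(2)[OF v f] .
    moreover have "fn (comparison C (v \<cdot> u) f) (HArr d) = HSqr (d \<cdot> (v \<cdot> u)) (f \<cdot> d)"
      using comparison_fn[of d "v \<cdot> u" f] d vu by simp
    ultimately show "fn (Comp Q (sdom (pre_pullback C v u f)) (comparison C v f)) x = fn (comparison C (v \<cdot> u) f) x"
      using x d comparison_fn[OF d(2)] pre_pullback_fn(1)[OF fill_square[OF v f d(2)]] by (simp add: compose_def)
  qed
qed

definition pre_pullback_map :: "'a \<Rightarrow> 'a \<Rightarrow> 'a square \<Rightarrow> 'a hmap square" where
  "pre_pullback_map v u s = Square (sdom (pre_pullback C v u (sdom s))) (sdom (pre_pullback C v u (scod s)))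
     (sbot (comparison_sq C (Idt (arrow_cat C) v) s)) (sbot (comparison_sq C (Idt (arrow_cat C) (v \<cdot> u)) s))"

lemma idsq_action:
  assumes "s \<in> homset (arrow_cat C) f f'" "Square u f h k \<in> Arr (arrow_cat C)"
  shows "fn (sbot (comparison_sq C (Idt (arrow_cat C) u) s)) (HSqr h k) = HSqr (stop s \<cdot> h) (sbot s \<cdot> k)"
    "Square u f' (stop s \<cdot> h) (sbot s \<cdot> k) \<in> Arr (arrow_cat C)"
proof -
  have u: "u \<in> Arr C" and hk: "h \<in> homset C (Dom C u) (Dom C f)" "k \<in> homset C (Cod C u) (Cod C f)"
    using assms by (auto simp: Square_arr_iff)
  show "fn (sbot (comparison_sq C (Idt (arrow_cat C) u) s)) (HSqr h k) = HSqr (stop s \<cdot> h) (sbot s \<cdot> k)"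
    using comparison_sq_sbot_fn[OF idsq_hom[OF u] assms] hk by (simp add: comp_idt)
  show "Square u f' (stop s \<cdot> h) (sbot s \<cdot> k) \<in> Arr (arrow_cat C)"
    using square_action[OF idsq_hom[OF u] assms] hk by (simp add: comp_idt)
qed

lemma comparison_sq_sbot_hom:
  assumes u: "u \<in> Arr C" and s: "s \<in> homset (arrow_cat C) f f'"
  shows "sbot (comparison_sq C (Idt (arrow_cat C) u) s) \<in> homset Q (sq_poset C u f) (sq_poset C u f')"
proof -
  have f: "f \<in> Arr C" "f' \<in> Arr C" using s by (auto simp: Square_hom_iff)
  show ?thesis
    using comparison_sq_hom[OF idsq_hom[OF u] s]
    unfolding Square_hom_iff Ord_cat_simps(1,2) comparison_arr(3)[OF u f(1)] comparison_arr(3)[OF u f(2)] by blast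
qed

lemma comparison_sq_stop_hom:
  assumes u: "u \<in> Arr C" and s: "s \<in> homset (arrow_cat C) f f'"
  shows "stop (comparison_sq C (Idt (arrow_cat C) u) s) \<in>
    homset Q (hom_poset C (Cod C u) (Dom C f)) (hom_poset C (Cod C u) (Dom C f'))"
proof -
  have f: "f \<in> Arr C" "f' \<in> Arr C" using s by (auto simp: Square_hom_iff)
  show ?thesis
    using comparison_sq_hom[OF idsq_hom[OF u] s]
    unfolding Square_hom_iff Ord_cat_simps(1,2) comparison_arr(2)[OF u f(1)] comparison_arr(2)[OF u f(2)] by blast
qed

lemma idsq_stop_action:
  assumes "u \<in> Arr C" "s \<in> homset (arrow_cat C) f f'" "d \<in> homset C (Cod C u) (Dom C f)"
  shows "fn (stop (comparison_sq C (Idt (arrow_cat C) u) s)) (HArr d) = HArr (stop s \<cdot> d)"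
  using comparison_sq_stop_fn[OF idsq_hom[OF assms(1)] assms(2,3)] assms(3) by (simp add: comp_idt)

lemma pre_pullback_map_hom:
  assumes u: "u \<in> Arr C" and v: "v \<in> Arr C" and uv: "Cod C u = Dom C v" and s: "s \<in> homset (arrow_cat C) f f'"
  shows "pre_pullback_map v u s \<in> homset (arrow_cat Q) (sdom (pre_pullback C v u f)) (sdom (pre_pullback C v u f'))"
    "Comp (arrow_cat Q) (pre_pullback C v u f') (pre_pullback_map v u s) =
      Comp (arrow_cat Q) (comparison_sq C (Idt (arrow_cat C) u) s) (pre_pullback C v u f)"
proof -
  have s': "sdom s = f" "scod s = f'" "f \<in> Arr C" "f' \<in> Arr C" "stop s \<in> homset C (Dom C f) (Dom C f')"
    "sbot s \<in> homset C (Cod C f) (Cod C f')"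
    using s by (simp_all add: Square_hom_iff)
  have u': "u \<in> homset C (Dom C u) (Dom C v)" using homset_self[OF u] uv by simp
  have vu: "v \<cdot> u \<in> Arr C" "Dom C (v \<cdot> u) = Dom C u" "Cod C (v \<cdot> u) = Cod C v"
    using comp_arr u v uv by metis+
  let ?P = "pre_pullback C v u f" and ?P' = "pre_pullback C v u f'"
  let ?v = "sbot (comparison_sq C (Idt (arrow_cat C) v) s)"
  let ?w = "sbot (comparison_sq C (Idt (arrow_cat C) (v \<cdot> u)) s)"
  let ?u = "comparison_sq C (Idt (arrow_cat C) u) s"
  note m = pre_pullback_maps[OF u v uv s'(3)] and m' = pre_pullback_maps[OF u v uv s'(4)]
  note hv = comparison_sq_sbot_hom[OF v s] and hw = comparison_sq_sbot_hom[OF vu(1) s]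
    and hu = comparison_sq_sbot_hom[OF u s] comparison_sq_stop_hom[OF u s]
  have S: "src (sdom ?P) = sq_poset C v f" "src ?v = sq_poset C v f" "src ?w = sq_poset C (v \<cdot> u) f"
    "src (stop ?P) = sq_poset C v f" "src (sbot ?P) = sq_poset C (v \<cdot> u) f"
    "tgt (sdom ?P) = sq_poset C (v \<cdot> u) f" "tgt (sdom ?P') = sq_poset C (v \<cdot> u) f'" "src (sdom ?P') = sq_poset C v f'"
    using m m' hv hw by (simp_all add: homset_def)
  have sq1: "Square (v \<cdot> u) f (h \<cdot> u) k \<in> Arr (arrow_cat C)" if "Square v f h k \<in> Arr (arrow_cat C)" for h k
    using Ord_fn_Field[OF m(1), of "HSqr h k"] pre_pullback_fn(1)[OF that] that by (auto simp: Field_sq_poset)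
  have sq2: "Square u f h (k \<cdot> v) \<in> Arr (arrow_cat C)" if "Square (v \<cdot> u) f h k \<in> Arr (arrow_cat C)" for h k
    using Ord_fn_Field[OF m(3), of "HSqr h k"] pre_pullback_fn(3)[OF that] that by (auto simp: Field_sq_poset)
  have comm: "Comp Q ?w (sdom ?P) = Comp Q (sdom ?P') ?v"
  proof (rule Ord_hom_eqI[OF ord_category.comp_hom[OF Ord_category m(1) hw] ord_category.comp_hom[OF Ord_category hv m'(1)]])
    fix x assume x: "x \<in> Field (sq_poset C v f)"
    then obtain h k where hk: "x = HSqr h k" "Square v f h k \<in> Arr (arrow_cat C)" by (auto simp: Field_sq_poset)
    have "h \<in> homset C (Dom C v) (Dom C f)" using hk by (simp add: Square_arr_iff)
    then have "stop s \<cdot> (h \<cdot> u) = stop s \<cdot> h \<cdot> u" using comp_assoc[OF u' _ s'(5)] by simp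
    then show "fn (Comp Q ?w (sdom ?P)) x = fn (Comp Q (sdom ?P') ?v) x"
      using x pre_pullback_fn(1)[OF hk(2)] idsq_action[OF s hk(2)] idsq_action(1)[OF s sq1[OF hk(2)]]
        pre_pullback_fn(1)[OF idsq_action(2)[OF s hk(2)]] by (simp add: compose_def S hk(1) del: arrow_cat_simps(4))
  qed
  then show hom: "pre_pullback_map v u s \<in> homset (arrow_cat Q) (sdom ?P) (sdom ?P')"
    using homset_arr[OF m(1)] homset_arr[OF m'(1)] hv hw
    unfolding pre_pullback_map_def s' Square_hom_iff square.sel Ord_cat_simps(1,2) S by blast
  have "Comp Q (stop ?P') ?v = Comp Q (stop ?u) (stop ?P)"
  proof (rule Ord_hom_eqI[OF ord_category.comp_hom[OF Ord_category hv m'(2)] ord_category.comp_hom[OF Ord_category m(2) hu(2)]])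
    fix x assume x: "x \<in> Field (sq_poset C v f)"
    then obtain h k where hk: "x = HSqr h k" "Square v f h k \<in> Arr (arrow_cat C)" by (auto simp: Field_sq_poset)
    have "h \<in> homset C (Cod C u) (Dom C f)" using hk uv by (simp add: Square_arr_iff)
    then show "fn (Comp Q (stop ?P') ?v) x = fn (Comp Q (stop ?u) (stop ?P)) x"
      using x pre_pullback_fn(2)[OF hk(2)] idsq_action[OF s hk(2)] idsq_stop_action[OF u s]
        pre_pullback_fn(2)[OF idsq_action(2)[OF s hk(2)]] by (simp add: compose_def S hk(1) del: arrow_cat_simps(4))
  qed
  moreover have "Comp Q (sbot ?P') ?w = Comp Q (sbot ?u) (sbot ?P)"
  proof (rule Ord_hom_eqI[OF ord_category.comp_hom[OF Ord_category hw m'(3)] ord_category.comp_hom[OF Ord_category m(3) hu(1)]])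
    fix x assume x: "x \<in> Field (sq_poset C (v \<cdot> u) f)"
    then obtain h k where hk: "x = HSqr h k" "Square (v \<cdot> u) f h k \<in> Arr (arrow_cat C)" by (auto simp: Field_sq_poset)
    have "k \<in> homset C (Cod C v) (Cod C f)" using hk vu by (simp add: Square_arr_iff)
    then have "sbot s \<cdot> (k \<cdot> v) = sbot s \<cdot> k \<cdot> v" using comp_assoc[OF homset_self[OF v] _ s'(6)] by simp
    then show "fn (Comp Q (sbot ?P') ?w) x = fn (Comp Q (sbot ?u) (sbot ?P)) x"
      using x pre_pullback_fn(3)[OF hk(2)] idsq_action[OF s hk(2)] idsq_action(1)[OF s sq2[OF hk(2)]]
        pre_pullback_fn(3)[OF idsq_action(2)[OF s hk(2)]] by (simp add: compose_def S hk(1) del: arrow_cat_simps(4))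
  qed
  moreover have "sdom (pre_pullback_map v u s) = sdom ?P" using hom unfolding Square_hom_iff by blast
  moreover have "scod ?u = comparison C u f'" using comparison_sq_hom[OF idsq_hom[OF u] s] unfolding Square_hom_iff by blast
  ultimately show "Comp (arrow_cat Q) ?P' (pre_pullback_map v u s) = Comp (arrow_cat Q) ?u ?P"
    unfolding arrow_cat_simps(5) by (simp only: pre_pullback_map_def square.sel s' m'(4))
qed

end

section \<open>Lifting structures along colimits\<close>

lemma carries_lift_iff:
  "carries (lift_struct C M J P) f \<phi> \<longleftrightarrow> \<phi> \<in> extensional (Obj (Ver J)) \<and>
     (\<forall>j\<in>Obj (Ver J). carries M (comparison C (onObj (onVer P) j) f) (\<phi> j)) \<and>
     (\<forall>a\<in>Arr (Ver J). preserves M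
        (comparison C (onObj (onVer P) (Cod (Ver J) a)) f, \<phi> (Cod (Ver J) a))
        (comparison C (onObj (onVer P) (Dom (Ver J) a)) f, \<phi> (Dom (Ver J) a))
        (comparison_sq C (onArr (onVer P) a) (Idt (arrow_cat C) f))) \<and>
     (\<forall>(j, i)\<in>Obj (composable J). \<phi> (onObj (VComp J) (j, i)) =
        comp_struct M (pulled_back M (pre_pullback C (onObj (onVer P) j) (onObj (onVer P) i) f) (\<phi> i))
          (comparison C (onObj (onVer P) j) f, \<phi> j))"
  unfolding lift_struct_def Let_def by (simp only: arrow_struct.simps)

lemma preserves_lift_iff:
  "preserves (lift_struct C M J P) (f, \<phi>) (g, \<psi>) s \<longleftrightarrow> (\<forall>j\<in>Obj (Ver J).
     preserves M (comparison C (onObj (onVer P) j) f, \<phi> j) (comparison C (onObj (onVer P) j) g, \<psi> j)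
       (comparison_sq C (Idt (arrow_cat C) (onObj (onVer P) j)) s))"
  unfolding lift_struct_def Let_def by (simp only: arrow_struct.simps prod.case)

lemma (in small_hom_category) lift_struct_colimit:
  assumes S: "algebraic_struct Q T M r" and J: "internal_category J" and P: "internal_functor J (sq C) P"
    and D: "poset_diagram (arrow_cat C) r F e" and K: "poset_cocone (arrow_cat C) r F e f s"
    and colim: "\<And>u. u \<in> onObj (onVer P) ` Obj (Ver J) \<Longrightarrow>
      poset_colimit (arrow_cat Q) r (\<lambda>a. comparison C u (F a))
        (\<lambda>a b. comparison_sq C (Idt (arrow_cat C) u) (e a b)) (comparison C u f)
        (\<lambda>a. comparison_sq C (Idt (arrow_cat C) u) (s a))"
    and phi: "\<And>a. a \<in> Field r \<Longrightarrow> carries (lift_struct C M J P) (F a) (\<phi> a)"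
    and phi_mor: "\<And>a b. (a, b) \<in> r \<Longrightarrow> preserves (lift_struct C M J P) (F a, \<phi> a) (F b, \<phi> b) (e a b)"
  shows "\<exists>\<psi>. carries (lift_struct C M J P) f \<psi>"
proof -
  interpret S: algebraic_struct "Ord_cat U :: ('a hom_elem rel, 'a hmap) ordcat" T M r by (rule S)
  interpret A: ord_category "arrow_cat C" by (rule arrow_category)
  let ?A = "arrow_cat C" and ?AQ = "arrow_cat Q"
  let ?u = "onObj (onVer P)" and ?V = "Ver J"
  let ?i = "Idt (arrow_cat C)"
  have V: "ord_category ?V" using J by (rule internal_category.cat_Ver)
  have PV: "ord_functor ?V ?A (onVer P)" using internal_functor.functor_onVer[OF P] by (simp add: sq_def)
  have u: "?u j \<in> Arr C" if "j \<in> Obj ?V" for j using ord_functor.obj_map[OF PV that] by simp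
  have f: "f \<in> Arr C" using K by (simp add: poset_cocone_def)
  have F: "F a \<in> Arr C" and s: "s a \<in> homset ?A (F a) f" if "a \<in> Field r" for a
    using D K that by (auto simp: poset_diagram_def poset_cocone_def)
  have e: "e a b \<in> homset ?A (F a) (F b)" if "(a, b) \<in> r" for a b using D that unfolding poset_diagram_def by blast
  have c: "comparison C (?u j) g \<in> Arr Q" if "j \<in> Obj ?V" "g \<in> Arr C" for j g
    using comparison_arr(1)[OF u[OF that(1)] that(2)] .
  have pa: "carries M (comparison C (?u j) (F a)) (\<phi> a j)" if "a \<in> Field r" "j \<in> Obj ?V" for a j
    using phi[OF that(1)] that(2) unfolding carries_lift_iff by blast
  have wa: "S.wf_alg (comparison C (?u j) (F a)) (\<phi> a j)" if "a \<in> Field r" "j \<in> Obj ?V" for a j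
    using S.carries_wf[OF c[OF that(2) F[OF that(1)]] pa[OF that]] .
  have pe: "S.alg_mor (comparison C (?u j) (F a)) (\<phi> a j) (comparison C (?u j) (F b)) (\<phi> b j)
      (comparison_sq C (?i (?u j)) (e a b))" if ab: "(a, b) \<in> r" and j: "j \<in> Obj ?V" for a b j
  proof -
    have "a \<in> Field r" "b \<in> Field r" using ab by (auto simp: Field_def)
    then show ?thesis
      using S.preserves_alg_mor[OF wa wa comparison_sq_hom[OF idsq_hom[OF u[OF j]] e[OF ab]]] j phi_mor[OF ab]
      unfolding preserves_lift_iff by blast
  qed
  note col = colim[OF imageI]
  have "\<forall>j\<in>Obj ?V. \<exists>q. carries M (comparison C (?u j) f) q \<and> (\<forall>a\<in>Field r.
      S.alg_mor (comparison C (?u j) (F a)) (\<phi> a j) (comparison C (?u j) f) q (comparison_sq C (?i (?u j)) (s a)))"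
    using S.colimit_alg_exists[OF col pa pe] by blast
  then obtain q where q: "\<And>j. j \<in> Obj ?V \<Longrightarrow> carries M (comparison C (?u j) f) (q j)"
    and leg: "\<And>j a. j \<in> Obj ?V \<Longrightarrow> a \<in> Field r \<Longrightarrow> S.alg_mor (comparison C (?u j) (F a)) (\<phi> a j)
      (comparison C (?u j) f) (q j) (comparison_sq C (?i (?u j)) (s a))"
    by metis
  define \<psi> where "\<psi> = restrict q (Obj ?V)"
  have wq: "S.wf_alg (comparison C (?u j) f) (q j)" if "j \<in> Obj ?V" for j
    using S.carries_wf[OF c[OF that f] q[OF that]] .
  have arrows: "preserves M (comparison C (?u (Cod ?V a)) f, q (Cod ?V a)) (comparison C (?u (Dom ?V a)) f, q (Dom ?V a))
        (comparison_sq C (onArr (onVer P) a) (?i f))" if a: "a \<in> Arr ?V" for a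
  proof -
    let ?j = "Cod ?V a" and ?j' = "Dom ?V a"
    have jj: "?j \<in> Obj ?V" "?j' \<in> Obj ?V" using a ord_category.cod_obj[OF V] ord_category.dom_obj[OF V] by auto
    have t: "onArr (onVer P) a \<in> homset ?A (?u ?j') (?u ?j)" (is "?t \<in> _")
      using ord_functor.hom_map[OF PV homset_self[OF a]] .
    note hf = comparison_sq_hom[OF t idsq_hom[OF f]]
    have "S.alg_mor (comparison C (?u ?j) f) (q ?j) (comparison C (?u ?j') f) (q ?j') (comparison_sq C ?t (?i f))"
    proof (rule S.colimit_alg_mor[OF col[OF jj(1)] pa[OF _ jj(1)] pe[OF _ jj(1)] leg[OF jj(1)] wq[OF jj(1)] wq[OF jj(2)] hf])
      fix x assume x: "x \<in> Field r"
      note hF = comparison_sq_hom[OF t idsq_hom[OF F[OF x]]]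
      have "preserves M (comparison C (?u ?j) (F x), \<phi> x ?j) (comparison C (?u ?j') (F x), \<phi> x ?j')
        (comparison_sq C ?t (?i (F x)))" using phi[OF x] a unfolding carries_lift_iff by blast
      then have 1: "S.alg_mor (comparison C (?u ?j) (F x)) (\<phi> x ?j) (comparison C (?u ?j') (F x)) (\<phi> x ?j')
        (comparison_sq C ?t (?i (F x)))"
        using S.preserves_alg_mor[OF wa[OF x jj(1)] wa[OF x jj(2)] hF] by blast
      have "Comp ?AQ (comparison_sq C ?t (?i f)) (comparison_sq C (?i (?u ?j)) (s x)) = comparison_sq C ?t (s x)"
        using comparison_sq_comp[OF idsq_hom[OF u[OF jj(1)]] t s[OF x] idsq_hom[OF f]]
          A.idt_comp[OF t] A.idt_comp[OF s[OF x]] by metis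
      moreover have "Comp ?AQ (comparison_sq C (?i (?u ?j')) (s x)) (comparison_sq C ?t (?i (F x))) = comparison_sq C ?t (s x)"
        using comparison_sq_comp[OF t idsq_hom[OF u[OF jj(2)]] idsq_hom[OF F[OF x]] s[OF x]]
          A.comp_idt[OF t] A.comp_idt[OF s[OF x]] by metis
      ultimately show "S.alg_mor (comparison C (?u ?j) (F x)) (\<phi> x ?j) (comparison C (?u ?j') f) (q ?j')
         (Comp ?AQ (comparison_sq C ?t (?i f)) (comparison_sq C (?i (?u ?j)) (s x)))"
        using S.alg_mor_comp[OF 1 leg[OF jj(2) x]] by metis
    qed
    then show ?thesis using S.preserves_alg_mor[OF wq[OF jj(1)] wq[OF jj(2)] hf] by blast
  qed
  have comps: "q (onObj (VComp J) (j, i)) = comp_struct M (pulled_back M (pre_pullback C (?u j) (?u i) f) (q i))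
      (comparison C (?u j) f, q j)" and comps_obj: "onObj (VComp J) (j, i) \<in> Obj ?V" and ij_obj: "i \<in> Obj ?V" "j \<in> Obj ?V"
    if ji: "(j, i) \<in> Obj (composable J)" for j i
  proof -
    show i: "i \<in> Obj ?V" and j: "j \<in> Obj ?V" using ji by (auto simp: composable_def)
    have VD: "onObj (VCod J) i = onObj (VDom J) j" using ji by (simp add: composable_def)
    let ?k = "onObj (VComp J) (j, i)"
    show k: "?k \<in> Obj ?V" using ord_functor.obj_map[OF internal_category.functor_VComp[OF J] ji] .
    have uk: "?u ?k = ?u j \<cdot> ?u i"
      using internal_functor.vcomp_map[OF P] ji by (auto simp: feq_def fcomp_def fpair_def sq_def)
    have "Cod C (?u i) = onObj (onHor P) (onObj (VCod J) i)"
      using internal_functor.vcod_map[OF P] i by (simp add: feq_def fcomp_def sq_def)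
    also have "\<dots> = Dom C (?u j)"
      using internal_functor.vdom_map[OF P] j VD by (simp add: feq_def fcomp_def sq_def)
    finally have uv: "Cod C (?u i) = Dom C (?u j)" .
    let ?pb = "\<lambda>g. pre_pullback C (?u j) (?u i) g"
    have pb: "pullback_square Q (?pb g)" "scod (?pb g) = comparison C (?u i) g"
      "Comp Q (sdom (?pb g)) (comparison C (?u j) g) = comparison C (?u ?k) g"
      "Cod Q (comparison C (?u j) g) = Dom Q (sdom (?pb g))" if g: "g \<in> Arr C" for g
    proof -
      show "pullback_square Q (?pb g)" using pre_pullback_square[OF u[OF i] u[OF j] uv g] .
      show "scod (?pb g) = comparison C (?u i) g" using pre_pullback_maps(4)[OF u[OF i] u[OF j] uv g] .
      show "Comp Q (sdom (?pb g)) (comparison C (?u j) g) = comparison C (?u ?k) g"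
        using pre_pullback_comparison[OF u[OF i] u[OF j] uv g] unfolding uk .
      show "Cod Q (comparison C (?u j) g) = Dom Q (sdom (?pb g))"
        using pre_pullback_maps(1)[OF u[OF i] u[OF j] uv g] comparison_hom[OF u[OF j] g] unfolding homset_def by simp
    qed
    obtain b where b: "pulled_back M (?pb f) (q i) = (sdom (?pb f), b)"
      "S.alg_mor (sdom (?pb f)) b (comparison C (?u i) f) (q i) (?pb f)" "carries M (sdom (?pb f)) b"
      using S.pulled_back_eq[OF pb(1)[OF f]] q[OF i] unfolding pb(2)[OF f] by blast
    have wb: "S.wf_alg (sdom (?pb f)) b" using b(2) unfolding S.alg_mor_def by blast
    define q' where "q' = comp_struct M (sdom (?pb f), b) (comparison C (?u j) f, q j)"
    have wq': "S.wf_alg (comparison C (?u ?k) f) q'"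
      using S.comp_alg[OF c[OF j f] S.wf_algD(1)[OF wb] q[OF j] b(3) pb(4)[OF f]]
      unfolding S.wf_alg_iff q'_def pb(3)[OF f] .
    have "q ?k = q'"
    proof (rule S.colimit_alg_unique[OF col[OF k] pa[OF _ k] pe[OF _ k] leg[OF k] wq[OF k] _ wq'])
      fix x assume x: "x \<in> Field r"
      obtain bx where bx: "pulled_back M (?pb (F x)) (\<phi> x i) = (sdom (?pb (F x)), bx)"
        "S.alg_mor (sdom (?pb (F x))) bx (comparison C (?u i) (F x)) (\<phi> x i) (?pb (F x))" "carries M (sdom (?pb (F x))) bx"
        using S.pulled_back_eq[OF pb(1)[OF F[OF x]]] pa[OF x i] unfolding pb(2)[OF F[OF x]] by blast
      have phk: "\<phi> x ?k = comp_struct M (sdom (?pb (F x)), bx) (comparison C (?u j) (F x), \<phi> x j)"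
        using phi[OF x] ji bx(1) unfolding carries_lift_iff by fastforce
      let ?n = "pre_pullback_map (?u j) (?u i) (s x)"
      note n = pre_pullback_map_hom[OF u[OF i] u[OF j] uv s[OF x]]
      have "S.alg_mor (sdom (?pb (F x))) bx (comparison C (?u i) f) (q i) (Comp ?AQ (?pb f) ?n)"
        using S.alg_mor_comp[OF bx(2) leg[OF i x]] unfolding n(2) .
      then have nm: "S.alg_mor (sdom (?pb (F x))) bx (sdom (?pb f)) b ?n"
        using S.cartesian_alg[OF pb(1)[OF f]] b(2) n(1) unfolding pb(2)[OF f] by blast
      note lj = leg[OF j x]
      have st: "stop ?n = sbot (comparison_sq C (?i (?u j)) (s x))" by (simp add: pre_pullback_map_def)
      have sq: "Square (comparison C (?u ?k) (F x)) (comparison C (?u ?k) f)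
          (stop (comparison_sq C (?i (?u j)) (s x))) (sbot ?n) = comparison_sq C (?i (?u ?k)) (s x)"
      proof -
        have "sdom (s x) = F x" "scod (s x) = f" using s[OF x] by (auto simp: Square_hom_iff)
        moreover have "Cod C (?u j \<cdot> ?u i) = Cod C (?u j)" using comp_arr(3)[OF u[OF i] u[OF j]] uv by simp
        ultimately show ?thesis unfolding uk by (simp add: pre_pullback_map_def comparison_sq_def)
      qed
      have "Comp Q (stop (comparison_sq C (?i (?u j)) (s x))) (\<phi> x ?k) = Comp Q q'
        (stop (onArr T (Square (comparison C (?u ?k) (F x)) (comparison C (?u ?k) f)
          (stop (comparison_sq C (?i (?u j)) (s x))) (sbot ?n))))"
        unfolding phk q'_def pb(3)[OF f, symmetric] pb(3)[OF F[OF x], symmetric]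
        using lj nm pa[OF x j] bx(3) q[OF j] b(3) pb(4)[OF f] pb(4)[OF F[OF x]]
        unfolding S.alg_mor_def by (intro S.comp_natural st) blast+
      moreover have "stop (comparison_sq C (?i (?u ?k)) (s x)) = stop (comparison_sq C (?i (?u j)) (s x))"
        using arg_cong[OF sq, of stop] by simp
      ultimately have "Comp Q (stop (comparison_sq C (?i (?u ?k)) (s x))) (\<phi> x ?k) =
          Comp Q q' (stop (onArr T (comparison_sq C (?i (?u ?k)) (s x))))"
        unfolding sq by metis
      then show "S.alg_mor (comparison C (?u ?k) (F x)) (\<phi> x ?k) (comparison C (?u ?k) f) q' (comparison_sq C (?i (?u ?k)) (s x))"
        using wa[OF x k] wq' comparison_sq_hom[OF idsq_hom[OF u[OF k]] s[OF x]] unfolding S.alg_mor_def by blast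
    qed
    then show "q ?k = comp_struct M (pulled_back M (?pb f) (q i)) (comparison C (?u j) f, q j)"
      unfolding b(1) q'_def .
  qed
  have "carries (lift_struct C M J P) f \<psi>"
    unfolding carries_lift_iff
  proof (intro conjI ballI)
    show "\<psi> \<in> extensional (Obj ?V)" by (simp add: \<psi>_def)
    show "carries M (comparison C (?u j) f) (\<psi> j)" if "j \<in> Obj ?V" for j using q that by (simp add: \<psi>_def)
    fix a assume a: "a \<in> Arr ?V"
    then have "Cod ?V a \<in> Obj ?V" "Dom ?V a \<in> Obj ?V"
      using ord_category.cod_obj[OF V] ord_category.dom_obj[OF V] by auto
    then have "\<psi> (Cod ?V a) = q (Cod ?V a)" "\<psi> (Dom ?V a) = q (Dom ?V a)" by (simp_all add: \<psi>_def)
    then show "preserves M (comparison C (?u (Cod ?V a)) f, \<psi> (Cod ?V a)) (comparison C (?u (Dom ?V a)) f, \<psi> (Dom ?V a))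
        (comparison_sq C (onArr (onVer P) a) (?i f))" using arrows[OF a] by metis
  next
    fix ji assume "ji \<in> Obj (composable J)"
    then obtain j i where ji: "ji = (j, i)" "(j, i) \<in> Obj (composable J)" by (cases ji) auto
    show "case ji of (j, i) \<Rightarrow> \<psi> (onObj (VComp J) (j, i)) = comp_struct M
      (pulled_back M (pre_pullback C (?u j) (?u i) f) (\<psi> i)) (comparison C (?u j) f, \<psi> j)"
      using comps[OF ji(2)] comps_obj[OF ji(2)] ij_obj[OF ji(2)] unfolding ji(1) by (simp add: \<psi>_def)
  qed
  then show ?thesis by blast
qed

section \<open>Split epimorphisms and right adjoint left inverses\<close>

lemma (in ord_functor) poset_diagram_image:
  assumes "poset_diagram C r G t"
  shows "poset_diagram D r (\<lambda>a. onObj F (G a)) (\<lambda>a b. onArr F (t a b))"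
  unfolding poset_diagram_def
proof (intro conjI ballI)
  fix a assume a: "a \<in> Field r"
  then have "G a \<in> Obj C" "t a a = Idt C (G a)" using assms by (auto simp: poset_diagram_def)
  then show "onObj F (G a) \<in> Obj D" "onArr F (t a a) = Idt D (onObj F (G a))"
    using obj_map idt_map by auto
next
  have t: "t a b \<in> homset C (G a) (G b)" if "(a, b) \<in> r" for a b using assms that unfolding poset_diagram_def by blast
  have c: "Comp C (t b c) (t a b) = t a c" if "(a, b) \<in> r" "(b, c) \<in> r" for a b c
    using assms that unfolding poset_diagram_def by blast
  fix ab assume ab: "ab \<in> r"
  show "case ab of (a, b) \<Rightarrow> onArr F (t a b) \<in> homset D (onObj F (G a)) (onObj F (G b))"
    using hom_map t ab by auto
  show "case ab of (a, b) \<Rightarrow> \<forall>c. (b, c) \<in> r \<longrightarrow> Comp D (onArr F (t b c)) (onArr F (t a b)) = onArr F (t a c)"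
    using comp_map[OF t t] c ab by (auto split: prod.split)
qed

lemma (in ord_functor) poset_cocone_image:
  assumes d: "poset_diagram C r G t" and "poset_cocone C r G t c \<kappa>"
  shows "poset_cocone D r (\<lambda>a. onObj F (G a)) (\<lambda>a b. onArr F (t a b)) (onObj F c) (\<lambda>a. onArr F (\<kappa> a))"
proof -
  have t: "t a b \<in> homset C (G a) (G b)" if "(a, b) \<in> r" for a b using d that unfolding poset_diagram_def by blast
  have k: "c \<in> Obj C" "\<And>a. a \<in> Field r \<Longrightarrow> \<kappa> a \<in> homset C (G a) c" "\<And>a b. (a, b) \<in> r \<Longrightarrow> Comp C (\<kappa> b) (t a b) = \<kappa> a"
    using assms(2) unfolding poset_cocone_def by blast+
  have "Comp D (onArr F (\<kappa> b)) (onArr F (t a b)) = onArr F (\<kappa> a)" if ab: "(a, b) \<in> r" for a b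
  proof -
    have "b \<in> Field r" using ab by (auto simp: Field_def)
    then show ?thesis using comp_map[OF t[OF ab] k(2)] k(3)[OF ab] by metis
  qed
  then show ?thesis using k obj_map hom_map unfolding poset_cocone_def by blast
qed

definition cod_functor :: "('o, 'a) ordcat \<Rightarrow> ('a, 'a square, 'a, 'a square) ofunctor" where
  "cod_functor C = \<lparr>onObj = (\<lambda>f. Idt C (Cod C f)),
     onArr = (\<lambda>s. Square (Idt C (Cod C (sdom s))) (Idt C (Cod C (scod s))) (sbot s) (sbot s))\<rparr>"

context ord_category
begin

lemma cod_functor: "ord_functor (arrow_cat C) (arrow_cat C) (cod_functor C)"
  by unfold_locales
    (auto simp: cod_functor_def Square_hom_iff cat_simps idt_comp comp_idt)

lemma cod_alg_iff:
  "alg_sq C (cod_functor C) f p \<in> Arr (arrow_cat C) \<longleftrightarrow>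
    f \<in> Arr C \<and> p \<in> homset C (Cod C f) (Dom C f) \<and> f \<cdot> p = Idt C (Cod C f)"
  by (auto simp: alg_sq_def cod_functor_def Square_arr_iff cat_simps idt_hom idt_comp)

lemma cod_colimit:
  assumes colim: "poset_colimit (arrow_cat C) r G t g \<kappa>"
  shows "poset_colimit (arrow_cat C) r (\<lambda>a. onObj (cod_functor C) (G a)) (\<lambda>a b. onArr (cod_functor C) (t a b))
    (onObj (cod_functor C) g) (\<lambda>a. onArr (cod_functor C) (\<kappa> a))"
proof -
  let ?A = "arrow_cat C" and ?T = "cod_functor C"
  interpret T: ord_functor ?A ?A ?T by (rule cod_functor)
  have D: "poset_diagram ?A r G t" and K: "poset_cocone ?A r G t g \<kappa>"
    using colim by (auto simp: poset_colimit_def simp del: arrow_cat_simps)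
  have g: "g \<in> Arr C" using K by (simp add: poset_cocone_def)
  have G: "G a \<in> Arr C" if "a \<in> Field r" for a using D that by (simp add: poset_diagram_def)
  have k: "stop (\<kappa> a) \<in> homset C (Dom C (G a)) (Dom C g)" "sbot (\<kappa> a) \<in> homset C (Cod C (G a)) (Cod C g)"
    "sbot (\<kappa> a) \<cdot> G a = g \<cdot> stop (\<kappa> a)" "sdom (\<kappa> a) = G a" if "a \<in> Field r" for a
    using K that by (auto simp: poset_cocone_def Square_hom_iff)
  have tt: "t a b \<in> homset ?A (G a) (G b)" if "(a, b) \<in> r" for a b using D that unfolding poset_diagram_def by blast
  \<comment> \<open>An arrow \<open>w\<close> out of the codomain of \<open>f\<close> is a square from \<open>f\<close> to an identity.\<close>
  have ext: "Square f (Idt C X) (w \<cdot> f) w \<in> homset ?A f (Idt C X)"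
    if "f \<in> Arr C" "w \<in> homset C (Cod C f) X" "X \<in> Obj C" for f w X
    using that comp_hom[OF homset_self[OF that(1)] that(2)]
    by (intro Square_homI) (auto simp: cat_simps idt_comp)
  have legs: "Comp ?A (Square g (Idt C X) (w \<cdot> g) w) (\<kappa> a) = Square (G a) (Idt C X) (w \<cdot> sbot (\<kappa> a) \<cdot> G a) (w \<cdot> sbot (\<kappa> a))"
    if "a \<in> Field r" "w \<in> homset C (Cod C g) X" for a w X
    using comp_assoc[OF k(1)[OF that(1)] homset_self[OF g] that(2)]
      comp_assoc[OF homset_self[OF G[OF that(1)]] k(2)[OF that(1)] that(2)] k(3,4)[OF that(1)] by simp
  show ?thesis
    unfolding poset_colimit_def
  proof (intro conjI allI ballI impI T.poset_diagram_image[OF D] T.poset_cocone_image[OF D K])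
    fix h \<kappa>' assume K': "poset_cocone ?A r (\<lambda>a. onObj ?T (G a)) (\<lambda>a b. onArr ?T (t a b)) h \<kappa>'"
    have h: "h \<in> Arr C" using K' by (simp add: poset_cocone_def)
    have k': "stop (\<kappa>' a) \<in> homset C (Cod C (G a)) (Dom C h)" "sbot (\<kappa>' a) = h \<cdot> stop (\<kappa>' a)"
      "sdom (\<kappa>' a) = Idt C (Cod C (G a))" "scod (\<kappa>' a) = h" if a: "a \<in> Field r" for a
    proof -
      have "\<kappa>' a \<in> homset ?A (Idt C (Cod C (G a))) h"
        using K' a unfolding poset_cocone_def by (simp add: cod_functor_def)
      then have *: "stop (\<kappa>' a) \<in> homset C (Cod C (G a)) (Dom C h)" "sbot (\<kappa>' a) \<in> homset C (Cod C (G a)) (Cod C h)"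
        "sbot (\<kappa>' a) \<cdot> Idt C (Cod C (G a)) = h \<cdot> stop (\<kappa>' a)" "sdom (\<kappa>' a) = Idt C (Cod C (G a))" "scod (\<kappa>' a) = h"
        using G[OF a] by (auto simp: Square_hom_iff cat_simps)
      then show "stop (\<kappa>' a) \<in> homset C (Cod C (G a)) (Dom C h)" "sbot (\<kappa>' a) = h \<cdot> stop (\<kappa>' a)"
         "sdom (\<kappa>' a) = Idt C (Cod C (G a))" "scod (\<kappa>' a) = h"
        using comp_idt by auto
    qed
    have kt: "stop (\<kappa>' b) \<cdot> sbot (t a b) = stop (\<kappa>' a)" if "(a, b) \<in> r" for a b
    proof -
      have "Comp ?A (\<kappa>' b) (onArr ?T (t a b)) = \<kappa>' a" using K' that unfolding poset_cocone_def by blast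
      from arg_cong[OF this, of stop] show ?thesis by (simp add: cod_functor_def)
    qed
    define X where "X = Dom C h"
    have X: "X \<in> Obj C" using h dom_obj by (simp add: X_def)
    let ?x = "\<lambda>a. Square (G a) (Idt C X) (stop (\<kappa>' a) \<cdot> G a) (stop (\<kappa>' a))"
    have "poset_cocone ?A r G t (Idt C X) ?x"
      unfolding poset_cocone_def
    proof (intro conjI ballI)
      show "Idt C X \<in> Obj ?A" using X by (simp add: cat_simps)
      show "?x a \<in> homset ?A (G a) (Idt C X)" if "a \<in> Field r" for a
        using ext[OF G[OF that]] k'(1)[OF that] X by (simp add: X_def)
      fix ab assume "ab \<in> r"
      then obtain a b where ab: "ab = (a, b)" "(a, b) \<in> r" by (cases ab) auto
      then have F: "a \<in> Field r" "b \<in> Field r" by (auto simp: Field_def)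
      have t: "stop (t a b) \<in> homset C (Dom C (G a)) (Dom C (G b))" "sbot (t a b) \<in> homset C (Cod C (G a)) (Cod C (G b))"
        "sbot (t a b) \<cdot> G a = G b \<cdot> stop (t a b)" "sdom (t a b) = G a"
        using tt[OF ab(2)] by (auto simp: Square_hom_iff)
      have "stop (\<kappa>' b) \<cdot> G b \<cdot> stop (t a b) = stop (\<kappa>' a) \<cdot> G a"
        using comp_assoc[OF t(1) homset_self[OF G[OF F(2)]] k'(1)[OF F(2)]] t(3)
          comp_assoc[OF homset_self[OF G[OF F(1)]] t(2) k'(1)[OF F(2)]] kt[OF ab(2)] by simp
      then show "case ab of (a, b) \<Rightarrow> Comp ?A (?x b) (t a b) = ?x a" using kt[OF ab(2)] t(4) ab(1) by simp
    qed
    then obtain u where u: "u \<in> homset ?A g (Idt C X)" "\<And>a. a \<in> Field r \<Longrightarrow> Comp ?A u (\<kappa> a) = ?x a"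
      using colim unfolding poset_colimit_def by blast
    have w: "sbot u \<in> homset C (Cod C g) (Dom C h)" using u(1) X by (simp add: Square_hom_iff cat_simps X_def)
    have wk: "sbot u \<cdot> sbot (\<kappa> a) = stop (\<kappa>' a)" if "a \<in> Field r" for a
      using arg_cong[OF u(2)[OF that], of sbot] by simp
    let ?v = "Square (Idt C (Cod C g)) h (sbot u) (h \<cdot> sbot u)"
    have "?v \<in> homset ?A (onObj ?T g) h"
      using w g h comp_hom[OF w homset_self[OF h]] by (simp add: Square_hom_iff cod_functor_def cat_simps comp_idt)
    moreover have "Comp ?A ?v (onArr ?T (\<kappa> a)) = \<kappa>' a" if a: "a \<in> Field r" for a
      using wk[OF a] comp_assoc[OF k(2)[OF a] w homset_self[OF h]] k'[OF a] k(4)[OF a]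
      by (simp add: cod_functor_def square.expand)
    ultimately show "\<exists>u\<in>homset ?A (onObj ?T g) h. \<forall>a\<in>Field r. Comp ?A u (onArr ?T (\<kappa> a)) = \<kappa>' a" by blast
  next
    fix h u v assume uv: "u \<in> homset ?A (onObj ?T g) h" "v \<in> homset ?A (onObj ?T g) h"
      and le: "\<forall>a\<in>Field r. Le ?A (Comp ?A u (onArr ?T (\<kappa> a))) (Comp ?A v (onArr ?T (\<kappa> a)))"
    have w: "stop w \<in> homset C (Cod C g) (Dom C h) \<and> sbot w = h \<cdot> stop w \<and> h \<in> Arr C"
      if "w \<in> homset ?A (onObj ?T g) h" for w
      using that g comp_idt[of "sbot w" "Cod C g" "Cod C h"] by (auto simp: Square_hom_iff cod_functor_def cat_simps)
    note u = w[OF uv(1)] and v = w[OF uv(2)]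
    have X: "Dom C h \<in> Obj C" using u dom_obj by simp
    let ?e = "\<lambda>w. Square g (Idt C (Dom C h)) (stop w \<cdot> g) (stop w)"
    have "Le ?A (?e u) (?e v)"
    proof -
      have "Le ?A (Comp ?A (?e u) (\<kappa> a)) (Comp ?A (?e v) (\<kappa> a))" if a: "a \<in> Field r" for a
      proof -
        have 1: "Le C (stop u \<cdot> sbot (\<kappa> a)) (stop v \<cdot> sbot (\<kappa> a))" using le a by (simp add: cod_functor_def)
        have "Le C (stop u \<cdot> sbot (\<kappa> a) \<cdot> G a) (stop v \<cdot> sbot (\<kappa> a) \<cdot> G a)"
          using comp_mono[OF homset_self[OF G[OF a]] homset_self[OF G[OF a]] comp_hom[OF k(2)[OF a]] comp_hom[OF k(2)[OF a]]
            le_refl[OF G[OF a]] 1] u v by blast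
        then show ?thesis using 1 legs[OF a, of "stop u" "Dom C h"] legs[OF a, of "stop v" "Dom C h"] u v by simp
      qed
      then show ?thesis
        using colim ext[OF g _ X] u v unfolding poset_colimit_def by blast
    qed
    then have *: "Le C (stop u) (stop v)" by simp
    then have "Le C (h \<cdot> stop u) (h \<cdot> stop v)"
      using comp_mono[OF conjunct1[OF u] conjunct1[OF v] homset_self[of h] homset_self[of h] * le_refl[of h]] u by blast
    then show "Le ?A u v" using * u v by simp
  qed
qed

text \<open>Split epimorphisms and RALIs are treated together, \<open>b\<close> deciding whether the section is required
  to be a left adjoint.\<close>

lemma section_algebraic_struct:
  assumes carr: "\<And>f l. carries M f l \<longleftrightarrow> l \<in> homset C (Cod C f) (Dom C f) \<and> f \<cdot> l = Idt C (Cod C f) \<and>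
      (b \<longrightarrow> Le C (l \<cdot> f) (Idt C (Dom C f)))"
    and pres: "\<And>f l g m s. preserves M (f, l) (g, m) s \<longleftrightarrow> stop s \<cdot> l = m \<cdot> sbot s"
    and compM: "\<And>f l g m. comp_struct M (g, m) (f, l) = l \<cdot> m"
  shows "algebraic_struct C (cod_functor C) M r"
proof unfold_locales
  let ?A = "arrow_cat C" and ?T = "cod_functor C"
  interpret T: ord_functor ?A ?A ?T by (rule cod_functor)
  show "X \<in> Obj ?A \<Longrightarrow> onObj ?T X \<in> Obj ?A" for X by (rule T.obj_map)
  show "f \<in> homset ?A X Y \<Longrightarrow> onArr ?T f \<in> homset ?A (onObj ?T X) (onObj ?T Y)" for f X Y by (rule T.hom_map)
  show "X \<in> Obj ?A \<Longrightarrow> onArr ?T (Idt ?A X) = Idt ?A (onObj ?T X)" for X by (rule T.idt_map)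
  show "\<lbrakk>f \<in> homset ?A X Y; g \<in> homset ?A Y Z\<rbrakk> \<Longrightarrow> onArr ?T (Comp ?A g f) = Comp ?A (onArr ?T g) (onArr ?T f)"
    for f X Y g Z by (rule T.comp_map)
  show "\<lbrakk>f \<in> homset ?A X Y; g \<in> homset ?A X Y; Le ?A f g\<rbrakk> \<Longrightarrow> Le ?A (onArr ?T f) (onArr ?T g)" for f X Y g
    by (rule T.le_map)
  show "f \<in> Arr C \<Longrightarrow> Cod C (onObj ?T f) = Cod C f" for f by (simp add: cod_functor_def cat_simps)
  have st: "stop (onArr ?T s) = sbot s" for s by (simp add: cod_functor_def)
  show "sbot (onArr ?T s) = sbot s" for s by (simp add: cod_functor_def)
  show "poset_colimit ?A r G t g \<kappa> \<Longrightarrow>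
      poset_colimit ?A r (\<lambda>a. onObj ?T (G a)) (\<lambda>a b. onArr ?T (t a b)) (onObj ?T g) (\<lambda>a. onArr ?T (\<kappa> a))" for G t g \<kappa>
    by (rule cod_colimit)
  show "\<lbrakk>f \<in> Arr C; carries M f p\<rbrakk> \<Longrightarrow> alg_sq C ?T f p \<in> Arr ?A" for f p
    by (simp add: carr cod_alg_iff)
  show "preserves M (f, p) (g, q) s \<longleftrightarrow> stop s \<cdot> p = q \<cdot> stop (onArr ?T s)" for f p g q s
    by (simp add: pres st)
  show "carries M (sdom s) p" if s: "pullback_square C s" and q: "carries M (scod s) q"
    and p: "alg_sq C ?T (sdom s) p \<in> Arr ?A" and e: "stop s \<cdot> p = q \<cdot> stop (onArr ?T s)" for s q p
  proof -
    let ?g = "sdom s" and ?h = "scod s"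
    have p': "?g \<in> Arr C" "p \<in> homset C (Cod C ?g) (Dom C ?g)" "?g \<cdot> p = Idt C (Cod C ?g)"
      using p by (simp_all add: cod_alg_iff)
    have "s \<in> homset ?A ?g ?h" using s by (simp add: pullback_square_def homset_def)
    then have s': "?h \<in> Arr C" "stop s \<in> homset C (Dom C ?g) (Dom C ?h)" "sbot s \<in> homset C (Cod C ?g) (Cod C ?h)"
      "sbot s \<cdot> ?g = ?h \<cdot> stop s" by (simp_all add: Square_hom_iff)
    have gh: "?g \<in> homset C (Dom C ?g) (Cod C ?g)" "?h \<in> homset C (Dom C ?h) (Cod C ?h)"
      using homset_self[OF p'(1)] homset_self[OF s'(1)] .
    have q': "q \<in> homset C (Cod C ?h) (Dom C ?h)" using q carr by blast
    have "Le C (p \<cdot> ?g) (Idt C (Dom C ?g))" if b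
    proof -
      have "Le C (q \<cdot> ?h) (Idt C (Dom C ?h))" using q that carr by blast
      then have le: "Le C (q \<cdot> ?h \<cdot> stop s) (Idt C (Dom C ?h) \<cdot> stop s)"
        using comp_mono[OF s'(2) s'(2) comp_hom[OF gh(2) q'] idt_hom[OF dom_obj[OF s'(1)]] le_refl[OF homset_arr[OF s'(2)]]] by blast
      have "stop s \<cdot> (p \<cdot> ?g) = stop s \<cdot> p \<cdot> ?g" using comp_assoc[OF gh(1) p'(2) s'(2)] .
      also have "\<dots> = q \<cdot> ?h \<cdot> stop s"
        using e st comp_assoc[OF gh(1) s'(3) q'] comp_assoc[OF s'(2) gh(2) q'] s'(4) by simp
      finally have "Le C (stop s \<cdot> (p \<cdot> ?g)) (stop s \<cdot> Idt C (Dom C ?g))"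
        using le s'(2) by (simp add: idt_comp comp_idt)
      moreover have "?g \<cdot> (p \<cdot> ?g) = ?g \<cdot> Idt C (Dom C ?g)"
        using comp_assoc[OF gh(1) p'(2) gh(1)] p'(3) gh(1) by (simp add: idt_comp comp_idt)
      moreover have "?g \<cdot> Idt C (Dom C ?g) = ?g" using gh(1) comp_idt by blast
      ultimately show ?thesis
        using s le_refl[OF p'(1)] comp_hom[OF gh(1) p'(2)] idt_hom[OF dom_obj[OF p'(1)]]
        unfolding pullback_square_def by metis
    qed
    then show ?thesis using p' carr by blast
  qed
  show "carries M g q" if colim: "poset_colimit ?A r G t g \<kappa>" and p: "\<And>a. a \<in> Field r \<Longrightarrow> carries M (G a) (p a)"
    and q: "alg_sq C ?T g q \<in> Arr ?A" and e: "\<And>a. a \<in> Field r \<Longrightarrow> stop (\<kappa> a) \<cdot> p a = q \<cdot> stop (onArr ?T (\<kappa> a))" for G t g \<kappa> p q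
  proof -
    have q': "g \<in> Arr C" "q \<in> homset C (Cod C g) (Dom C g)" "g \<cdot> q = Idt C (Cod C g)"
      using q by (simp_all add: cod_alg_iff)
    have g: "g \<in> homset C (Dom C g) (Cod C g)" using homset_self[OF q'(1)] .
    have I: "Idt C (Cod C g) \<in> homset C (Cod C g) (Cod C g)" "Idt C (Dom C g) \<in> homset C (Dom C g) (Dom C g)"
      using q'(1) idt_hom dom_obj cod_obj by auto
    have "Le C (q \<cdot> g) (Idt C (Dom C g))" if b
    proof -
      have "g \<cdot> (q \<cdot> g) = g" using comp_assoc[OF g q'(2) g] q'(3) g by (simp add: idt_comp)
      then have h1: "Square g g (q \<cdot> g) (Idt C (Cod C g)) \<in> homset ?A g g" (is "?l \<in> _")
        using q' g I comp_hom[OF g q'(2)] by (intro Square_homI) (simp_all add: idt_comp)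
      have h2: "Square g g (Idt C (Dom C g)) (Idt C (Cod C g)) \<in> homset ?A g g" (is "?r \<in> _")
        using q' g I by (intro Square_homI) (simp_all add: idt_comp comp_idt)
      have "Le ?A (Comp ?A ?l (\<kappa> a)) (Comp ?A ?r (\<kappa> a))" if a: "a \<in> Field r" for a
      proof -
        have "\<kappa> a \<in> homset ?A (G a) g" using colim a unfolding poset_colimit_def poset_cocone_def by blast
        then have k: "G a \<in> Arr C" "stop (\<kappa> a) \<in> homset C (Dom C (G a)) (Dom C g)" "sbot (\<kappa> a) \<in> homset C (Cod C (G a)) (Cod C g)"
          "sbot (\<kappa> a) \<cdot> G a = g \<cdot> stop (\<kappa> a)" by (simp_all add: Square_hom_iff)
        have Ga: "G a \<in> homset C (Dom C (G a)) (Cod C (G a))" using homset_self[OF k(1)] .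
        have pa: "p a \<in> homset C (Cod C (G a)) (Dom C (G a))" "Le C (p a \<cdot> G a) (Idt C (Dom C (G a)))"
          using p[OF a] carr \<open>b\<close> by auto
        have "q \<cdot> g \<cdot> stop (\<kappa> a) = stop (\<kappa> a) \<cdot> (p a \<cdot> G a)"
          using comp_assoc[OF k(2) g q'(2)] comp_assoc[OF Ga k(3) q'(2)] comp_assoc[OF Ga pa(1) k(2)] e[OF a] st k(4) by simp
        moreover have "Le C (stop (\<kappa> a) \<cdot> (p a \<cdot> G a)) (stop (\<kappa> a) \<cdot> Idt C (Dom C (G a)))"
          using comp_mono[OF comp_hom[OF Ga pa(1)] idt_hom[OF dom_obj[OF k(1)]] k(2) k(2) pa(2) le_refl[OF homset_arr[OF k(2)]]] .
        ultimately show ?thesis using k le_refl[OF homset_arr[OF k(3)]] by (simp add: idt_comp comp_idt)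
      qed
      then have "Le ?A ?l ?r" using colim h1 h2 unfolding poset_colimit_def by blast
      then show ?thesis by simp
    qed
    then show ?thesis using q' carr by blast
  qed
  show "alg_sq C ?T (g \<cdot> f) (comp_struct M (g, q) (f, p)) \<in> Arr ?A"
    if fg: "f \<in> Arr C" "g \<in> Arr C" and p: "carries M f p" and q: "carries M g q" and c: "Cod C f = Dom C g" for f p g q
  proof -
    have f: "f \<in> homset C (Dom C f) (Dom C g)" and g: "g \<in> homset C (Dom C g) (Cod C g)" using fg c homset_self by metis+
    have p': "p \<in> homset C (Dom C g) (Dom C f)" "f \<cdot> p = Idt C (Dom C g)" and q': "q \<in> homset C (Cod C g) (Dom C g)" "g \<cdot> q = Idt C (Cod C g)"
      using p q carr c by auto
    have "g \<cdot> f \<cdot> (p \<cdot> q) = g \<cdot> (f \<cdot> p \<cdot> q)"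
      using comp_assoc[OF comp_hom[OF q'(1) p'(1)] f g] comp_assoc[OF q'(1) p'(1) f] by simp
    then have "g \<cdot> f \<cdot> (p \<cdot> q) = Idt C (Cod C g)" using p' q' by (simp add: idt_comp)
    then show ?thesis
      using comp_hom[OF f g] comp_hom[OF q'(1) p'(1)] by (simp add: cod_alg_iff compM homset_def)
  qed
  show "stop s \<cdot> comp_struct M (g, q) (f, p) = comp_struct M (g', q') (f', p') \<cdot>
      stop (onArr ?T (Square (g \<cdot> f) (g' \<cdot> f') (stop s) (sbot t)))"
    if p: "carries M f p" and q: "carries M g q" and c: "Cod C f = Dom C g"
    and p': "carries M f' p'" and q': "carries M g' q'" and c': "Cod C f' = Dom C g'"
    and s: "s \<in> homset ?A f f'" and t: "t \<in> homset ?A g g'" and st': "stop t = sbot s"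
    and ep: "stop s \<cdot> p = p' \<cdot> stop (onArr ?T s)" and eq: "stop t \<cdot> q = q' \<cdot> stop (onArr ?T t)" for f p g q f' p' g' q' s t
  proof -
    have h: "p \<in> homset C (Dom C g) (Dom C f)" "p' \<in> homset C (Dom C g') (Dom C f')"
      "q \<in> homset C (Cod C g) (Dom C g)" "q' \<in> homset C (Cod C g') (Dom C g')"
      using p q p' q' c c' carr by auto
    have k: "stop s \<in> homset C (Dom C f) (Dom C f')" "stop t \<in> homset C (Dom C g) (Dom C g')" "sbot t \<in> homset C (Cod C g) (Cod C g')"
      using s t by (simp_all add: Square_hom_iff)
    have "stop s \<cdot> (p \<cdot> q) = p' \<cdot> stop t \<cdot> q" using comp_assoc[OF h(3,1) k(1)] ep st st' by simp
    also have "\<dots> = p' \<cdot> q' \<cdot> sbot t" using comp_assoc[OF h(3) k(2) h(2)] comp_assoc[OF k(3) h(4,2)] eq st by simp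
    finally show ?thesis by (simp add: compM st)
  qed
qed

lemma rali_algebraic_struct: "algebraic_struct C (cod_functor C) (rali_struct C) r"
  by (rule section_algebraic_struct[where b = True]) (simp_all add: rali_struct_def)

lemma split_epi_algebraic_struct: "algebraic_struct C (cod_functor C) (split_epi_struct C) r"
  by (rule section_algebraic_struct[where b = False]) (simp_all add: split_epi_struct_def)

end

section \<open>Algebraic weak factorisation systems\<close>

lemma universe_infinite:
  assumes "universe (U :: 'u itself)" shows "infinite (UNIV :: 'u set)"
proof -
  obtain h :: "nat \<Rightarrow> 'u" where "inj h"
    using lesspoll_imp_lepoll[OF assms[unfolded universe_def small_def, THEN conjunct1]] unfolding lepoll_def by blast
  then show ?thesis using range_inj_infinite finite_subset[OF subset_UNIV] by blast
qed

text \<open>The poset \<open>r\<close> as a category; \<open>c\<close> encodes pairs so that arrows have the type of the objects.\<close>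

definition poset_cat :: "('i \<times> 'i \<Rightarrow> 'i) \<Rightarrow> 'i rel \<Rightarrow> ('i, 'i) ordcat" where
  "poset_cat c r = \<lparr>Obj = Field r, Arr = c ` r, Dom = (\<lambda>e. fst (inv c e)), Cod = (\<lambda>e. snd (inv c e)),
     Idt = (\<lambda>x. c (x, x)), Comp = (\<lambda>g f. c (fst (inv c f), snd (inv c g))), Le = (=)\<rparr>"

definition point_weight :: "'w \<Rightarrow> ('d, 'e, 'w rel, ('w rel, 'w) smap) ofunctor" where
  "point_weight z = \<lparr>onObj = (\<lambda>_. {(z, z)}), onArr = (\<lambda>_. SMap {(z, z)} {(z, z)} (\<lambda>x\<in>{z}. x))\<rparr>"

definition poset_functor :: "('i \<times> 'i \<Rightarrow> 'i) \<Rightarrow> ('i \<Rightarrow> 'o) \<Rightarrow> ('i \<Rightarrow> 'i \<Rightarrow> 'a) \<Rightarrow> ('i, 'i, 'o, 'a) ofunctor" where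
  "poset_functor c G t = \<lparr>onObj = G, onArr = (\<lambda>e. t (fst (inv c e)) (snd (inv c e)))\<rparr>"

lemma poset_cat_hom:
  assumes "inj c"
  shows "f \<in> homset (poset_cat c r) x y \<longleftrightarrow> f = c (x, y) \<and> (x, y) \<in> r"
  using assms by (auto simp: homset_def poset_cat_def)

lemma poset_cat_category:
  assumes c: "inj c" and r: "Partial_order r"
  shows "ord_category (poset_cat c r)"
proof -
  have refl: "(x, x) \<in> r" if "x \<in> Field r" for x
    using r that by (auto simp: partial_order_on_def preorder_on_def refl_on_def)
  have tr: "(x, z) \<in> r" if "(x, y) \<in> r" "(y, z) \<in> r" for x y z
    using r that unfolding partial_order_on_def preorder_on_def trans_def by blast
  have dec: "inv c (c p) = p" for p using c by simp
  let ?D = "poset_cat c r"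
  show ?thesis
  proof
    fix f assume "f \<in> Arr ?D"
    then show "Dom ?D f \<in> Obj ?D" "Cod ?D f \<in> Obj ?D" "Le ?D f f"
      using dec by (auto simp: poset_cat_def Field_def)
  next
    show "X \<in> Obj ?D \<Longrightarrow> Idt ?D X \<in> homset ?D X X" for X
      unfolding poset_cat_hom[OF c] using refl by (simp add: poset_cat_def)
    show "\<lbrakk>f \<in> homset ?D X Y; g \<in> homset ?D Y Z\<rbrakk> \<Longrightarrow> Comp ?D g f \<in> homset ?D X Z" for f g X Y Z
      unfolding poset_cat_hom[OF c] using tr dec by (auto simp: poset_cat_def)
    show "f \<in> homset ?D X Y \<Longrightarrow> Comp ?D f (Idt ?D X) = f" "f \<in> homset ?D X Y \<Longrightarrow> Comp ?D (Idt ?D Y) f = f" for f X Y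
      unfolding poset_cat_hom[OF c] using dec by (auto simp: poset_cat_def)
    show "\<lbrakk>f \<in> homset ?D W X; g \<in> homset ?D X Y; h \<in> homset ?D Y Z\<rbrakk> \<Longrightarrow>
        Comp ?D h (Comp ?D g f) = Comp ?D (Comp ?D h g) f" for f g h W X Y Z
      unfolding poset_cat_hom[OF c] using dec by (auto simp: poset_cat_def)
  qed (simp_all add: poset_cat_def)
qed

lemma point_weight_functor:
  assumes U: "universe U" and c: "inj c"
  shows "ord_functor (op_cat (poset_cat c r)) (Ord_cat U) (point_weight z)"
proof -
  have "small U {z}" by (rule finite_small[OF U]) simp
  then have p: "{(z, z)} \<in> Obj (Ord_cat U)"
    by (simp add: Ord_obj_iff partial_order_on_def preorder_on_def refl_on_def trans_def antisym_def)
  show ?thesis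
    by unfold_locales (use p in \<open>auto simp: point_weight_def Ord_hom_iff op_cat_def compose_def\<close>)
qed

lemma (in ord_category) poset_functor_functor:
  assumes c: "inj c" and D: "poset_diagram C r G t"
  shows "ord_functor (poset_cat c r) C (poset_functor c G t)"
proof -
  have t: "t a b \<in> homset C (G a) (G b)" if "(a, b) \<in> r" for a b using D that unfolding poset_diagram_def by blast
  have o: "G a \<in> Obj C" "t a a = Idt C (G a)" if "a \<in> Field r" for a using D that unfolding poset_diagram_def by blast+
  have cc: "t b d \<cdot> t a b = t a d" if "(a, b) \<in> r" "(b, d) \<in> r" for a b d
    using D that unfolding poset_diagram_def by blast
  have le: "Le C (t a b) (t a b)" if "(a, b) \<in> r" for a b using le_refl[OF homset_arr[OF t[OF that]]] .
  show ?thesis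
  proof
    show "onObj (poset_functor c G t) X \<in> Obj C" "onArr (poset_functor c G t) (Idt (poset_cat c r) X) = Idt C (onObj (poset_functor c G t) X)"
      if "X \<in> Obj (poset_cat c r)" for X
      using that o c by (auto simp: poset_cat_def poset_functor_def)
    show "onArr (poset_functor c G t) f \<in> homset C (onObj (poset_functor c G t) X) (onObj (poset_functor c G t) Y)"
      if "f \<in> homset (poset_cat c r) X Y" for f X Y
      using that t c by (auto simp: poset_cat_hom[OF c] poset_functor_def)
    show "onArr (poset_functor c G t) (Comp (poset_cat c r) g f) = onArr (poset_functor c G t) g \<cdot> onArr (poset_functor c G t) f"
      if "f \<in> homset (poset_cat c r) X Y" "g \<in> homset (poset_cat c r) Y Z" for f g X Y Z
      using that cc c by (simp add: poset_cat_hom[OF c]) (auto simp: poset_cat_def poset_functor_def)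
    show "Le C (onArr (poset_functor c G t) f) (onArr (poset_functor c G t) g)"
      if "f \<in> homset (poset_cat c r) X Y" "g \<in> homset (poset_cat c r) X Y" for f g X Y
      using that le c by (auto simp: poset_cat_hom[OF c] poset_functor_def)
  qed
qed

lemma (in ord_category) weighted_cocone_iff:
  assumes c: "inj c" and G: "\<And>a b. (a, b) \<in> r \<Longrightarrow> onArr G (c (a, b)) = t a b"
  shows "weighted_cocone (poset_cat c r) (point_weight z) C G v k \<longleftrightarrow> poset_cocone C r (onObj G) t v (\<lambda>a. k a z)"
proof -
  have "Le C (k a z) (k a z)" if "k a z \<in> homset C (onObj G a) v" for a
    using le_refl[OF homset_arr[OF that]] .
  then show ?thesis
    using c G by (auto simp: weighted_cocone_def poset_cocone_def poset_cat_def point_weight_def Ball_def)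
qed

lemma (in ord_category) weighted_colimit_iff:
  assumes c: "inj c" and G: "\<And>a b. (a, b) \<in> r \<Longrightarrow> onArr G (c (a, b)) = t a b"
    and D: "poset_diagram C r (onObj G) t"
  shows "weighted_colimit (poset_cat c r) (point_weight z) C G v (\<lambda>a _. k a) \<longleftrightarrow> poset_colimit C r (onObj G) t v k"
    (is "?l \<longleftrightarrow> ?r")
proof -
  have s: "Obj (poset_cat c r) = Field r" "Field (onObj (point_weight z) d) = {z}" for d
    by (auto simp: poset_cat_def point_weight_def)
  have W: "weighted_cocone (poset_cat c r) (point_weight z) C G v k \<longleftrightarrow> poset_cocone C r (onObj G) t v (\<lambda>a. k a z)"
    for v k by (rule weighted_cocone_iff[OF c]) (rule G)
  show ?thesis
  proof
    assume l: ?l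
    note l1 = l[unfolded weighted_colimit_def s, THEN conjunct1]
      and l2 = l[unfolded weighted_colimit_def s, THEN conjunct2, THEN conjunct1, rule_format]
      and l3 = l[unfolded weighted_colimit_def s, THEN conjunct2, THEN conjunct2, rule_format]
    show ?r unfolding poset_colimit_def
    proof (intro conjI allI ballI impI D)
      show "poset_cocone C r (onObj G) t v k" using l1 unfolding W .
      fix v' k' assume "poset_cocone C r (onObj G) t v' k'"
      then have "weighted_cocone (poset_cat c r) (point_weight z) C G v' (\<lambda>a _. k' a)" unfolding W .
      then obtain u where "u \<in> homset C v v' \<and> (\<forall>a\<in>Field r. \<forall>x\<in>{z}. k' a = u \<cdot> k a)"
        using ex1_implies_ex[OF l2] by blast
      then show "\<exists>u\<in>homset C v v'. \<forall>a\<in>Field r. u \<cdot> k a = k' a" by auto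
    next
      fix v' x y assume xy: "x \<in> homset C v v'" "y \<in> homset C v v'" "\<forall>a\<in>Field r. Le C (x \<cdot> k a) (y \<cdot> k a)"
      then have "v' \<in> Obj C" using cod_obj[OF homset_arr[OF xy(1)]] by (simp add: homset_def)
      then show "Le C x y" using l3[OF _ xy(1,2)] xy(3) by blast
    qed
  next
    assume r: ?r
    note r1 = r[unfolded poset_colimit_def, THEN conjunct2, THEN conjunct1]
      and r2 = r[unfolded poset_colimit_def, THEN conjunct2, THEN conjunct2, THEN conjunct1, rule_format]
      and r3 = r[unfolded poset_colimit_def, THEN conjunct2, THEN conjunct2, THEN conjunct2, rule_format]
    show ?l unfolding weighted_colimit_def s
    proof (intro conjI allI ballI impI)
      show "weighted_cocone (poset_cat c r) (point_weight z) C G v (\<lambda>a _. k a)"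
        using r1 unfolding W .
      fix v' k' assume "weighted_cocone (poset_cat c r) (point_weight z) C G v' k'"
      then have "poset_cocone C r (onObj G) t v' (\<lambda>a. k' a z)" unfolding W .
      then obtain u where u: "u \<in> homset C v v'" "\<And>a. a \<in> Field r \<Longrightarrow> u \<cdot> k a = k' a z"
        using r2 by blast
      show "\<exists>!u. u \<in> homset C v v' \<and> (\<forall>d\<in>Field r. \<forall>x\<in>{z}. k' d x = u \<cdot> k d)"
      proof (rule ex1I[of _ u])
        show "u \<in> homset C v v' \<and> (\<forall>d\<in>Field r. \<forall>x\<in>{z}. k' d x = u \<cdot> k d)" using u by simp
        fix u' assume "u' \<in> homset C v v' \<and> (\<forall>d\<in>Field r. \<forall>x\<in>{z}. k' d x = u' \<cdot> k d)"
        then show "u' = u" using colimit_unique[OF r, of u' v' u] u by simp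
      qed
    next
      fix v' x y assume "v' \<in> Obj C" "x \<in> homset C v v'" "y \<in> homset C v v'"
        "\<forall>d\<in>Field r. \<forall>i\<in>{z}. Le C (x \<cdot> k d) (y \<cdot> k d)"
      then show "Le C x y" using r3[of x v' y] by simp
    qed
  qed
qed

lemma cocontinuous_poset_colimit:
  fixes U :: "'u itself" and r :: "'u rel"
  assumes U: "universe U" and T: "cocontinuous U X Y T" "ord_functor X Y T" and X: "ord_category X" and Y: "ord_category Y"
    and r: "Partial_order r" "small U (Field r)" and colim: "poset_colimit X r G t g \<kappa>"
  shows "poset_colimit Y r (\<lambda>a. onObj T (G a)) (\<lambda>a b. onArr T (t a b)) (onObj T g) (\<lambda>a. onArr T (\<kappa> a))"
proof -
  have "infinite (UNIV :: 'u set)" using universe_infinite[OF U] .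
  then have "(UNIV :: 'u set) \<times> (UNIV :: 'u set) \<lesssim> (UNIV :: 'u set)"
    using eqpoll_iff_card_of_ordIso[THEN iffD2, OF card_of_Times_same_infinite] eqpoll_imp_lepoll by blast
  then obtain c :: "'u \<times> 'u \<Rightarrow> 'u" where c: "inj c" unfolding lepoll_def by auto
  let ?D = "poset_cat c r" and ?G = "poset_functor c G t" and ?W = "point_weight undefined :: ('u, 'u, 'u rel, ('u rel, 'u) smap) ofunctor"
  have D: "poset_diagram X r G t" using colim unfolding poset_colimit_def by blast
  have "r \<subseteq> Field r \<times> Field r" by (auto dest: Field_mono)
  then have "small U (c ` r)"
    using small_image[OF small_subset[OF _ small_times[OF U r(2) r(2)]]] by blast
  then have sm: "small_cat U ?D" using r(2) by (simp add: small_cat_def poset_cat_def)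
  have G: "onArr ?G (c (a, b)) = t a b" "onObj ?G = G" for a b using c by (simp_all add: poset_functor_def)
  have TG: "onArr (fcomp T ?G) (c (a, b)) = onArr T (t a b)" "onObj (fcomp T ?G) = (\<lambda>a. onObj T (G a))" for a b
    by (simp_all add: fcomp_def G)
  have "weighted_colimit ?D ?W X ?G g (\<lambda>a _. \<kappa> a)"
    using ord_category.weighted_colimit_iff[OF X c, of r ?G t "undefined :: 'u" g \<kappa>] G D colim by simp
  then have "weighted_colimit ?D ?W Y (fcomp T ?G) (onObj T g) (\<lambda>a _. onArr T (\<kappa> a))"
    using T(1)[unfolded cocontinuous_def, rule_format, of ?D ?W ?G g "\<lambda>a _. \<kappa> a"]
      poset_cat_category[OF c r(1)] sm point_weight_functor[OF U c, of r "undefined :: 'u"]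
      ord_category.poset_functor_functor[OF X c D] by simp
  then show ?thesis
    using ord_category.weighted_colimit_iff[OF Y c, of r "fcomp T ?G" "\<lambda>a b. onArr T (t a b)"
      "undefined :: 'u" "onObj T g" "\<lambda>a. onArr T (\<kappa> a)"]
      TG ord_functor.poset_diagram_image[OF T(2) D] by simp
qed

context ord_awfs
begin

abbreviation "AC \<equiv> arrow_cat C"
abbreviation "T \<equiv> R_functor W"

lemma T_simps [simp]: "onObj T f = Rm W f" "stop (onArr T s) = onArr (KF W) s" "sbot (onArr T s) = sbot s"
  "sdom (onArr T s) = Rm W (sdom s)" "scod (onArr T s) = Rm W (scod s)"
  by (simp_all add: R_functor_def)

lemma alg_square_eq: "alg_square C W (f, p) = alg_sq C T f p"
  by (simp add: alg_square_def alg_sq_def)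

lemma awfs_carries_iff: "carries (awfs_struct C W) f p \<longleftrightarrow> f \<in> Arr C \<and> alg_sq C T f p \<in> homset AC (Rm W f) f \<and>
    Comp AC (alg_sq C T f p) (Lambda C W f) = Idt AC f \<and>
    Comp AC (alg_sq C T f p) (Pi_sq C W f) = Comp AC (alg_sq C T f p) (onArr T (alg_sq C T f p))"
  unfolding awfs_struct_def em_algebra_def arrow_struct.simps alg_square_eq by simp

end

lemma awfs_algebraic_struct:
  assumes C: "ord_category C" and W: "ord_awfs C W"
    and colimT: "\<And>G t g \<kappa>. poset_colimit (arrow_cat C) r G t g \<kappa> \<Longrightarrow>
      poset_colimit (arrow_cat C) r (\<lambda>a. onObj (R_functor W) (G a)) (\<lambda>a b. onArr (R_functor W) (t a b))
        (onObj (R_functor W) g) (\<lambda>a. onArr (R_functor W) (\<kappa> a))"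
  shows "algebraic_struct C (R_functor W) (awfs_struct C W) r"
proof -
  interpret ord_category C by (rule C)
  interpret W: ord_awfs C W by (rule W)
  interpret A: ord_category "arrow_cat C" by (rule arrow_category)
  interpret Rm: ord_monad "arrow_cat C" "R_functor W" "Lambda C W" "Pi_sq C W" by (rule W.R_monad)
  interpret T: ord_functor "arrow_cat C" "arrow_cat C" "R_functor W" by (rule Rm.functor_T)
  interpret Lc: ord_comonad "arrow_cat C" "L_functor W" "Phi C W" "Sigma_sq C W" by (rule W.L_comonad)
  interpret L: ord_functor "arrow_cat C" "arrow_cat C" "L_functor W" by (rule Lc.functor_G)
  interpret K: ord_functor "arrow_cat C" C "KF W" by (rule W.functor_K)
  let ?A = "arrow_cat C" and ?T = "R_functor W" and ?M = "awfs_struct C W"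
  let ?al = "alg_sq C ?T"
  have aho: "?al f p \<in> homset ?A (Rm W f) f" if "?al f p \<in> Arr ?A" for f p
    using that by (simp add: homset_def alg_sq_def)
  have lam: "Lambda C W f \<in> homset ?A f (Rm W f)" if "f \<in> Arr C" for f
    using Rm.unit_nat that by (simp add: nat_trans_def fid_def)
  have lam_nat: "Comp ?A (Lambda C W g) s = Comp ?A (onArr ?T s) (Lambda C W f)" if "s \<in> homset ?A f g" for s f g
    using Rm.unit_nat that homsetD[OF that] unfolding nat_trans_def fid_def ofunctor.simps by metis
  have pi: "Pi_sq C W f \<in> homset ?A (Rm W (Rm W f)) (Rm W f)" if "f \<in> Arr C" for f
    using Rm.mult_nat that by (simp add: nat_trans_def fcomp_def)
  have pi_nat: "Comp ?A (Pi_sq C W g) (onArr ?T (onArr ?T s)) = Comp ?A (onArr ?T s) (Pi_sq C W f)" if "s \<in> homset ?A f g" for s f g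
    using Rm.mult_nat that homsetD[OF that] unfolding nat_trans_def fcomp_def ofunctor.simps by metis
  have Th: "onArr ?T s \<in> homset ?A (Rm W f) (Rm W g)" if "s \<in> homset ?A f g" for s f g
    using T.hom_map[OF that] by simp
  have mor: "Comp ?A s (?al f p) = Comp ?A (?al g q) (onArr ?T s) \<longleftrightarrow> stop s \<cdot> p = q \<cdot> stop (onArr ?T s)"
    if "s \<in> homset ?A f g" for f p g q s
    using that by (auto simp: alg_sq_def Square_hom_iff comp_idt idt_comp)
  show ?thesis
  proof (unfold_locales)
    show "Cod C (onObj ?T f) = Cod C f" if "f \<in> Arr C" for f using W.R_hom[OF that] by (simp add: homset_def)
    show "sbot (onArr ?T s) = sbot s" for s by simp
    show "poset_colimit ?A r G t g \<kappa> \<Longrightarrow>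
      poset_colimit ?A r (\<lambda>a. onObj ?T (G a)) (\<lambda>a b. onArr ?T (t a b)) (onObj ?T g) (\<lambda>a. onArr ?T (\<kappa> a))" for G t g \<kappa>
      by (rule colimT)
    show "carries ?M f p \<Longrightarrow> ?al f p \<in> Arr ?A" for f p
      unfolding W.awfs_carries_iff by (elim conjE) (rule homset_arr)
    show "preserves ?M (f, p) (g, q) s \<longleftrightarrow> stop s \<cdot> p = q \<cdot> stop (onArr ?T s)" if "s \<in> homset ?A f g" for f p g q s
      using mor[OF that] unfolding awfs_struct_def arrow_struct.simps W.alg_square_eq .
    show "carries ?M (sdom s) p" if s: "pullback_square C s" and q: "carries ?M (scod s) q"
      and p: "?al (sdom s) p \<in> Arr ?A" and e: "stop s \<cdot> p = q \<cdot> stop (onArr ?T s)" for s q p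
    proof -
      let ?g = "sdom s" and ?h = "scod s"
      let ?a = "?al ?g p" and ?b = "?al ?h q"
      have sh: "s \<in> homset ?A ?g ?h" using s by (simp add: pullback_square_def homset_def)
      have a: "?a \<in> homset ?A (Rm W ?g) ?g" using aho[OF p] .
      have g: "?g \<in> Arr C" using sh by (simp add: Square_hom_iff)
      have b: "?h \<in> Arr C" "?b \<in> homset ?A (Rm W ?h) ?h" "Comp ?A ?b (Lambda C W ?h) = Idt ?A ?h"
        "Comp ?A ?b (Pi_sq C W ?h) = Comp ?A ?b (onArr ?T ?b)" using q unfolding W.awfs_carries_iff by blast+
      have sa: "Comp ?A s ?a = Comp ?A ?b (onArr ?T s)" using mor[OF sh] e by simp
      have cancel: "x = y" if x: "x \<in> homset ?A k ?g" and y: "y \<in> homset ?A k ?g" and "sbot x = sbot y"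
        "Comp ?A s x = Comp ?A s y" for x y k
      proof -
        have "stop x = stop y"
        proof (rule pullback_unique[OF s])
          show "stop x \<in> homset C (Dom C k) (Dom C ?g)" "stop y \<in> homset C (Dom C k) (Dom C ?g)"
            using x y by (simp_all add: Square_hom_iff)
          show "?g \<cdot> stop x = ?g \<cdot> stop y" using x y \<open>sbot x = sbot y\<close> unfolding Square_hom_iff by metis
          show "stop s \<cdot> stop x = stop s \<cdot> stop y" using that(4) by simp
        qed
        then show ?thesis using x y \<open>sbot x = sbot y\<close> by (simp add: Square_hom_iff square.expand)
      qed
      have "Comp ?A ?a (Lambda C W ?g) = Idt ?A ?g"
      proof (rule cancel[OF A.comp_hom[OF lam[OF g] a]])
        show I: "Idt ?A ?g \<in> homset ?A ?g ?g" using A.idt_hom g by (metis arrow_cat_simps(1))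
        show "sbot (Comp ?A ?a (Lambda C W ?g)) = sbot (Idt ?A ?g)"
          using g by (simp add: alg_sq_def Lambda_def cat_simps)
        have "Comp ?A s (Comp ?A ?a (Lambda C W ?g)) = Comp ?A ?b (Comp ?A (onArr ?T s) (Lambda C W ?g))"
          using A.comp_assoc[OF lam[OF g] a sh] A.comp_assoc[OF lam[OF g] Th[OF sh] b(2)] sa by metis
        also have "\<dots> = Comp ?A (Idt ?A ?h) s"
          using lam_nat[OF sh] A.comp_assoc[OF sh lam[OF b(1)] b(2)] b(3) by metis
        also have "\<dots> = Comp ?A s (Idt ?A ?g)" using A.idt_comp[OF sh] A.comp_idt[OF sh] by metis
        finally show "Comp ?A s (Comp ?A ?a (Lambda C W ?g)) = Comp ?A s (Idt ?A ?g)" .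
      qed
      moreover have "Comp ?A ?a (Pi_sq C W ?g) = Comp ?A ?a (onArr ?T ?a)"
      proof (rule cancel[OF A.comp_hom[OF pi[OF g] a] A.comp_hom[OF Th[OF a] a]])
        show "sbot (Comp ?A ?a (Pi_sq C W ?g)) = sbot (Comp ?A ?a (onArr ?T ?a))"
          by (simp add: alg_sq_def Pi_sq_def)
        have "Comp ?A s (Comp ?A ?a (Pi_sq C W ?g)) = Comp ?A ?b (Comp ?A (onArr ?T s) (Pi_sq C W ?g))"
          using A.comp_assoc[OF pi[OF g] a sh] A.comp_assoc[OF pi[OF g] Th[OF sh] b(2)] sa by metis
        also have "\<dots> = Comp ?A (Comp ?A ?b (onArr ?T ?b)) (onArr ?T (onArr ?T s))"
          using pi_nat[OF sh] A.comp_assoc[OF Th[OF Th[OF sh]] pi[OF b(1)] b(2)] b(4) by metis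
        also have "\<dots> = Comp ?A ?b (onArr ?T (Comp ?A ?b (onArr ?T s)))"
          using A.comp_assoc[OF Th[OF Th[OF sh]] Th[OF b(2)] b(2)] T.comp_map[OF Th[OF sh] b(2)] by metis
        also have "\<dots> = Comp ?A ?b (Comp ?A (onArr ?T s) (onArr ?T ?a))"
          using T.comp_map[OF a sh] sa by metis
        also have "\<dots> = Comp ?A s (Comp ?A ?a (onArr ?T ?a))"
          using A.comp_assoc[OF Th[OF a] Th[OF sh] b(2)] A.comp_assoc[OF Th[OF a] a sh] sa by metis
        finally show "Comp ?A s (Comp ?A ?a (Pi_sq C W ?g)) = Comp ?A s (Comp ?A ?a (onArr ?T ?a))" .
      qed
      ultimately show ?thesis using g a unfolding W.awfs_carries_iff by blast
    qed
    show "carries ?M g q" if colim: "poset_colimit ?A r G t g \<kappa>" and p: "\<And>a. a \<in> Field r \<Longrightarrow> carries ?M (G a) (p a)"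
      and q: "?al g q \<in> Arr ?A" and e: "\<And>a. a \<in> Field r \<Longrightarrow> stop (\<kappa> a) \<cdot> p a = q \<cdot> stop (onArr ?T (\<kappa> a))" for G t g \<kappa> p q
    proof -
      let ?b = "?al g q"
      have b: "?b \<in> homset ?A (Rm W g) g" using aho[OF q] .
      have g: "g \<in> Arr C" using b by (simp add: Square_hom_iff)
      have k: "\<kappa> a \<in> homset ?A (G a) g" if "a \<in> Field r" for a
        using colim that unfolding poset_colimit_def poset_cocone_def by blast
      have G: "G a \<in> Arr C" "?al (G a) (p a) \<in> homset ?A (Rm W (G a)) (G a)"
        "Comp ?A (?al (G a) (p a)) (Lambda C W (G a)) = Idt ?A (G a)"
        "Comp ?A (?al (G a) (p a)) (Pi_sq C W (G a)) = Comp ?A (?al (G a) (p a)) (onArr ?T (?al (G a) (p a)))"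
        if "a \<in> Field r" for a using p[OF that] unfolding W.awfs_carries_iff by blast+
      have ka: "Comp ?A (\<kappa> a) (?al (G a) (p a)) = Comp ?A ?b (onArr ?T (\<kappa> a))" if "a \<in> Field r" for a
        using mor[OF k[OF that]] e[OF that] by simp
      have I: "Idt ?A g \<in> homset ?A g g" using A.idt_hom g by (metis arrow_cat_simps(1))
      have "Comp ?A ?b (Lambda C W g) = Idt ?A g"
      proof (rule A.colimit_unique[OF colim A.comp_hom[OF lam[OF g] b] I])
        fix a assume a: "a \<in> Field r"
        have "Comp ?A (Comp ?A ?b (Lambda C W g)) (\<kappa> a) = Comp ?A ?b (Comp ?A (onArr ?T (\<kappa> a)) (Lambda C W (G a)))"
          using A.comp_assoc[OF k[OF a] lam[OF g] b] lam_nat[OF k[OF a]] by metis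
        also have "\<dots> = Comp ?A (\<kappa> a) (Idt ?A (G a))"
          using A.comp_assoc[OF lam[OF G(1)[OF a]] Th[OF k[OF a]] b] ka[OF a]
            A.comp_assoc[OF lam[OF G(1)[OF a]] G(2)[OF a] k[OF a]] G(3)[OF a] by metis
        also have "\<dots> = Comp ?A (Idt ?A g) (\<kappa> a)" using A.idt_comp[OF k[OF a]] A.comp_idt[OF k[OF a]] by metis
        finally show "Comp ?A (Comp ?A ?b (Lambda C W g)) (\<kappa> a) = Comp ?A (Idt ?A g) (\<kappa> a)" .
      qed
      moreover have "Comp ?A ?b (Pi_sq C W g) = Comp ?A ?b (onArr ?T ?b)"
      proof (rule A.colimit_unique[OF colimT[OF colimT[OF colim]], unfolded W.T_simps, OF A.comp_hom[OF pi[OF g] b] A.comp_hom[OF Th[OF b] b]])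
        fix a assume a: "a \<in> Field r"
        note k = k[OF a] and G = G[OF a] and ka = ka[OF a]
        let ?a = "?al (G a) (p a)"
        have "Comp ?A (Comp ?A ?b (Pi_sq C W g)) (onArr ?T (onArr ?T (\<kappa> a))) = Comp ?A ?b (Comp ?A (onArr ?T (\<kappa> a)) (Pi_sq C W (G a)))"
          using A.comp_assoc[OF Th[OF Th[OF k]] pi[OF g] b] pi_nat[OF k] by metis
        also have "\<dots> = Comp ?A (\<kappa> a) (Comp ?A ?a (onArr ?T ?a))"
          using A.comp_assoc[OF pi[OF G(1)] Th[OF k] b] ka A.comp_assoc[OF pi[OF G(1)] G(2) k] G(4) by metis
        also have "\<dots> = Comp ?A ?b (Comp ?A (onArr ?T (\<kappa> a)) (onArr ?T ?a))"
          using A.comp_assoc[OF Th[OF G(2)] G(2) k] ka A.comp_assoc[OF Th[OF G(2)] Th[OF k] b] by metis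
        also have "\<dots> = Comp ?A ?b (Comp ?A (onArr ?T ?b) (onArr ?T (onArr ?T (\<kappa> a))))"
          using T.comp_map[OF G(2) k] T.comp_map[OF Th[OF k] b] ka by metis
        also have "\<dots> = Comp ?A (Comp ?A ?b (onArr ?T ?b)) (onArr ?T (onArr ?T (\<kappa> a)))"
          using A.comp_assoc[OF Th[OF Th[OF k]] Th[OF b] b] .
        finally show "Comp ?A (Comp ?A ?b (Pi_sq C W g)) (onArr ?T (onArr ?T (\<kappa> a))) =
          Comp ?A (Comp ?A ?b (onArr ?T ?b)) (onArr ?T (onArr ?T (\<kappa> a)))" .
      qed
      ultimately show ?thesis using g b unfolding W.awfs_carries_iff by blast
    qed
    have KR: "onArr (KF W) s \<in> homset C (onObj (KF W) f) (onObj (KF W) g)" "Rm W g \<cdot> onArr (KF W) s = sbot s \<cdot> Rm W f"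
      "onArr (KF W) s \<cdot> Lm W f = Lm W g \<cdot> stop s" "f \<in> Arr C" "g \<in> Arr C"
      if "s \<in> homset ?A f g" for s f g
    proof -
      show "onArr (KF W) s \<in> homset C (onObj (KF W) f) (onObj (KF W) g)" using K.hom_map[OF that] .
      show "Rm W g \<cdot> onArr (KF W) s = sbot s \<cdot> Rm W f" using Th[OF that] by (simp add: Square_hom_iff)
      have "onArr (L_functor W) s \<in> homset ?A (Lm W f) (Lm W g)" using L.hom_map[OF that] by (simp add: L_functor_def)
      then show "onArr (KF W) s \<cdot> Lm W f = Lm W g \<cdot> stop s" by (simp add: Square_hom_iff L_functor_def)
      show "f \<in> Arr C" "g \<in> Arr C" using that by (simp_all add: Square_hom_iff)
    qed
    have alD: "f \<in> Arr C" "p \<in> homset C (onObj (KF W) f) (Dom C f)" "f \<cdot> p = Rm W f" "p \<cdot> Lm W f = Idt C (Dom C f)"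
      if "carries ?M f p" for f p
    proof -
      have 1: "f \<in> Arr C" "?al f p \<in> homset ?A (Rm W f) f" "Comp ?A (?al f p) (Lambda C W f) = Idt ?A f"
        using that unfolding W.awfs_carries_iff by blast+
      show "f \<in> Arr C" by (rule 1)
      show "p \<in> homset C (onObj (KF W) f) (Dom C f)" "f \<cdot> p = Rm W f"
        using 1(2) W.R_hom[OF 1(1)] idt_comp[OF W.R_hom[OF 1(1)]] by (simp_all add: Square_hom_iff alg_sq_def homset_def[of C])
      show "p \<cdot> Lm W f = Idt C (Dom C f)" using arg_cong[OF 1(3), of stop] by (simp add: alg_sq_def Lambda_def)
    qed
    have com: "comul W f \<in> homset C (onObj (KF W) f) (onObj (KF W) (Lm W f))" "Rm W (Lm W f) \<cdot> comul W f = Idt C (onObj (KF W) f)"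
      if "f \<in> Arr C" for f
    proof -
      have L: "Lm W f \<in> Arr C" "Cod C (Lm W f) = onObj (KF W) f" using W.L_hom[OF that] by (simp_all add: homset_def)
      have "Sigma_sq C W f \<in> homset ?A (Lm W f) (Lm W (Lm W f))"
        using Lc.comult_nat that by (simp add: nat_trans_def fcomp_def L_functor_def)
      then show "comul W f \<in> homset C (onObj (KF W) f) (onObj (KF W) (Lm W f))"
        using W.L_hom[OF L(1)] L by (simp add: Square_hom_iff Sigma_sq_def homset_def[of C])
      show "Rm W (Lm W f) \<cdot> comul W f = Idt C (onObj (KF W) f)"
        using arg_cong[OF Lc.counit_left, of f sbot] that L by (simp add: Phi_def Sigma_sq_def L_functor_def)
    qed
    have com_nat: "comul W g \<cdot> onArr (KF W) s = onArr (KF W) (Square (Lm W f) (Lm W g) (stop s) (onArr (KF W) s)) \<cdot> comul W f"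
      if "s \<in> homset ?A f g" for f g s
    proof -
      have "Comp ?A (Sigma_sq C W g) (onArr (L_functor W) s) = Comp ?A (onArr (fcomp (L_functor W) (L_functor W)) s) (Sigma_sq C W f)"
        using Lc.comult_nat that homsetD[OF that] unfolding nat_trans_def by metis
      then show ?thesis using homsetD[OF that] arg_cong[of _ _ sbot] by (fastforce simp: Sigma_sq_def L_functor_def fcomp_def)
    qed
    define t where "t f g q = q \<cdot> onArr (KF W) (Square (g \<cdot> f) g f (Idt C (Cod C g)))" for f g q
    define A2 where "A2 f g q = Square (Lm W (g \<cdot> f)) f (Idt C (Dom C f)) (t f g q)" for f g q
    have comp_eq: "comp_struct ?M (g, q) (f, p) = p \<cdot> (onArr (KF W) (A2 f g q) \<cdot> comul W (g \<cdot> f))" for f g p q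
      by (simp add: awfs_struct_def Let_def t_def A2_def)
    have facts: "g \<cdot> f \<in> Arr C" "Dom C (g \<cdot> f) = Dom C f" "Cod C (g \<cdot> f) = Cod C g"
       "Square (g \<cdot> f) g f (Idt C (Cod C g)) \<in> homset ?A (g \<cdot> f) g"
       "t f g q \<in> homset C (onObj (KF W) (g \<cdot> f)) (Cod C f)" "g \<cdot> t f g q = Rm W (g \<cdot> f)"
       "A2 f g q \<in> homset ?A (Lm W (g \<cdot> f)) f"
      if f: "f \<in> Arr C" and q: "carries ?M g q" and c: "Cod C f = Dom C g" for f g q
    proof -
      note q' = alD[OF q]
      show h: "g \<cdot> f \<in> Arr C" "Dom C (g \<cdot> f) = Dom C f" "Cod C (g \<cdot> f) = Cod C g" using comp_arr[OF f q'(1)] c by auto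
      have f': "f \<in> homset C (Dom C f) (Dom C g)" using homset_self[OF f] c by simp
      show A1: "Square (g \<cdot> f) g f (Idt C (Cod C g)) \<in> homset ?A (g \<cdot> f) g" (is "?A1 \<in> _")
        using h q'(1) f' idt_hom[OF cod_obj[OF q'(1)]] by (intro Square_homI) (simp_all add: id_left)
      have g: "g \<in> homset C (Dom C g) (Cod C g)" using homset_self[OF q'(1)] .
      show th: "t f g q \<in> homset C (onObj (KF W) (g \<cdot> f)) (Cod C f)"
        using comp_hom[OF KR(1)[OF A1] q'(2)] c by (simp add: t_def)
      have Rh: "Rm W (g \<cdot> f) \<in> homset C (onObj (KF W) (g \<cdot> f)) (Cod C g)" using W.R_hom[OF h(1)] h by simp
      show "g \<cdot> t f g q = Rm W (g \<cdot> f)"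
        using comp_assoc[OF KR(1)[OF A1] q'(2) g] q'(3) KR(2)[OF A1] idt_comp[OF Rh] by (simp add: t_def)
      have Lh: "Lm W (g \<cdot> f) \<in> homset C (Dom C f) (onObj (KF W) (g \<cdot> f))" using W.L_hom[OF h(1)] h by simp
      have Lg: "Lm W g \<in> homset C (Dom C g) (onObj (KF W) g)" using W.L_hom[OF q'(1)] .
      have "t f g q \<cdot> Lm W (g \<cdot> f) = q \<cdot> (Lm W g \<cdot> f)"
        using comp_assoc[OF Lh KR(1)[OF A1] q'(2)] KR(3)[OF A1] by (simp add: t_def)
      also have "\<dots> = f" using comp_assoc[OF f' Lg q'(2)] q'(4) idt_comp[OF f'] by simp
      finally have "t f g q \<cdot> Lm W (g \<cdot> f) = f \<cdot> Idt C (Dom C f)" using comp_idt[OF f'] by simp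
      then show "A2 f g q \<in> homset ?A (Lm W (g \<cdot> f)) f"
        using Lh f th idt_hom[OF dom_obj[OF f]] unfolding A2_def by (intro Square_homI) (simp_all add: homset_def)
    qed
    show "?al (g \<cdot> f) (comp_struct ?M (g, q) (f, p)) \<in> Arr ?A"
      if f: "f \<in> Arr C" and p: "carries ?M f p" and q: "carries ?M g q" and c: "Cod C f = Dom C g" for f p g q
    proof -
      note h = facts[OF f q c] and p' = alD[OF p] and q' = alD[OF q]
      let ?h = "g \<cdot> f" and ?k = "onArr (KF W) (A2 f g q)"
      note k = KR[OF h(7)] and cm = com[OF h(1)]
      have fh: "f \<in> homset C (Dom C f) (Dom C g)" "g \<in> homset C (Dom C g) (Cod C g)"
        using homset_self[OF f] homset_self[OF q'(1)] c by simp_all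
      have x: "p \<cdot> (?k \<cdot> comul W ?h) \<in> homset C (onObj (KF W) ?h) (Dom C f)"
        using comp_hom[OF comp_hom[OF cm(1) k(1)] p'(2)] .
      have RL: "Rm W (Lm W ?h) \<in> homset C (onObj (KF W) (Lm W ?h)) (onObj (KF W) ?h)"
        using W.R_hom[of "Lm W ?h"] W.L_hom[OF h(1)] by (simp add: homset_def)
      have "f \<cdot> (p \<cdot> (?k \<cdot> comul W ?h)) = Rm W f \<cdot> ?k \<cdot> comul W ?h"
        using comp_assoc[OF comp_hom[OF cm(1) k(1)] p'(2) fh(1)] p'(3)
          comp_assoc[OF cm(1) k(1) W.R_hom[OF f]] by simp
      also have "\<dots> = t f g q \<cdot> (Rm W (Lm W ?h) \<cdot> comul W ?h)"
        using k(2) comp_assoc[OF cm(1) RL h(5)] by (simp add: A2_def)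
      also have "\<dots> = t f g q" using cm(2) comp_idt[OF h(5)] by simp
      finally have "?h \<cdot> (p \<cdot> (?k \<cdot> comul W ?h)) = Rm W ?h"
        using comp_assoc[OF x fh(1) fh(2)] h(6) by simp
      moreover have "Dom C (Rm W ?h) = onObj (KF W) ?h" "Cod C (Rm W ?h) = Cod C g" "Rm W ?h \<in> Arr C"
        using W.R_hom[OF h(1)] h by (simp_all add: homset_def)
      ultimately show ?thesis
        unfolding comp_eq using h x idt_hom[OF cod_obj[OF q'(1)]] by (simp add: alg_sq_def Square_arr_iff id_left)
    qed
    show "stop s \<cdot> comp_struct ?M (g, q) (f, p) = comp_struct ?M (g', q') (f', p') \<cdot>
        stop (onArr ?T (Square (g \<cdot> f) (g' \<cdot> f') (stop s) (sbot u)))"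
      if p: "carries ?M f p" and q: "carries ?M g q" and c: "Cod C f = Dom C g"
      and p': "carries ?M f' p'" and q': "carries ?M g' q'" and c': "Cod C f' = Dom C g'"
      and s: "s \<in> homset ?A f f'" and u: "u \<in> homset ?A g g'" and su: "stop u = sbot s"
      and ep: "stop s \<cdot> p = p' \<cdot> stop (onArr ?T s)" and eq: "stop u \<cdot> q = q' \<cdot> stop (onArr ?T u)" for f p g q f' p' g' q' s u
    proof -
      note P = alD[OF p] and Q = alD[OF q] and P' = alD[OF p'] and Q' = alD[OF q']
      note h = facts[OF P(1) q c] and h' = facts[OF P'(1) q' c']
      let ?h = "g \<cdot> f" and ?h' = "g' \<cdot> f'"
      let ?S = "Square ?h ?h' (stop s) (sbot u)"
      let ?K = "onArr (KF W)"
      let ?A1 = "Square ?h g f (Idt C (Cod C g))" and ?A1' = "Square ?h' g' f' (Idt C (Cod C g'))"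
      have S: "stop s \<in> homset C (Dom C f) (Dom C f')" "sbot s \<in> homset C (Dom C g) (Dom C g')" "sbot s \<cdot> f = f' \<cdot> stop s"
        "sbot u \<in> homset C (Cod C g) (Cod C g')" "sbot u \<cdot> g = g' \<cdot> sbot s"
        using s u su c c' by (simp_all add: Square_hom_iff)
      have ff: "f \<in> homset C (Dom C f) (Dom C g)" "f' \<in> homset C (Dom C f') (Dom C g')" "g \<in> homset C (Dom C g) (Cod C g)"
        "g' \<in> homset C (Dom C g') (Cod C g')"
        using homset_self P(1) P'(1) Q(1) Q'(1) c c' by metis+
      have "sbot u \<cdot> ?h = g' \<cdot> (sbot s \<cdot> f)"
        using comp_assoc[OF ff(1) ff(3) S(4)] S(5) comp_assoc[OF ff(1) S(2) ff(4)] by simp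
      also have "\<dots> = ?h' \<cdot> stop s" using S(3) comp_assoc[OF S(1) ff(2) ff(4)] by simp
      finally have Sh: "?S \<in> homset ?A ?h ?h'"
        using h h' S by (intro Square_homI) simp_all
      have "Comp ?A ?A1' ?S = Comp ?A u ?A1"
      proof -
        have "Idt C (Cod C g') \<cdot> sbot u = sbot u" "sbot u \<cdot> Idt C (Cod C g) = sbot u" using idt_comp comp_idt S(4) by blast+
        moreover have "scod u = g'" using u by (simp add: Square_hom_iff)
        ultimately show ?thesis using S(3) su by simp
      qed
      then have K1: "?K ?A1' \<cdot> ?K ?S = ?K u \<cdot> ?K ?A1"
        using K.comp_map[OF Sh h'(4)] K.comp_map[OF h(4) u] by metis
      have "t f' g' q' \<cdot> ?K ?S = q' \<cdot> (?K ?A1' \<cdot> ?K ?S)"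
        using comp_assoc[OF KR(1)[OF Sh] KR(1)[OF h'(4)] Q'(2)] by (simp add: t_def)
      also have "\<dots> = q' \<cdot> ?K u \<cdot> ?K ?A1" using K1 comp_assoc[OF KR(1)[OF h(4)] KR(1)[OF u] Q'(2)] by simp
      also have "\<dots> = sbot s \<cdot> t f g q"
        using eq su comp_assoc[OF KR(1)[OF h(4)] Q(2) S(2)] by (simp add: t_def)
      finally have ts: "t f' g' q' \<cdot> ?K ?S = sbot s \<cdot> t f g q" .
      let ?L = "Square (Lm W ?h) (Lm W ?h') (stop s) (?K ?S)"
      have Lh: "?L \<in> homset ?A (Lm W ?h) (Lm W ?h')" using L.hom_map[OF Sh] by (simp add: L_functor_def)
      have "Comp ?A (A2 f' g' q') ?L = Comp ?A s (A2 f g q)"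
      proof -
        have "Idt C (Dom C f') \<cdot> stop s = stop s" "stop s \<cdot> Idt C (Dom C f) = stop s" using idt_comp comp_idt S(1) by blast+
        moreover have "scod s = f'" using s by (simp add: Square_hom_iff)
        ultimately show ?thesis using ts by (simp add: A2_def)
      qed
      then have K2: "?K (A2 f' g' q') \<cdot> ?K ?L = ?K s \<cdot> ?K (A2 f g q)"
        using K.comp_map[OF Lh h'(7)] K.comp_map[OF h(7) s] by metis
      have "stop s \<cdot> (p \<cdot> (?K (A2 f g q) \<cdot> comul W ?h)) = p' \<cdot> ?K s \<cdot> (?K (A2 f g q) \<cdot> comul W ?h)"
        using comp_assoc[OF comp_hom[OF com(1)[OF h(1)] KR(1)[OF h(7)]] P(2) S(1)] ep by simp
      also have "\<dots> = p' \<cdot> (?K (A2 f' g' q') \<cdot> ?K ?L \<cdot> comul W ?h)"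
        using comp_assoc[OF comp_hom[OF com(1)[OF h(1)] KR(1)[OF h(7)]] KR(1)[OF s] P'(2)]
          comp_assoc[OF com(1)[OF h(1)] KR(1)[OF h(7)] KR(1)[OF s]] K2 by simp
      also have "?K (A2 f' g' q') \<cdot> ?K ?L \<cdot> comul W ?h = ?K (A2 f' g' q') \<cdot> (comul W ?h' \<cdot> ?K ?S)"
        using comp_assoc[OF com(1)[OF h(1)] KR(1)[OF Lh] KR(1)[OF h'(7)]] com_nat[OF Sh] by simp
      also have "\<dots> = ?K (A2 f' g' q') \<cdot> comul W ?h' \<cdot> ?K ?S"
        using comp_assoc[OF KR(1)[OF Sh] com(1)[OF h'(1)] KR(1)[OF h'(7)]] .
      also have "p' \<cdot> \<dots> = p' \<cdot> (?K (A2 f' g' q') \<cdot> comul W ?h') \<cdot> ?K ?S"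
        using comp_assoc[OF KR(1)[OF Sh] comp_hom[OF com(1)[OF h'(1)] KR(1)[OF h'(7)]] P'(2)] .
      finally show ?thesis unfolding comp_eq by simp
    qed
  qed
qed

lemma poset_colimit_cong:
  assumes "\<And>a. a \<in> Field r \<Longrightarrow> G a = G' a"
  shows "poset_colimit X r G t c \<kappa> \<longleftrightarrow> poset_colimit X r G' t c \<kappa>"
proof -
  have e: "G a = G' a" "G b = G' b" if "(a, b) \<in> r" for a b
    using assms that by (auto simp: Field_def)
  have "poset_diagram X r G t \<longleftrightarrow> poset_diagram X r G' t"
    unfolding poset_diagram_def using assms e by (intro conj_cong ball_cong refl) (auto split: prod.split)
  moreover have "poset_cocone X r G t c' \<kappa>' \<longleftrightarrow> poset_cocone X r G' t c' \<kappa>'" for c' \<kappa>'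
    unfolding poset_cocone_def using assms by auto
  ultimately show ?thesis unfolding poset_colimit_def by simp
qed

lemma (in small_hom_category) comparison_colimit:
  assumes D: "poset_diagram (arrow_cat C) r F e" and K: "poset_cocone (arrow_cat C) r F e f s" and u: "u \<in> Arr C"
    and r: "\<And>a b. \<lbrakk>a \<in> Field r; b \<in> Field r\<rbrakk> \<Longrightarrow> \<exists>d. (a, d) \<in> r \<and> (b, d) \<in> r"
    and top: "\<And>d. d \<in> homset C (Cod C u) (Dom C f) \<Longrightarrow>
      \<exists>a\<in>Field r. \<exists>d'\<in>homset C (Cod C u) (Dom C (F a)). stop (s a) \<cdot> d' = d"
    and bot: "\<And>h k. Square u f h k \<in> Arr (arrow_cat C) \<Longrightarrow>
      \<exists>a\<in>Field r. \<exists>h' k'. Square u (F a) h' k' \<in> Arr (arrow_cat C) \<and> stop (s a) \<cdot> h' = h \<and> sbot (s a) \<cdot> k' = k"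
    and emb: "\<And>a Y d d'. \<lbrakk>a \<in> Field r; d \<in> homset C Y (Dom C (F a)); d' \<in> homset C Y (Dom C (F a));
      Le C (stop (s a) \<cdot> d) (stop (s a) \<cdot> d')\<rbrakk> \<Longrightarrow> Le C d d'"
    and emb': "\<And>a Y d d'. \<lbrakk>a \<in> Field r; d \<in> homset C Y (Cod C (F a)); d' \<in> homset C Y (Cod C (F a));
      Le C (sbot (s a) \<cdot> d) (sbot (s a) \<cdot> d')\<rbrakk> \<Longrightarrow> Le C d d'"
  shows "poset_colimit (arrow_cat Q) r (\<lambda>a. comparison C u (F a)) (\<lambda>a b. comparison_sq C (Idt (arrow_cat C) u) (e a b))
    (comparison C u f) (\<lambda>a. comparison_sq C (Idt (arrow_cat C) u) (s a))"
proof -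
  interpret Q: ord_category "Ord_cat U :: ('a hom_elem rel, 'a hmap) ordcat" by (rule Ord_category)
  interpret A: ord_category "arrow_cat C" by (rule arrow_category)
  let ?i = "Idt (arrow_cat C) u" and ?AQ = "arrow_cat Q"
  note i = idsq_hom[OF u]
  have f: "f \<in> Arr C" using K by (simp add: poset_cocone_def)
  have F: "F a \<in> Arr C" "e a a = Idt (arrow_cat C) (F a)" and s: "s a \<in> homset (arrow_cat C) (F a) f" if "a \<in> Field r" for a
    using D K that unfolding poset_diagram_def poset_cocone_def arrow_cat_simps(1) by blast+
  have e: "e a b \<in> homset (arrow_cat C) (F a) (F b)" "Comp (arrow_cat C) (s b) (e a b) = s a" if "(a, b) \<in> r" for a b
    using D K that unfolding poset_diagram_def poset_cocone_def by blast+
  have ee: "Comp (arrow_cat C) (e b c) (e a b) = e a c" if "(a, b) \<in> r" "(b, c) \<in> r" for a b c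
    using D that unfolding poset_diagram_def by blast
  have ii: "Comp (arrow_cat C) ?i ?i = ?i" using A.idt_comp[OF i] .
  have DD: "poset_diagram ?AQ r (\<lambda>a. comparison C u (F a)) (\<lambda>a b. comparison_sq C ?i (e a b))"
    unfolding poset_diagram_def
  proof (intro conjI ballI)
    fix a assume a: "a \<in> Field r"
    show "comparison C u (F a) \<in> Obj ?AQ" using comparison_arr(1)[OF u F(1)[OF a]] by simp
    show "comparison_sq C ?i (e a a) = Idt ?AQ (comparison C u (F a))"
      unfolding F(2)[OF a] by (rule comparison_sq_idt[OF u F(1)[OF a]])
  next
    fix ab assume ab: "ab \<in> r"
    show "case ab of (a, b) \<Rightarrow> comparison_sq C ?i (e a b) \<in> homset ?AQ (comparison C u (F a)) (comparison C u (F b))"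
      using comparison_sq_hom[OF i e(1)] ab by (cases ab) blast
    have "Comp ?AQ (comparison_sq C ?i (e b c)) (comparison_sq C ?i (e a b)) = comparison_sq C ?i (e a c)"
      if "(a, b) \<in> r" "(b, c) \<in> r" for a b c
      using comparison_sq_comp[OF i i e(1)[OF that(1)] e(1)[OF that(2)]] ii ee[OF that] by metis
    then show "case ab of (a, b) \<Rightarrow> \<forall>c. (b, c) \<in> r \<longrightarrow>
        Comp ?AQ (comparison_sq C ?i (e b c)) (comparison_sq C ?i (e a b)) = comparison_sq C ?i (e a c)"
      using ab by (cases ab) blast
  qed
  have KK: "poset_cocone ?AQ r (\<lambda>a. comparison C u (F a)) (\<lambda>a b. comparison_sq C ?i (e a b))
    (comparison C u f) (\<lambda>a. comparison_sq C ?i (s a))"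
    unfolding poset_cocone_def
  proof (intro conjI ballI)
    show "comparison C u f \<in> Obj ?AQ" using comparison_arr(1)[OF u f] by simp
    show "comparison_sq C ?i (s a) \<in> homset ?AQ (comparison C u (F a)) (comparison C u f)" if "a \<in> Field r" for a
      using comparison_sq_hom[OF i s[OF that]] .
    fix ab assume "ab \<in> r"
    then obtain a b where ab: "ab = (a, b)" "(a, b) \<in> r" by (cases ab) auto
    then have "b \<in> Field r" by (auto simp: Field_def)
    then have "Comp ?AQ (comparison_sq C ?i (s b)) (comparison_sq C ?i (e a b)) = comparison_sq C ?i (s a)"
      using comparison_sq_comp[OF i i e(1)[OF ab(2)] s] ii e(2)[OF ab(2)] by metis
    then show "case ab of (a, b) \<Rightarrow> Comp ?AQ (comparison_sq C ?i (s b)) (comparison_sq C ?i (e a b)) = comparison_sq C ?i (s a)"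
      unfolding ab(1) prod.case .
  qed
  have dom: "Dom Q (comparison C u g) = hom_poset C (Cod C u) (Dom C g)" "Cod Q (comparison C u g) = sq_poset C u g"
    if "g \<in> Arr C" for g using comparison_arr(2,3)[OF u that] by simp_all
  have cut: "poset_diagram Q r G t \<and> poset_cocone Q r G t c k"
    if g: "\<And>a. a \<in> Field r \<Longrightarrow> G a \<in> Obj Q \<and> t a a = Idt Q (G a)" "\<And>a b. (a, b) \<in> r \<Longrightarrow> t a b \<in> homset Q (G a) (G b)"
      "\<And>a b c. (a, b) \<in> r \<Longrightarrow> (b, c) \<in> r \<Longrightarrow> Comp Q (t b c) (t a b) = t a c"
      "c \<in> Obj Q" "\<And>a. a \<in> Field r \<Longrightarrow> k a \<in> homset Q (G a) c" "\<And>a b. (a, b) \<in> r \<Longrightarrow> Comp Q (k b) (t a b) = k a"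
    for G t c k
    unfolding poset_diagram_def poset_cocone_def using g by (auto simp del: Ord_cat_simps)
  have eqs: "Comp ?AQ (comparison_sq C ?i (e b c)) (comparison_sq C ?i (e a b)) = comparison_sq C ?i (e a c)"
    if "(a, b) \<in> r" "(b, c) \<in> r" for a b c
    using comparison_sq_comp[OF i i e(1)[OF that(1)] e(1)[OF that(2)]] ii ee[OF that] by metis
  have eqk: "Comp ?AQ (comparison_sq C ?i (s b)) (comparison_sq C ?i (e a b)) = comparison_sq C ?i (s a)" if "(a, b) \<in> r" for a b
    using KK that unfolding poset_cocone_def by blast
  have eid: "comparison_sq C ?i (e a a) = Idt ?AQ (comparison C u (F a))" if "a \<in> Field r" for a
    using DD that unfolding poset_diagram_def by blast
  show ?thesis
  proof (rule Q.arrow_colimitI[OF DD KK])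
    let ?G = "\<lambda>a. hom_poset C (Cod C u) (Dom C (F a))"
    let ?t = "\<lambda>a b. stop (comparison_sq C ?i (e a b))" and ?k = "\<lambda>a. stop (comparison_sq C ?i (s a))"
    have fe: "a \<in> Field r \<and> b \<in> Field r" if "(a, b) \<in> r" for a b using that by (auto simp: Field_def)
    have "poset_diagram Q r ?G ?t \<and> poset_cocone Q r ?G ?t (hom_poset C (Cod C u) (Dom C f)) ?k"
    proof (rule cut)
      show "?G a \<in> Obj Q \<and> ?t a a = Idt Q (?G a)" if a: "a \<in> Field r" for a
        using arg_cong[OF eid[OF a], of stop] hom_poset_obj comparison_arr(2)[OF u F(1)[OF a]] by simp
      show "?t a b \<in> homset Q (?G a) (?G b)" if "(a, b) \<in> r" for a b
        using comparison_sq_stop_hom[OF u e(1)[OF that]] .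
      show "Comp Q (?t b c) (?t a b) = ?t a c" if "(a, b) \<in> r" "(b, c) \<in> r" for a b c
        using arg_cong[OF eqs[OF that], of stop] unfolding arrow_cat_simps(5) square.sel .
      show "hom_poset C (Cod C u) (Dom C f) \<in> Obj Q" by (rule hom_poset_obj)
      show "?k a \<in> homset Q (?G a) (hom_poset C (Cod C u) (Dom C f))" if "a \<in> Field r" for a
        using comparison_sq_stop_hom[OF u s[OF that]] .
      show "Comp Q (?k b) (?t a b) = ?k a" if "(a, b) \<in> r" for a b
        using arg_cong[OF eqk[OF that], of stop] unfolding arrow_cat_simps(5) square.sel .
    qed
    then have "poset_colimit Q r ?G ?t (hom_poset C (Cod C u) (Dom C f)) ?k"
    proof (elim conjE, intro directed_union_colimit r)
      fix x assume "x \<in> Field (hom_poset C (Cod C u) (Dom C f))"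
      then obtain d where d: "x = HArr d" "d \<in> homset C (Cod C u) (Dom C f)" by (auto simp: Field_hom_poset)
      then obtain a d' where a: "a \<in> Field r" "d' \<in> homset C (Cod C u) (Dom C (F a))" "stop (s a) \<cdot> d' = d" using top by blast
      then show "\<exists>a\<in>Field r. \<exists>y\<in>Field (?G a). fn (?k a) y = x"
        using idsq_stop_action[OF u s[OF a(1)] a(2)] d(1) by (intro bexI[of _ a] bexI[of _ "HArr d'"]) (auto simp: Field_hom_poset)
    next
      fix a y y' assume a: "a \<in> Field r" and y: "y \<in> Field (?G a)" "y' \<in> Field (?G a)"
        and le: "(fn (?k a) y, fn (?k a) y') \<in> hom_poset C (Cod C u) (Dom C f)"
      obtain d d' where d: "y = HArr d" "y' = HArr d'" "d \<in> homset C (Cod C u) (Dom C (F a))" "d' \<in> homset C (Cod C u) (Dom C (F a))"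
        using y by (auto simp: Field_hom_poset)
      have "Le C (stop (s a) \<cdot> d) (stop (s a) \<cdot> d')"
        using le unfolding d(1,2) idsq_stop_action[OF u s[OF a] d(3)] idsq_stop_action[OF u s[OF a] d(4)]
        by (auto simp: hom_poset_def)
      then show "(y, y') \<in> ?G a" using emb[OF a d(3,4)] d by (auto simp: hom_poset_def)
    qed
    then have "poset_colimit Q r ?G ?t (Dom Q (comparison C u f)) ?k" unfolding dom(1)[OF f] .
    moreover have "Dom Q (comparison C u (F a)) = ?G a" if "a \<in> Field r" for a using dom(1)[OF F(1)[OF that]] .
    ultimately show "poset_colimit Q r (\<lambda>a. Dom Q (comparison C u (F a))) ?t (Dom Q (comparison C u f)) ?k"
      by (subst poset_colimit_cong[of r "\<lambda>a. Dom Q (comparison C u (F a))" ?G]) auto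
  next
    let ?G = "\<lambda>a. sq_poset C u (F a)"
    let ?t = "\<lambda>a b. sbot (comparison_sq C ?i (e a b))" and ?k = "\<lambda>a. sbot (comparison_sq C ?i (s a))"
    have "poset_diagram Q r ?G ?t \<and> poset_cocone Q r ?G ?t (sq_poset C u f) ?k"
    proof (rule cut)
      show "?G a \<in> Obj Q \<and> ?t a a = Idt Q (?G a)" if a: "a \<in> Field r" for a
        using arg_cong[OF eid[OF a], of sbot] sq_poset_obj comparison_arr(3)[OF u F(1)[OF a]] by simp
      show "?t a b \<in> homset Q (?G a) (?G b)" if "(a, b) \<in> r" for a b
        using comparison_sq_sbot_hom[OF u e(1)[OF that]] .
      show "Comp Q (?t b c) (?t a b) = ?t a c" if "(a, b) \<in> r" "(b, c) \<in> r" for a b c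
        using arg_cong[OF eqs[OF that], of sbot] unfolding arrow_cat_simps(5) square.sel .
      show "sq_poset C u f \<in> Obj Q" by (rule sq_poset_obj)
      show "?k a \<in> homset Q (?G a) (sq_poset C u f)" if "a \<in> Field r" for a
        using comparison_sq_sbot_hom[OF u s[OF that]] .
      show "Comp Q (?k b) (?t a b) = ?k a" if "(a, b) \<in> r" for a b
        using arg_cong[OF eqk[OF that], of sbot] unfolding arrow_cat_simps(5) square.sel .
    qed
    then have "poset_colimit Q r ?G ?t (sq_poset C u f) ?k"
    proof (elim conjE, intro directed_union_colimit r)
      fix x assume "x \<in> Field (sq_poset C u f)"
      then obtain h k where h: "x = HSqr h k" "Square u f h k \<in> Arr (arrow_cat C)" by (auto simp: Field_sq_poset)
      then obtain a h' k' where a: "a \<in> Field r" "Square u (F a) h' k' \<in> Arr (arrow_cat C)" "stop (s a) \<cdot> h' = h" "sbot (s a) \<cdot> k' = k"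
        using bot by blast
      then show "\<exists>a\<in>Field r. \<exists>y\<in>Field (?G a). fn (?k a) y = x"
        using idsq_action(1)[OF s[OF a(1)] a(2)] h(1) by (intro bexI[of _ a] bexI[of _ "HSqr h' k'"]) (auto simp: Field_sq_poset)
    next
      fix a y y' assume a: "a \<in> Field r" and y: "y \<in> Field (?G a)" "y' \<in> Field (?G a)"
        and le: "(fn (?k a) y, fn (?k a) y') \<in> sq_poset C u f"
      obtain h k h' k' where h: "y = HSqr h k" "y' = HSqr h' k'" "Square u (F a) h k \<in> Arr (arrow_cat C)" "Square u (F a) h' k' \<in> Arr (arrow_cat C)"
        using y by (auto simp: Field_sq_poset)
      have "Le C (stop (s a) \<cdot> h) (stop (s a) \<cdot> h')" "Le C (sbot (s a) \<cdot> k) (sbot (s a) \<cdot> k')"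
        using le unfolding h(1,2) idsq_action(1)[OF s[OF a] h(3)] idsq_action(1)[OF s[OF a] h(4)]
        by (auto simp: sq_poset_def)
      then have "Le C h h'" "Le C k k'" using emb[OF a] emb'[OF a] h(3,4) by (auto simp: Square_arr_iff)
      then show "(y, y') \<in> ?G a" using h by (auto simp: sq_poset_def)
    qed
    then have "poset_colimit Q r ?G ?t (Cod Q (comparison C u f)) ?k" unfolding dom(2)[OF f] .
    moreover have "Cod Q (comparison C u (F a)) = ?G a" if "a \<in> Field r" for a using dom(2)[OF F(1)[OF that]] .
    ultimately show "poset_colimit Q r (\<lambda>a. Cod Q (comparison C u (F a))) ?t (Cod Q (comparison C u f)) ?k"
      by (subst poset_colimit_cong[of r "\<lambda>a. Cod Q (comparison C u (F a))" ?G]) auto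
  qed
qed

lemma iso_over_structD:
  assumes "iso_over (struct_intcat C A) forget (struct_intcat C B) forget"
  obtains \<tau> where "\<And>f p. \<lbrakk>f \<in> Arr C; carries A f p\<rbrakk> \<Longrightarrow> carries B f (\<tau> f p)"
    "\<And>f p g q s. \<lbrakk>f \<in> Arr C; carries A f p; g \<in> Arr C; carries A g q; s \<in> homset (arrow_cat C) f g;
       preserves A (f, p) (g, q) s\<rbrakk> \<Longrightarrow> preserves B (f, \<tau> f p) (g, \<tau> g q) s"
    "\<And>f \<phi>. \<lbrakk>f \<in> Arr C; carries B f \<phi>\<rbrakk> \<Longrightarrow> \<exists>p. carries A f p"
proof -
  obtain T T' where T: "internal_functor (struct_intcat C A) (struct_intcat C B) T"
    and T': "internal_functor (struct_intcat C B) (struct_intcat C A) T'"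
    and TT: "ifeq (struct_intcat C B) (ifcomp T T') ifid"
    and FT: "ifeq (struct_intcat C A) (ifcomp forget T) forget"
    using assms unfolding iso_over_def by blast
  have T1: "ord_functor (struct_cat C A) (struct_cat C B) (onVer T)"
    and T1': "ord_functor (struct_cat C B) (struct_cat C A) (onVer T')"
    using internal_functor.functor_onVer[OF T] internal_functor.functor_onVer[OF T'] by (simp_all add: struct_intcat_def)
  let ?t = "\<lambda>f p. snd (onObj (onVer T) (f, p))"
  have obj: "onObj (onVer T) (f, p) = (f, ?t f p)" "carries B f (?t f p)" if "f \<in> Arr C" "carries A f p" for f p
  proof -
    have "(f, p) \<in> Obj (struct_cat C A)" using that by (simp add: struct_cat_def)
    then have 1: "onObj (onVer T) (f, p) \<in> Obj (struct_cat C B)" "fst (onObj (onVer T) (f, p)) = f"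
      using ord_functor.obj_map[OF T1] FT by (auto simp: ifeq_def feq_def ifcomp_def fcomp_def forget_def struct_intcat_def)
    then show "onObj (onVer T) (f, p) = (f, ?t f p)" by (metis prod.collapse)
    then show "carries B f (?t f p)" using 1(1) unfolding struct_cat_def
      by (metis (no_types, lifting) ordcat.select_convs(1) mem_Collect_eq case_prodD)
  qed
  show ?thesis
  proof (rule that)
    show "carries B f (?t f p)" if "f \<in> Arr C" "carries A f p" for f p using obj(2)[OF that] .
    show "preserves B (f, ?t f p) (g, ?t g q) s"
      if m: "f \<in> Arr C" "carries A f p" "g \<in> Arr C" "carries A g q" "s \<in> homset (arrow_cat C) f g" "preserves A (f, p) (g, q) s"
      for f p g q s
    proof -
      let ?m = "((f, p), (g, q), s)"
      have mA: "?m \<in> Arr (struct_cat C A)" using m by (simp add: struct_cat_def)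
      then have "?m \<in> homset (struct_cat C A) (f, p) (g, q)" by (simp add: homset_def struct_cat_def)
      from ord_functor.hom_map[OF T1 this]
      have "onArr (onVer T) ?m \<in> homset (struct_cat C B) (f, ?t f p) (g, ?t g q)"
        using obj(1) m by metis
      moreover have "snd (snd (onArr (onVer T) ?m)) = s"
        using FT mA by (auto simp: ifeq_def feq_def ifcomp_def fcomp_def forget_def struct_intcat_def split_beta)
      ultimately show ?thesis by (auto simp: homset_def struct_cat_def)
    qed
    show "\<exists>p. carries A f p" if "f \<in> Arr C" "carries B f \<phi>" for f \<phi>
    proof -
      have B: "(f, \<phi>) \<in> Obj (struct_cat C B)" using that by (simp add: struct_cat_def)
      obtain f' p where fp: "onObj (onVer T') (f, \<phi>) = (f', p)" by fastforce
      then have "f' \<in> Arr C" "carries A f' p"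
        using ord_functor.obj_map[OF T1' B] by (auto simp: struct_cat_def)
      moreover have "onObj (onVer T) (f', p) = (f, \<phi>)"
        using TT B fp by (auto simp: ifeq_def feq_def ifcomp_def fcomp_def ifid_def fid_def struct_intcat_def)
      ultimately show ?thesis using obj(1) by (metis fst_conv)
    qed
  qed
qed

section \<open>The category of T0 spaces\<close>

lemma Top0_simps [simp]:
  "Dom (Top0 U) = src" "Cod (Top0 U) = tgt"
  "Idt (Top0 U) X = SMap X X (\<lambda>x\<in>topspace X. x)"
  "Comp (Top0 U) g f = SMap (src f) (tgt g) (compose (topspace (src f)) (fn g) (fn f))"
  "Le (Top0 U) f g \<longleftrightarrow> (\<forall>x\<in>topspace (src f). specialises (tgt f) (fn g x) (fn f x))"
  by (simp_all add: Top0_def)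

lemma Top0_obj_iff: "X \<in> Obj (Top0 U) \<longleftrightarrow> t0_space X \<and> small U (topspace X)"
  by (simp add: Top0_def)

lemma Top0_hom_iff:
  "f \<in> homset (Top0 U) X Y \<longleftrightarrow> src f = X \<and> tgt f = Y \<and> X \<in> Obj (Top0 U) \<and> Y \<in> Obj (Top0 U) \<and>
     fn f \<in> extensional (topspace X) \<and> continuous_map X Y (fn f)"
  by (cases f) (auto simp: homset_def Top0_def)

lemma Top0_fn: "\<lbrakk>f \<in> homset (Top0 U) X Y; x \<in> topspace X\<rbrakk> \<Longrightarrow> fn f x \<in> topspace Y"
  unfolding Top0_hom_iff by (meson continuous_map_image_subset_topspace image_subset_iff)

lemma Top0_hom_eqI:
  assumes "f \<in> homset (Top0 U) X Y" "g \<in> homset (Top0 U) X Y" "\<And>x. x \<in> topspace X \<Longrightarrow> fn f x = fn g x"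
  shows "f = g"
proof -
  have "fn f = fn g" using assms by (intro extensionalityI[of _ "topspace X"]) (simp_all add: Top0_hom_iff)
  then show ?thesis using assms by (simp add: Top0_hom_iff smap.expand)
qed

lemma specialises_trans: "\<lbrakk>specialises X x y; specialises X y z\<rbrakk> \<Longrightarrow> specialises X x z"
  unfolding specialises_def by blast

lemma specialises_map:
  assumes "specialises X x y" "continuous_map X Y h" "x \<in> topspace X" "y \<in> topspace X"
  shows "specialises Y (h x) (h y)"
  unfolding specialises_def
proof (intro allI impI, elim conjE)
  fix V assume V: "openin Y V" "h x \<in> V"
  then have "openin X {x \<in> topspace X. h x \<in> V}" using assms(2) by (simp add: openin_continuous_map_preimage)
  then show "h y \<in> V" using assms V unfolding specialises_def by blast
qed

lemma Top0_comp_hom: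
  assumes "f \<in> homset (Top0 U) X Y" "g \<in> homset (Top0 U) Y Z"
  shows "Comp (Top0 U) g f \<in> homset (Top0 U) X Z"
proof -
  have "continuous_map X Z (fn g \<circ> fn f)" using assms continuous_map_compose unfolding Top0_hom_iff by blast
  then have "continuous_map X Z (compose (topspace X) (fn g) (fn f))"
    by (rule continuous_map_eq) (simp add: compose_def)
  then show ?thesis using assms by (simp add: Top0_hom_iff compose_def)
qed

lemma Top0_idt_hom: "X \<in> Obj (Top0 U) \<Longrightarrow> Idt (Top0 U) X \<in> homset (Top0 U) X X"
  using continuous_map_eq[OF continuous_map_id[of X]] by (simp add: Top0_hom_iff)

lemma Top0_category: "ord_category (Top0 U)"
proof
  let ?C = "Top0 U"
  fix f :: "('a topology, 'a) smap" assume "f \<in> Arr ?C"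
  then have f: "f \<in> homset ?C (src f) (tgt f)" by (simp add: homset_def)
  then show "Dom ?C f \<in> Obj ?C" "Cod ?C f \<in> Obj ?C" by (auto simp: Top0_hom_iff)
  show "Le ?C f f" by (simp add: specialises_def)
next
  show "X \<in> Obj (Top0 U) \<Longrightarrow> Idt (Top0 U) X \<in> homset (Top0 U) X X" for X :: "'a topology" by (rule Top0_idt_hom)
  show "\<lbrakk>f \<in> homset (Top0 U) X Y; g \<in> homset (Top0 U) Y Z\<rbrakk> \<Longrightarrow> Comp (Top0 U) g f \<in> homset (Top0 U) X Z"
    for f X Y Z and g :: "('a topology, 'a) smap" by (rule Top0_comp_hom)
next
  fix f :: "('a topology, 'a) smap" and X Y assume f: "f \<in> homset (Top0 U) X Y"
  have X: "X \<in> Obj (Top0 U)" "Y \<in> Obj (Top0 U)" "src f = X" "tgt f = Y" using f by (simp_all add: Top0_hom_iff)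
  show "Comp (Top0 U) f (Idt (Top0 U) X) = f"
    using Top0_comp_hom[OF Top0_idt_hom[OF X(1)] f] by (rule Top0_hom_eqI[OF _ f]) (simp add: compose_def)
  show "Comp (Top0 U) (Idt (Top0 U) Y) f = f"
    using Top0_comp_hom[OF f Top0_idt_hom[OF X(2)]]
    by (rule Top0_hom_eqI[OF _ f]) (use Top0_fn[OF f] X in \<open>simp add: compose_def\<close>)
next
  fix f W X g Y and h :: "('a topology, 'a) smap" and Z
  assume "f \<in> homset (Top0 U) W X" "g \<in> homset (Top0 U) X Y" "h \<in> homset (Top0 U) Y Z"
  then show "Comp (Top0 U) h (Comp (Top0 U) g f) = Comp (Top0 U) (Comp (Top0 U) h g) f"
    using Top0_fn[of f U W X] by (auto simp: Top0_hom_iff compose_def)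
next
  fix f X Y g and h :: "('a topology, 'a) smap"
  assume fg: "f \<in> homset (Top0 U) X Y" "g \<in> homset (Top0 U) X Y" and le: "Le (Top0 U) f g" "Le (Top0 U) g h"
  have "src f = X" "src g = X" "tgt f = Y" "tgt g = Y" using fg unfolding Top0_hom_iff by blast+
  then show "Le (Top0 U) f h" using le specialises_trans[of Y "fn h x" "fn g x" "fn f x" for x] by simp
next
  fix f X Y and g :: "('a topology, 'a) smap"
  assume fg: "f \<in> homset (Top0 U) X Y" "g \<in> homset (Top0 U) X Y" and le: "Le (Top0 U) f g" "Le (Top0 U) g f"
  have e: "src f = X" "src g = X" "tgt f = Y" "tgt g = Y" "t0_space Y"
    using fg unfolding Top0_hom_iff Top0_obj_iff by blast+
  show "f = g"
  proof (rule Top0_hom_eqI[OF fg], rule ccontr)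
    fix x assume x: "x \<in> topspace X" "fn f x \<noteq> fn g x"
    then obtain V where V: "openin Y V" "fn f x \<notin> V \<longleftrightarrow> fn g x \<in> V"
      using e(5)[unfolded t0_space_def, rule_format, OF Top0_fn[OF fg(1) x(1)] Top0_fn[OF fg(2) x(1)]] by blast
    have "specialises Y (fn g x) (fn f x)" "specialises Y (fn f x) (fn g x)" using le x(1) e by simp_all
    then show False using V unfolding specialises_def by blast
  qed
next
  fix f X Y f' g Z and g' :: "('a topology, 'a) smap"
  assume 1: "f \<in> homset (Top0 U) X Y" "f' \<in> homset (Top0 U) X Y"
    "g \<in> homset (Top0 U) Y Z" "g' \<in> homset (Top0 U) Y Z" and 2: "Le (Top0 U) f f'" "Le (Top0 U) g g'"
  have e: "src f = X" "src f' = X" "tgt f = Y" "src g = Y" "tgt g = Z" "continuous_map Y Z (fn g)"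
    using 1 unfolding Top0_hom_iff by blast+
  have "specialises Z (fn g' (fn f' x)) (fn g (fn f x))" if x: "x \<in> topspace X" for x
  proof (rule specialises_trans)
    show "specialises Z (fn g' (fn f' x)) (fn g (fn f' x))" using 2(2) e Top0_fn[OF 1(2) x] by simp
    show "specialises Z (fn g (fn f' x)) (fn g (fn f x))"
      using specialises_map[OF _ e(6) Top0_fn[OF 1(2) x] Top0_fn[OF 1(1) x]] 2(1) e x by simp
  qed
  then show "Le (Top0 U) (Comp (Top0 U) g f) (Comp (Top0 U) g' f')"
    using e by (simp add: compose_def)
qed

lemma Top0_small_hom:
  assumes U: "universe U"
  shows "small_hom_category (Top0 U :: ('u topology, ('u topology, 'u) smap) ordcat) (U :: 'u itself)"
proof (intro small_hom_category.intro Top0_category small_hom_category_axioms.intro U)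
  fix X Y :: "'u topology"
  show "small U (homset (Top0 U) X Y)"
  proof (cases "X \<in> Obj (Top0 U) \<and> Y \<in> Obj (Top0 U)")
    case True
    have "homset (Top0 U) X Y \<subseteq> SMap X Y ` (topspace X \<rightarrow>\<^sub>E topspace Y)"
    proof
      fix f assume f: "f \<in> homset (Top0 U) X Y"
      then have "fn f \<in> topspace X \<rightarrow>\<^sub>E topspace Y" using Top0_fn[OF f] by (auto simp: Top0_hom_iff PiE_iff)
      moreover have "f = SMap X Y (fn f)" using f by (auto simp: Top0_hom_iff smap.expand)
      ultimately show "f \<in> SMap X Y ` (topspace X \<rightarrow>\<^sub>E topspace Y)" by blast
    qed
    then show ?thesis
      using small_subset[OF _ small_image[OF small_extensional_funcset[OF U]]] True unfolding Top0_obj_iff by blast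
  next
    case False
    then have "homset (Top0 U) X Y = {}" by (auto simp: Top0_hom_iff)
    then show ?thesis using finite_small[OF U, of "homset (Top0 U) X Y"] by simp
  qed
qed

section \<open>Filter spaces and the chain space\<close>

lemma topspace_filter_space [simp]: "topspace (filter_space X) = open_filters X"
proof -
  have "\<Union>{sharp X V |V. openin X V} = open_filters X"
  proof
    have "open_filters X \<subseteq> sharp X (topspace X)" by (auto simp: sharp_def open_filters_def)
    then show "open_filters X \<subseteq> \<Union>{sharp X V |V. openin X V}" using openin_topspace[of X] by blast
  qed (auto simp: sharp_def)
  then show ?thesis by (simp add: filter_space_def topology_generated_by_topspace)
qed

lemma openin_sharp: "openin X V \<Longrightarrow> openin (filter_space X) (sharp X V)"
  unfolding filter_space_def by (rule topology_generated_by_Basis) blast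

lemma openin_filter_space_sharp:
  assumes "openin (filter_space X) P" "\<phi> \<in> P"
  shows "\<exists>V\<in>\<phi>. openin X V \<and> sharp X V \<subseteq> P"
proof -
  have "generate_topology_on {sharp X V |V. openin X V} P"
    using assms(1) by (simp add: filter_space_def openin_topology_generated_by_iff)
  then show ?thesis using assms(2)
  proof (induction)
    case (Int a b)
    then obtain V W where VW: "V \<in> \<phi>" "openin X V" "sharp X V \<subseteq> a" "W \<in> \<phi>" "openin X W" "sharp X W \<subseteq> b" by blast
    have "\<phi> \<in> open_filters X"
    proof -
      have "a \<subseteq> topspace (filter_space X)"
        using Int.hyps(1) unfolding filter_space_def
        by (intro openin_subset) (simp only: openin_topology_generated_by_iff)
      then show ?thesis using Int.prems by auto
    qed
    then have "V \<inter> W \<in> \<phi>" using VW by (auto simp: open_filters_def)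
    moreover have "sharp X (V \<inter> W) \<subseteq> a \<inter> b"
      using VW(2,3,5,6) by (auto simp: sharp_def open_filters_def)
    ultimately show ?case using VW by blast
  next
    case (UN K)
    then obtain k where k: "k \<in> K" "\<phi> \<in> k" by blast
    then obtain V where "V \<in> \<phi>" "openin X V" "sharp X V \<subseteq> k" using UN.IH by blast
    then show ?case using k(1) by blast
  next
    case (Basis s)
    then show ?case by (auto simp: sharp_def)
  qed simp
qed

lemma filter_unit_filters: "x \<in> topspace X \<Longrightarrow> filter_unit X x \<in> open_filters X"
  by (auto simp: filter_unit_def open_filters_def)

lemma filter_map_filters:
  assumes h: "continuous_map X Y h" and \<phi>: "\<phi> \<in> open_filters X"
  shows "filter_map X Y h \<phi> \<in> open_filters Y"
proof -
  have op: "openin X {x \<in> topspace X. h x \<in> V}" if "openin Y V" for V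
    using h that by (simp add: openin_continuous_map_preimage)
  have "{x \<in> topspace X. h x \<in> topspace Y} = topspace X"
    using continuous_map_image_subset_topspace[OF h] by auto
  moreover have "{x \<in> topspace X. h x \<in> V \<inter> W} = {x \<in> topspace X. h x \<in> V} \<inter> {x \<in> topspace X. h x \<in> W}" for V W by auto
  moreover have "{x \<in> topspace X. h x \<in> W} \<in> \<phi>" if "{x \<in> topspace X. h x \<in> V} \<in> \<phi>" "openin Y W" "V \<subseteq> W" for V W
  proof -
    have "{x \<in> topspace X. h x \<in> V} \<subseteq> {x \<in> topspace X. h x \<in> W}" using that by blast
    then show ?thesis using \<phi> that op[OF that(2)] unfolding open_filters_def by blast
  qed
  ultimately show ?thesis using \<phi> unfolding open_filters_def filter_map_def by auto
qed

lemma filter_mult_filters: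
  assumes "\<Psi> \<in> open_filters (filter_space X)"
  shows "filter_mult X \<Psi> \<in> open_filters X"
proof -
  have top: "sharp X (topspace X) = open_filters X" by (auto simp: sharp_def open_filters_def)
  have int: "sharp X (V \<inter> W) = sharp X V \<inter> sharp X W" if "openin X V" "openin X W" for V W
    using that by (auto simp: sharp_def open_filters_def)
  have up: "sharp X W \<in> \<Psi>" if "sharp X V \<in> \<Psi>" "openin X W" "V \<subseteq> W" for V W
  proof -
    have "sharp X V \<subseteq> sharp X W" using that by (auto simp: sharp_def open_filters_def)
    then show ?thesis using assms that openin_sharp[OF that(2)] unfolding open_filters_def by blast
  qed
  have \<Psi>: "open_filters X \<in> \<Psi>" "\<And>P P'. P \<in> \<Psi> \<Longrightarrow> P' \<in> \<Psi> \<Longrightarrow> P \<inter> P' \<in> \<Psi>"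
    using assms by (simp_all add: open_filters_def[of "filter_space X"])
  have "topspace X \<in> filter_mult X \<Psi>" using top \<Psi>(1) by (simp add: filter_mult_def)
  moreover have "V \<inter> W \<in> filter_mult X \<Psi>" if "V \<in> filter_mult X \<Psi>" "W \<in> filter_mult X \<Psi>" for V W
    using that int \<Psi>(2) by (auto simp: filter_mult_def)
  moreover have "W \<in> filter_mult X \<Psi>" if "V \<in> filter_mult X \<Psi>" "openin X W" "V \<subseteq> W" for V W
    using that up by (auto simp: filter_mult_def)
  moreover have "filter_mult X \<Psi> \<subseteq> {V. openin X V}" by (auto simp: filter_mult_def)
  ultimately show ?thesis unfolding open_filters_def by blast
qed

lemma K_space_fst: "continuous_map (K_space A B f) (filter_space A) fst"
  unfolding K_space_def by (intro continuous_map_from_subtopology continuous_map_fst)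

lemma topspace_K_space:
  "z \<in> topspace (K_space A B f) \<longleftrightarrow> fst z \<in> open_filters A \<and> snd z \<in> topspace B \<and>
    filter_unit B (snd z) \<subseteq> filter_map A B f (fst z)"
  by (auto simp: K_space_def topspace_subtopology mem_Times_iff)

definition point_space :: "'a \<Rightarrow> 'a topology" where "point_space c = discrete_topology {c}"

definition to_point :: "'a \<Rightarrow> 'a topology \<Rightarrow> ('a topology, 'a) smap" where
  "to_point c X = SMap X (point_space c) (\<lambda>x\<in>topspace X. c)"

lemma topspace_point_space [simp]: "topspace (point_space c) = {c}"
  by (simp add: point_space_def)

lemma topspace_K_space_point:
  "z \<in> topspace (K_space A (point_space c) (\<lambda>x\<in>topspace A. c)) \<longleftrightarrow> fst z \<in> open_filters A \<and> snd z = c"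
proof -
  have "filter_unit (point_space c) c \<subseteq> filter_map A (point_space c) (\<lambda>x\<in>topspace A. c) \<phi>" if "\<phi> \<in> open_filters A" for \<phi>
  proof
    fix V assume "V \<in> filter_unit (point_space c) c"
    then have "openin (point_space c) V" "c \<in> V" by (auto simp: filter_unit_def)
    moreover from this have "{x \<in> topspace A. (\<lambda>x\<in>topspace A. c) x \<in> V} = topspace A" by auto
    ultimately show "V \<in> filter_map A (point_space c) (\<lambda>x\<in>topspace A. c) \<phi>"
      using that by (simp add: filter_map_def open_filters_def)
  qed
  then show ?thesis unfolding topspace_K_space by auto
qed

text \<open>A chain with top element \<open>w\<close> that is a limit of smaller elements, topologised by the Scott
  topology together with the set \<open>{w}\<close>; because of this set the space is not a retract of its filter
  space. The initial segments with \<open>w\<close> added are continuous lattices.\<close>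

locale chain_space =
  fixes lt :: "'u \<Rightarrow> 'u \<Rightarrow> bool" (infix "\<sqsubset>" 50) and w c :: 'u
  assumes irrefl: "\<not> x \<sqsubset> x" and trans: "\<lbrakk>x \<sqsubset> y; y \<sqsubset> z\<rbrakk> \<Longrightarrow> x \<sqsubset> z"
    and total: "x \<noteq> y \<Longrightarrow> x \<sqsubset> y \<or> y \<sqsubset> x"
    and least: "P x \<Longrightarrow> \<exists>y. P y \<and> (\<forall>z. P z \<longrightarrow> \<not> z \<sqsubset> y)"
    and limit: "a \<sqsubset> w \<Longrightarrow> \<exists>b. a \<sqsubset> b \<and> b \<sqsubset> w"
    and nonempty: "\<exists>a. a \<sqsubset> w"
begin

definition pts :: "'u set" where "pts = insert w {x. x \<sqsubset> w}"

definition up :: "'u \<Rightarrow> 'u set" where "up b = {x \<in> pts. b \<sqsubset> x}"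

definition basic :: "'u set \<Rightarrow> bool" where
  "basic B \<longleftrightarrow> B = {w} \<or> B = pts \<or> (\<exists>b. b \<sqsubset> w \<and> B = up b)"

definition space :: "'u topology" where
  "space = topology (\<lambda>V. V \<subseteq> pts \<and> (\<forall>x\<in>V. \<exists>B. basic B \<and> x \<in> B \<and> B \<subseteq> V))"

lemma w_pts: "w \<in> pts" by (simp add: pts_def)

lemma not_w_less: "x \<in> pts \<Longrightarrow> \<not> w \<sqsubset> x"
  using trans[of w x w] irrefl[of w] by (auto simp: pts_def)

lemma w_up: "b \<sqsubset> w \<Longrightarrow> w \<in> up b" by (simp add: up_def w_pts)

lemma basic_sub: "basic B \<Longrightarrow> B \<subseteq> pts" by (auto simp: basic_def up_def w_pts)

lemma basic_chain:
  assumes "basic B" "basic B'" shows "B \<subseteq> B' \<or> B' \<subseteq> B"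
proof -
  have "up b \<subseteq> up b' \<or> up b' \<subseteq> up b" for b b'
    using total[of b b'] trans by (auto simp: up_def)
  moreover have "w \<in> B" if "basic B" for B using that w_pts w_up by (auto simp: basic_def)
  ultimately show ?thesis using assms basic_sub unfolding basic_def by (metis empty_subsetI insert_subset)
qed

lemma openin_space: "openin space V \<longleftrightarrow> V \<subseteq> pts \<and> (\<forall>x\<in>V. \<exists>B. basic B \<and> x \<in> B \<and> B \<subseteq> V)"
proof -
  have "istopology (\<lambda>V. V \<subseteq> pts \<and> (\<forall>x\<in>V. \<exists>B. basic B \<and> x \<in> B \<and> B \<subseteq> V))"
    unfolding istopology_def
  proof (intro conjI allI impI ballI)
    fix S T x
    assume S: "S \<subseteq> pts \<and> (\<forall>x\<in>S. \<exists>B. basic B \<and> x \<in> B \<and> B \<subseteq> S)"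
      and T: "T \<subseteq> pts \<and> (\<forall>x\<in>T. \<exists>B. basic B \<and> x \<in> B \<and> B \<subseteq> T)"
    show "S \<inter> T \<subseteq> pts" using S by blast
    assume x: "x \<in> S \<inter> T"
    obtain B B' where B: "basic B" "x \<in> B" "B \<subseteq> S" "basic B'" "x \<in> B'" "B' \<subseteq> T" using S T x by blast
    show "\<exists>B. basic B \<and> x \<in> B \<and> B \<subseteq> S \<inter> T"
    proof (cases "B \<subseteq> B'")
      case True then show ?thesis using B by blast
    next
      case False
      then have "B' \<subseteq> B" using basic_chain[OF B(1,4)] by blast
      then show ?thesis using B by blast
    qed
  next
    fix K x assume K: "\<forall>V\<in>K. V \<subseteq> pts \<and> (\<forall>x\<in>V. \<exists>B. basic B \<and> x \<in> B \<and> B \<subseteq> V)"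
    then show "\<Union> K \<subseteq> pts" by blast
    assume "x \<in> \<Union> K"
    then obtain V where V: "V \<in> K" "x \<in> V" by blast
    then obtain B where "basic B" "x \<in> B" "B \<subseteq> V" using K by blast
    then show "\<exists>B. basic B \<and> x \<in> B \<and> B \<subseteq> \<Union> K" using V(1) by blast
  qed
  then show ?thesis by (simp add: space_def topology_inverse')
qed

lemma openin_basic: "basic B \<Longrightarrow> openin space B"
  unfolding openin_space using basic_sub by blast

lemma topspace_space [simp]: "topspace space = pts"
proof -
  have "openin space pts" by (rule openin_basic) (simp add: basic_def)
  then show ?thesis using openin_subset openin_space topspace_def by (metis subset_antisym openin_topspace)
qed

lemma openin_up: "b \<sqsubset> w \<Longrightarrow> openin space (up b)" by (rule openin_basic) (auto simp: basic_def)

lemma openin_upset: "\<lbrakk>openin space V; x \<in> V; x \<sqsubset> y; y \<in> pts\<rbrakk> \<Longrightarrow> y \<in> V"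
proof -
  assume V: "openin space V" "x \<in> V" "x \<sqsubset> y" "y \<in> pts"
  then obtain B where B: "basic B" "x \<in> B" "B \<subseteq> V" unfolding openin_space by blast
  then have "y \<in> B" using V not_w_less trans unfolding basic_def up_def by blast
  then show "y \<in> V" using B by blast
qed

lemma t0_space_space: "t0_space space"
  unfolding t0_space_def topspace_space
proof (intro ballI impI)
  have *: "\<exists>V. openin space V \<and> x \<notin> V \<and> y \<in> V" if "x \<in> pts" "y \<in> pts" "x \<sqsubset> y" for x y
  proof -
    have "x \<sqsubset> w" using that not_w_less by (auto simp: pts_def)
    then show ?thesis using that openin_up irrefl by (intro exI[of _ "up x"]) (auto simp: up_def)
  qed
  fix x y assume "x \<in> pts" "y \<in> pts" "x \<noteq> y"
  then show "\<exists>U. openin space U \<and> (x \<notin> U \<longleftrightarrow> y \<in> U)"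
    using total[of x y] *[of x y] *[of y x] by blast
qed

definition seg :: "'u \<Rightarrow> 'u set" where "seg a = {x \<in> pts. x = w \<or> \<not> a \<sqsubset> x}"

definition seg_space :: "'u \<Rightarrow> 'u topology" where "seg_space a = subtopology space (seg a)"

lemma topspace_seg_space [simp]: "topspace (seg_space a) = seg a"
  by (auto simp: seg_space_def seg_def)

lemma openin_seg_up: "b \<sqsubset> w \<Longrightarrow> openin (seg_space a) (up b \<inter> seg a)"
  unfolding seg_space_def openin_subtopology using openin_up by blast

lemma w_seg: "w \<in> seg a" by (simp add: seg_def w_pts)

definition height :: "'u \<Rightarrow> 'u set set \<Rightarrow> 'u" where
  "height a \<phi> = (THE x. x \<in> seg a \<and> (\<forall>b. b \<sqsubset> w \<longrightarrow> (b \<sqsubset> x \<longleftrightarrow> up b \<inter> seg a \<in> \<phi>)))"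

lemma height_unique:
  assumes "x \<in> pts" "y \<in> pts" "\<And>b. b \<sqsubset> w \<Longrightarrow> b \<sqsubset> x \<longleftrightarrow> b \<sqsubset> y"
  shows "x = y"
proof (rule ccontr)
  have *: False if "x \<in> pts" "y \<in> pts" "x \<sqsubset> y" "\<And>b. b \<sqsubset> w \<Longrightarrow> b \<sqsubset> x \<longleftrightarrow> b \<sqsubset> y" for x y
  proof -
    have "x \<sqsubset> w" using that(1-3) not_w_less by (auto simp: pts_def)
    then show False using that irrefl by blast
  qed
  assume "x \<noteq> y"
  then show False using total[of x y] *[of x y] *[of y x] assms by blast
qed

lemma height:
  assumes a: "a \<sqsubset> w" and \<phi>: "\<phi> \<in> open_filters (seg_space a)"
  shows "height a \<phi> \<in> seg a" "\<And>b. b \<sqsubset> w \<Longrightarrow> b \<sqsubset> height a \<phi> \<longleftrightarrow> up b \<inter> seg a \<in> \<phi>"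
proof -
  have sup: "W \<in> \<phi>" if "V \<in> \<phi>" "openin (seg_space a) W" "V \<subseteq> W" for V W
    using \<phi> that unfolding open_filters_def by blast
  have "\<exists>x. x \<in> seg a \<and> (\<forall>b. b \<sqsubset> w \<longrightarrow> (b \<sqsubset> x \<longleftrightarrow> up b \<inter> seg a \<in> \<phi>))"
  proof (cases "\<forall>b. b \<sqsubset> w \<longrightarrow> up b \<inter> seg a \<in> \<phi>")
    case True
    then show ?thesis using w_seg by (intro exI[of _ w]) auto
  next
    case False
    then obtain x where x: "x \<sqsubset> w" "up x \<inter> seg a \<notin> \<phi>" "\<And>z. z \<sqsubset> w \<Longrightarrow> up z \<inter> seg a \<notin> \<phi> \<Longrightarrow> \<not> z \<sqsubset> x"
      using least[of "\<lambda>b. b \<sqsubset> w \<and> up b \<inter> seg a \<notin> \<phi>"] by blast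
    have "\<not> a \<sqsubset> x"
    proof
      assume ax: "a \<sqsubset> x"
      then have "up a \<inter> seg a \<in> \<phi>" using x(3)[OF a] by blast
      moreover have "up a \<inter> seg a = {w}" "{w} \<subseteq> up x \<inter> seg a" using a x(1) w_seg w_up by (auto simp: up_def seg_def)
      ultimately show False using sup openin_seg_up[OF x(1)] x(2) by metis
    qed
    then have xs: "x \<in> seg a" using x(1) by (simp add: seg_def pts_def)
    have "b \<sqsubset> x \<longleftrightarrow> up b \<inter> seg a \<in> \<phi>" if b: "b \<sqsubset> w" for b
    proof
      show "b \<sqsubset> x \<Longrightarrow> up b \<inter> seg a \<in> \<phi>" using x(3)[OF b] by blast
      assume u: "up b \<inter> seg a \<in> \<phi>"
      show "b \<sqsubset> x"
      proof (rule ccontr)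
        assume "\<not> b \<sqsubset> x"
        then have "up b \<subseteq> up x" using total[of b x] trans by (auto simp: up_def)
        then have "up b \<inter> seg a \<subseteq> up x \<inter> seg a" by blast
        then show False using sup[OF u openin_seg_up[OF x(1)]] x(2) by blast
      qed
    qed
    then show ?thesis using xs by blast
  qed
  then have "\<exists>!x. x \<in> seg a \<and> (\<forall>b. b \<sqsubset> w \<longrightarrow> (b \<sqsubset> x \<longleftrightarrow> up b \<inter> seg a \<in> \<phi>))"
  proof (rule ex_ex1I)
    fix x y
    assume x: "x \<in> seg a \<and> (\<forall>b. b \<sqsubset> w \<longrightarrow> (b \<sqsubset> x \<longleftrightarrow> up b \<inter> seg a \<in> \<phi>))"
      and y: "y \<in> seg a \<and> (\<forall>b. b \<sqsubset> w \<longrightarrow> (b \<sqsubset> y \<longleftrightarrow> up b \<inter> seg a \<in> \<phi>))"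
    then have "x \<in> pts" "y \<in> pts" by (simp_all add: seg_def)
    then show "x = y" using x y by (intro height_unique) blast+
  qed
  from theI'[OF this] show "height a \<phi> \<in> seg a" "\<And>b. b \<sqsubset> w \<Longrightarrow> b \<sqsubset> height a \<phi> \<longleftrightarrow> up b \<inter> seg a \<in> \<phi>"
    unfolding height_def by blast+
qed

lemma height_eqI:
  assumes "a \<sqsubset> w" "\<phi> \<in> open_filters (seg_space a)" "x \<in> pts" "\<And>b. b \<sqsubset> w \<Longrightarrow> b \<sqsubset> x \<longleftrightarrow> up b \<inter> seg a \<in> \<phi>"
  shows "height a \<phi> = x"
proof (rule height_unique)
  show "height a \<phi> \<in> pts" using height(1)[OF assms(1,2)] by (simp add: seg_def)
qed (use assms height(2)[OF assms(1,2)] in blast)+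

abbreviation seg_arr :: "'u \<Rightarrow> ('u topology, 'u) smap" where "seg_arr a \<equiv> to_point c (seg_space a)"

abbreviation KS :: "'u \<Rightarrow> ('u set set \<times> 'u) topology" where
  "KS a \<equiv> K_space (seg_space a) (point_space c) (\<lambda>x\<in>topspace (seg_space a). c)"

definition seg_alg :: "'u \<Rightarrow> 'u set set \<times> 'u \<Rightarrow> 'u" where
  "seg_alg a = restrict (\<lambda>z. height a (fst z)) (topspace (KS a))"

lemma seg_alg_in: "\<lbrakk>a \<sqsubset> w; z \<in> topspace (KS a)\<rbrakk> \<Longrightarrow> seg_alg a z \<in> seg a \<and>
    (\<forall>b. b \<sqsubset> w \<longrightarrow> (b \<sqsubset> seg_alg a z \<longleftrightarrow> up b \<inter> seg a \<in> fst z))"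
proof -
  assume a: "a \<sqsubset> w" and z: "z \<in> topspace (KS a)"
  have "fst z \<in> open_filters (seg_space a)" using z unfolding topspace_K_space_point by (rule conjunct1)
  moreover have "seg_alg a z = height a (fst z)" unfolding seg_alg_def by (rule restrict_apply'[OF z])
  ultimately show ?thesis using height[OF a] by metis
qed

lemma seg_alg_continuous:
  assumes a: "a \<sqsubset> w" shows "continuous_map (KS a) (seg_space a) (seg_alg a)"
proof -
  have im: "seg_alg a \<in> topspace (KS a) \<rightarrow> seg a" using seg_alg_in[OF a] by blast
  have up_pre: "openin (KS a) {z \<in> topspace (KS a). seg_alg a z \<in> up b}" if b: "b \<sqsubset> w" for b
  proof -
    have "openin (KS a) {z \<in> topspace (KS a). fst z \<in> sharp (seg_space a) (up b \<inter> seg a)}"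
      using openin_continuous_map_preimage[OF K_space_fst openin_sharp[OF openin_seg_up[OF b]]] .
    moreover have "seg_alg a z \<in> up b \<longleftrightarrow> fst z \<in> sharp (seg_space a) (up b \<inter> seg a)" if z: "z \<in> topspace (KS a)" for z
      using seg_alg_in[OF a z] z b unfolding topspace_K_space_point by (auto simp: up_def seg_def sharp_def)
    ultimately show ?thesis by (metis (mono_tags, lifting) Collect_cong)
  qed
  have "continuous_map (KS a) space (seg_alg a)"
    unfolding continuous_map_def
  proof (intro conjI allI impI)
    show "seg_alg a \<in> topspace (KS a) \<rightarrow> topspace space" using im by (auto simp: seg_def)
    fix V assume V: "openin space V"
    show "openin (KS a) {z \<in> topspace (KS a). seg_alg a z \<in> V}"
    proof (subst openin_subopen, intro ballI)
      fix z assume z: "z \<in> {z \<in> topspace (KS a). seg_alg a z \<in> V}"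
      then obtain B where B: "basic B" "seg_alg a z \<in> B" "B \<subseteq> V" using V unfolding openin_space by blast
      have "openin (KS a) {z \<in> topspace (KS a). seg_alg a z \<in> B}"
        using B(1) unfolding basic_def
      proof (elim disjE exE conjE)
        assume "B = {w}"
        moreover have "y = w \<longleftrightarrow> y \<in> up a" if "y \<in> seg a" for y
          using that a w_up by (auto simp: seg_def up_def)
        ultimately have "{z \<in> topspace (KS a). seg_alg a z \<in> B} = {z \<in> topspace (KS a). seg_alg a z \<in> up a}" using im by blast
        then show ?thesis using up_pre[OF a] by simp
      next
        assume "B = pts"
        then have "{z \<in> topspace (KS a). seg_alg a z \<in> B} = topspace (KS a)" using im by (auto simp: seg_def)
        then show ?thesis by simp
      next
        fix b assume "b \<sqsubset> w" "B = up b"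
        then show ?thesis using up_pre by simp
      qed
      then show "\<exists>T. openin (KS a) T \<and> z \<in> T \<and> T \<subseteq> {z \<in> topspace (KS a). seg_alg a z \<in> V}"
        using z B by (intro exI[of _ "{z \<in> topspace (KS a). seg_alg a z \<in> B}"]) auto
    qed
  qed
  then have "continuous_map (KS a) (subtopology space (seg a)) (seg_alg a)"
    using im by (rule continuous_map_into_subtopology)
  then show ?thesis unfolding seg_space_def[symmetric] .
qed

lemma seg_alg_monad_algebra:
  assumes a: "a \<sqsubset> w"
  shows "monad_algebra (seg_space a) (point_space c) (\<lambda>x\<in>topspace (seg_space a). c) (seg_alg a)"
  unfolding monad_algebra_def pointed_algebra_def
proof (intro conjI ballI seg_alg_continuous[OF a])
  let ?f = "\<lambda>x\<in>topspace (seg_space a). c"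
  show "?f (seg_alg a z) = snd z" if "z \<in> topspace (KS a)" for z
    using seg_alg_in[OF a that] that[unfolded topspace_K_space_point] by simp
  show "seg_alg a (K_left (seg_space a) (point_space c) ?f x) = x" if x: "x \<in> topspace (seg_space a)" for x
  proof -
    have u: "filter_unit (seg_space a) x \<in> open_filters (seg_space a)" using filter_unit_filters[OF x] .
    have z: "K_left (seg_space a) (point_space c) ?f x \<in> topspace (KS a)"
      unfolding topspace_K_space_point using u x by (simp add: K_left_def)
    have "height a (filter_unit (seg_space a) x) = x"
      using x openin_seg_up by (intro height_eqI[OF a u]) (auto simp: seg_def filter_unit_def up_def)
    then show ?thesis using z by (simp add: seg_alg_def K_left_def)
  qed
  fix z assume z: "z \<in> topspace (K_space (KS a) (point_space c) snd)"
  let ?X = "seg_space a"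
  have \<Psi>: "fst z \<in> open_filters (KS a)" "snd z = c" using z by (auto simp: topspace_K_space)
  let ?m = "filter_mult ?X (filter_map (KS a) (filter_space ?X) fst (fst z))" and ?k = "filter_map (KS a) ?X (seg_alg a) (fst z)"
  have m: "?m \<in> open_filters ?X" using filter_mult_filters[OF filter_map_filters[OF K_space_fst \<Psi>(1)]] .
  have k: "?k \<in> open_filters ?X" using filter_map_filters[OF seg_alg_continuous[OF a] \<Psi>(1)] .
  have "height a ?m = height a ?k"
  proof (rule height_eqI[OF a m])
    show "height a ?k \<in> pts" using height(1)[OF a k] by (simp add: seg_def)
    fix b assume b: "b \<sqsubset> w"
    note ob = openin_seg_up[OF b]
    have "{y \<in> topspace (KS a). seg_alg a y \<in> up b \<inter> seg a} = {y \<in> topspace (KS a). fst y \<in> sharp ?X (up b \<inter> seg a)}"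
      using seg_alg_in[OF a] b by (auto simp: up_def seg_def sharp_def topspace_K_space_point simp del: topspace_seg_space)
    then show "b \<sqsubset> height a ?k \<longleftrightarrow> up b \<inter> seg a \<in> ?m"
      unfolding height(2)[OF a k b] using ob openin_sharp[OF ob] by (simp add: filter_map_def filter_mult_def)
  qed
  moreover have "K_mult ?X (point_space c) ?f z = (?m, c)" "K_map (KS a) ?X (seg_alg a) (\<lambda>b. b) z = (?k, c)"
    using \<Psi>(2) by (auto simp: K_mult_def K_map_def split_beta)
  moreover have "(?m, c) \<in> topspace (KS a)" "(?k, c) \<in> topspace (KS a)"
    unfolding topspace_K_space_point using m k by simp_all
  ultimately show "seg_alg a (K_mult ?X (point_space c) ?f z) = seg_alg a (K_map (KS a) ?X (seg_alg a) (\<lambda>b. b) z)"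
    by (simp add: seg_alg_def)
qed

lemma seg_alg_carries:
  assumes "a \<sqsubset> w" shows "carries filter_struct (seg_arr a) (seg_alg a)"
proof -
  have "seg_alg a \<in> extensional (topspace (KS a))" unfolding seg_alg_def by (rule restrict_extensional)
  then show ?thesis
    using seg_alg_monad_algebra[OF assms] unfolding filter_struct_def to_point_def arrow_struct.simps smap.sel by blast
qed

lemma seg_alg_map:
  assumes a: "a \<sqsubset> w" and b: "b \<sqsubset> w" and ab: "seg a \<subseteq> seg b" and z: "z \<in> topspace (KS a)"
  shows "seg_alg b (filter_map (seg_space a) (seg_space b) (\<lambda>x\<in>seg a. x) (fst z), c) = seg_alg a z"
proof -
  have \<phi>: "fst z \<in> open_filters (seg_space a)" using z unfolding topspace_K_space_point by blast
  let ?h = "\<lambda>x\<in>seg a. x"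
  have "continuous_map (seg_space a) (seg_space b) ?h"
  proof -
    have "continuous_map (subtopology (seg_space b) (seg a)) (seg_space b) id" by (simp add: continuous_map_from_subtopology)
    moreover have "subtopology (seg_space b) (seg a) = seg_space a"
      using ab by (simp add: seg_space_def subtopology_subtopology Int_absorb1)
    ultimately show ?thesis using continuous_map_eq[of "seg_space a" "seg_space b" id ?h] by simp
  qed
  then have f: "filter_map (seg_space a) (seg_space b) ?h (fst z) \<in> open_filters (seg_space b)" (is "?\<psi> \<in> _")
    using filter_map_filters \<phi> by blast
  have "height b ?\<psi> = height a (fst z)"
  proof (rule height_eqI[OF b f])
    show "height a (fst z) \<in> pts" using height(1)[OF a \<phi>] by (simp add: seg_def)
    fix d assume d: "d \<sqsubset> w"
    have "{x \<in> seg a. ?h x \<in> up d \<inter> seg b} = up d \<inter> seg a" using ab by auto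
    then show "d \<sqsubset> height a (fst z) \<longleftrightarrow> up d \<inter> seg b \<in> ?\<psi>"
      unfolding height(2)[OF a \<phi> d] using openin_seg_up[OF d] by (simp add: filter_map_def)
  qed
  moreover have "(?\<psi>, c) \<in> topspace (KS b)" unfolding topspace_K_space_point using f by simp
  ultimately show ?thesis using z by (simp add: seg_alg_def)
qed

lemma no_pointed_algebra: "\<not> pointed_algebra space (point_space c) (\<lambda>x\<in>topspace space. c) p"
proof
  let ?f = "\<lambda>x\<in>topspace space. c" and ?K = "K_space space (point_space c) (\<lambda>x\<in>topspace space. c)"
  assume "pointed_algebra space (point_space c) ?f p"
  then have cont: "continuous_map ?K space p" and unit: "\<And>x. x \<in> pts \<Longrightarrow> p (filter_unit space x, c) = x"
    by (auto simp: pointed_algebra_def K_left_def)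
  have Kin: "(\<phi>, c) \<in> topspace ?K" if "\<phi> \<in> open_filters space" for \<phi>
    unfolding topspace_K_space_point using that by simp
  have pre: "\<exists>V\<in>\<phi>. openin space V \<and> (\<forall>\<psi>\<in>sharp space V. p (\<psi>, c) \<in> W)"
    if W: "openin space W" and \<phi>: "\<phi> \<in> open_filters space" "p (\<phi>, c) \<in> W" for W \<phi>
  proof -
    have "continuous_map (filter_space space) ?K (\<lambda>\<phi>. (\<phi>, c))"
      unfolding K_space_def
    proof (rule continuous_map_into_subtopology)
      show "continuous_map (filter_space space) (prod_topology (filter_space space) (point_space c)) (\<lambda>\<phi>. (\<phi>, c))"
        by (simp add: continuous_map_paired)
      show "(\<lambda>\<phi>. (\<phi>, c)) \<in> topspace (filter_space space) \<rightarrow> {(\<phi>, b). filter_unit (point_space c) b \<subseteq> filter_map space (point_space c) ?f \<phi>}"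
        using Kin by (auto simp: topspace_K_space)
    qed
    then have "continuous_map (filter_space space) space (p \<circ> (\<lambda>\<phi>. (\<phi>, c)))" using cont by (rule continuous_map_compose)
    then have "openin (filter_space space) {\<phi> \<in> open_filters space. p (\<phi>, c) \<in> W}"
      using W openin_continuous_map_preimage[of "filter_space space" space "p \<circ> (\<lambda>\<phi>. (\<phi>, c))" W] by simp
    from openin_filter_space_sharp[OF this, of \<phi>] \<phi> show ?thesis by blast
  qed
  define \<phi> where "\<phi> = {V. openin space V \<and> (\<exists>b\<in>V. b \<sqsubset> w)}"
  have \<phi>: "\<phi> \<in> open_filters space"
  proof -
    have "V \<inter> W \<in> \<phi>" if VW: "V \<in> \<phi>" "W \<in> \<phi>" for V W
    proof -
      obtain b b' where b: "b \<in> V" "b \<sqsubset> w" "b' \<in> W" "b' \<sqsubset> w" and op: "openin space V" "openin space W"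
        using VW by (auto simp: \<phi>_def)
      have "b \<in> V \<inter> W \<or> b' \<in> V \<inter> W"
        using total[of b b'] b openin_upset[OF op(1) b(1), of b'] openin_upset[OF op(2) b(3), of b] by (auto simp: pts_def)
      then show ?thesis using b op by (auto simp: \<phi>_def)
    qed
    moreover have "topspace space \<in> \<phi>" using nonempty openin_topspace[of space] by (auto simp: \<phi>_def pts_def)
    ultimately show ?thesis by (auto simp: open_filters_def \<phi>_def)
  qed
  have pp: "p (\<phi>, c) \<in> pts" using continuous_map_image_subset_topspace[OF cont] Kin[OF \<phi>] by auto
  have "p (\<phi>, c) = w"
  proof (rule ccontr)
    assume "p (\<phi>, c) \<noteq> w"
    then have l: "p (\<phi>, c) \<sqsubset> w" using pp by (simp add: pts_def)
    then obtain b where b: "p (\<phi>, c) \<sqsubset> b" "b \<sqsubset> w" using limit by blast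
    have bp: "b \<in> pts" using b by (simp add: pts_def)
    obtain V where V: "V \<in> filter_unit space b" "openin space V" "\<forall>\<psi>\<in>sharp space V. p (\<psi>, c) \<in> up (p (\<phi>, c))"
      using pre[OF openin_up[OF l] filter_unit_filters[of b space]] bp b(1) unit[OF bp] by (auto simp: up_def)
    have "V \<in> \<phi>" using V(1) b(2) by (auto simp: \<phi>_def filter_unit_def)
    then have "p (\<phi>, c) \<in> up (p (\<phi>, c))" using V(3) \<phi> by (auto simp: sharp_def)
    then show False using irrefl by (simp add: up_def)
  qed
  moreover have "openin space {w}" by (rule openin_basic) (simp add: basic_def)
  ultimately obtain V where V: "V \<in> \<phi>" "openin space V" "\<forall>\<psi>\<in>sharp space V. p (\<psi>, c) \<in> {w}"
    using pre[OF _ \<phi>, of "{w}"] by auto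
  then obtain b where b: "b \<in> V" "b \<sqsubset> w" by (auto simp: \<phi>_def)
  then have bp: "b \<in> pts" by (simp add: pts_def)
  then have "filter_unit space b \<in> sharp space V"
    using filter_unit_filters[of b space] V(2) b by (auto simp: sharp_def filter_unit_def)
  then have "b = w" using V(3) unit[OF bp] by auto
  then show False using b irrefl by blast
qed

end

section \<open>Failure of cofibrant generation\<close>

lemma lepoll_iff_card_of: "A \<lesssim> B \<longleftrightarrow> (card_of A, card_of B) \<in> ordLeq"
  unfolding lepoll_def by (rule card_of_ordLeq)

lemma small_iff_not_lepoll: "small (U :: 'u itself) A \<longleftrightarrow> \<not> (UNIV :: 'u set) \<lesssim> A"
proof -
  have "A \<prec> B \<longleftrightarrow> \<not> B \<lesssim> A" for B :: "'u set"
  proof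
    show "\<not> B \<lesssim> A" if "A \<prec> B" using that lepoll_antisym[of A B] unfolding lesspoll_def by blast
    assume n: "\<not> B \<lesssim> A"
    then have "(card_of A, card_of B) \<in> ordLess"
      unfolding lepoll_iff_card_of by (simp add: not_ordLeq_iff_ordLess[OF card_of_Well_order card_of_Well_order])
    then have "A \<lesssim> B" unfolding lepoll_iff_card_of by (rule ordLess_imp_ordLeq)
    then show "A \<prec> B" using n eqpoll_sym eqpoll_imp_lepoll unfolding lesspoll_def by blast
  qed
  then show ?thesis by (simp add: small_def)
qed

text \<open>The chain is the initial segment of a well-order of type \<open>|'u|\<close> below the first \<open>w\<close> that has
  more than \<open>|S|\<close> predecessors: \<open>S\<close> many sets of size at most \<open>|S|\<close> do not cover it.\<close>

lemma exists_chain_space: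
  fixes S :: "'u set"
  assumes U: "universe TYPE('u)" and S: "small TYPE('u) S" "infinite S"
  obtains lt and w :: 'u where "chain_space lt w" "small TYPE('u) {x. lt x w}"
    "\<And>B. \<lbrakk>B \<subseteq> {x. lt x w}; B \<lesssim> S\<rbrakk> \<Longrightarrow> \<exists>a. lt a w \<and> (\<forall>b\<in>B. lt b a)"
proof -
  define r where "r = card_of (UNIV :: 'u set)"
  define lt where "lt x y \<longleftrightarrow> (x, y) \<in> r \<and> x \<noteq> y" for x y
  have co: "Card_order r" "well_order_on UNIV r" "Field r = UNIV"
    using card_of_Card_order[of "UNIV :: 'u set"] card_of_well_order_on[of "UNIV :: 'u set"] Field_card_of[of "UNIV :: 'u set"]
    by (simp_all add: r_def)
  have lin: "refl r" "trans r" "antisym r" "total r" "wf (r - Id)"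
    using co(2) unfolding well_order_on_def linear_order_on_def partial_order_on_def preorder_on_def by auto
  have irr: "\<not> lt x x" for x by (simp add: lt_def)
  have tr: "lt x z" if "lt x y" "lt y z" for x y z
    using that lin(2,3) unfolding lt_def trans_def antisym_def by blast
  have tot: "lt x y \<or> lt y x" if "x \<noteq> y" for x y using that lin(4) unfolding lt_def total_on_def by blast
  have least: "\<exists>y. P y \<and> (\<forall>z. P z \<longrightarrow> \<not> lt z y)" if "P x" for P x
  proof -
    have "x \<in> Collect P" using that by simp
    then obtain y where "y \<in> Collect P" "\<And>z. (z, y) \<in> r - Id \<Longrightarrow> z \<notin> Collect P"
      by (rule wfE_min[OF lin(5)]) blast
    then show ?thesis unfolding lt_def by blast
  qed
  have under: "{y. lt y x} = underS r x" for x by (auto simp: underS_def lt_def)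
  have seg_small: "small TYPE('u) {y. lt y x}" for x
  proof -
    have "(card_of (underS r x), r) \<in> ordLess" using card_of_underS[OF co(1)] co(3) by blast
    then show ?thesis unfolding small_iff_not_lepoll lepoll_iff_card_of under r_def[symmetric]
      using not_ordLess_ordLeq by blast
  qed
  have "\<exists>w. \<not> {y. lt y w} \<lesssim> S"
  proof -
    have "small TYPE('u) (Pow S)" using U S(1) unfolding universe_def by blast
    then have "(card_of (Pow S), r) \<in> ordLess"
      unfolding small_iff_not_lepoll lepoll_iff_card_of r_def
      by (simp add: not_ordLeq_iff_ordLess[OF card_of_Well_order card_of_Well_order])
    then obtain a where "(card_of (Pow S), Restr r (underS r a)) \<in> ordIso"
      using ordLess_iff_ordIso_Restr[of r "card_of (Pow S)"] card_of_Well_order[of "UNIV :: 'u set"] card_of_Well_order[of "Pow S"]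
      unfolding r_def by blast
    then have "(card_of (Field (card_of (Pow S))), card_of (Field (Restr r (underS r a)))) \<in> ordIso"
      by (rule card_of_cong)
    then have "Pow S \<lesssim> Field (Restr r (underS r a))"
      unfolding lepoll_iff_card_of Field_card_of by (rule ordIso_imp_ordLeq)
    moreover have "Field (Restr r (underS r a)) \<subseteq> underS r a" by (auto simp: Field_def)
    ultimately have P: "Pow S \<lesssim> {y. lt y a}" unfolding under using lepoll_trans subset_imp_lepoll by blast
    have "\<not> Pow S \<lesssim> S" using lesspoll_Pow_self lesspoll_trans1 by blast
    then show ?thesis using lepoll_trans[OF P] by blast
  qed
  then obtain w where w: "\<not> {y. lt y w} \<lesssim> S" "\<And>z. lt z w \<Longrightarrow> {y. lt y z} \<lesssim> S"
    using least[of "\<lambda>w. \<not> {y. lt y w} \<lesssim> S"] by blast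
  have bounded: "\<exists>a. lt a w \<and> (\<forall>b\<in>B. lt b a)" if B: "B \<subseteq> {x. lt x w}" "B \<lesssim> S" for B
  proof (rule ccontr)
    assume n: "\<not> (\<exists>a. lt a w \<and> (\<forall>b\<in>B. lt b a))"
    have sub: "{x. lt x w} \<subseteq> (\<Union>b\<in>B. {b} \<union> {y. lt y b})"
    proof
      fix x assume "x \<in> {x. lt x w}"
      then obtain b where "b \<in> B" "\<not> lt b x" using n by blast
      then show "x \<in> (\<Union>b\<in>B. {b} \<union> {y. lt y b})" using tot[of x b] by blast
    qed
    have "(card_of ({b} \<union> {y. lt y b}), card_of S) \<in> ordLeq" if "b \<in> B" for b
    proof (rule card_of_Un_ordLeq_infinite_Field)
      show "infinite (Field (card_of S))" "Card_order (card_of S)"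
        using S(2) card_of_Card_order by (simp_all add: Field_card_of)
      show "(card_of {b}, card_of S) \<in> ordLeq"
        using finite_lepoll_infinite[OF S(2), of "{b}"] unfolding lepoll_iff_card_of by simp
      show "(card_of {y. lt y b}, card_of S) \<in> ordLeq" using w(2) that B(1) unfolding lepoll_iff_card_of by blast
    qed
    then have "(\<Union>b\<in>B. {b} \<union> {y. lt y b}) \<lesssim> S"
      unfolding lepoll_iff_card_of
      by (intro card_of_UNION_ordLeq_infinite[OF S(2) B(2)[unfolded lepoll_iff_card_of]]) blast
    from w(1) lepoll_trans[OF subset_imp_lepoll[OF sub] this] show False by (rule notE)
  qed
  have "chain_space lt w"
  proof
    show "\<exists>b. lt a b \<and> lt b w" if a: "lt a w" for a
    proof -
      have "{a} \<lesssim> S" by (rule finite_lepoll_infinite[OF S(2)]) simp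
      then show ?thesis using bounded[of "{a}"] a by blast
    qed
    have "({} :: 'u set) \<lesssim> S" by (rule finite_lepoll_infinite[OF S(2)]) simp
    then show "\<exists>a. lt a w" using bounded[of "{}"] by blast
    show "\<not> lt x x" for x by (rule irr)
    show "lt x y \<Longrightarrow> lt y z \<Longrightarrow> lt x z" for x y z by (rule tr)
    show "x \<noteq> y \<Longrightarrow> lt x y \<or> lt y x" for x y by (rule tot)
    show "P x \<Longrightarrow> \<exists>y. P y \<and> (\<forall>z. P z \<longrightarrow> \<not> lt z y)" for P x by (rule least)
  qed
  then show ?thesis using seg_small bounded by (rule that)
qed

lemma bounding_set:
  fixes \<U> :: "('u topology, 'u) smap set"
  assumes U: "universe TYPE('u)" and sm: "small TYPE('u) \<U>" and arr: "\<U> \<subseteq> Arr (Top0 TYPE('u))"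
  obtains S :: "'u set" where "small TYPE('u) S" "infinite S"
    "\<And>u. u \<in> \<U> \<Longrightarrow> topspace (src u) \<lesssim> S \<and> topspace (tgt u) \<lesssim> S"
proof -
  obtain h :: "nat \<Rightarrow> 'u" where h: "inj h"
    using lesspoll_imp_lepoll[OF U[unfolded universe_def small_def, THEN conjunct1]] unfolding lepoll_def by blast
  define A where "A = (\<Union>u\<in>\<U>. topspace (src u))"
  define B where "B = (\<Union>u\<in>\<U>. topspace (tgt u))"
  define S where "S = (\<Union>X\<in>{A, B, range h}. X)"
  have "small TYPE('u) (topspace (src u))" "small TYPE('u) (topspace (tgt u))" if "u \<in> \<U>" for u
    using that arr by (auto simp: Top0_def)
  then have "small TYPE('u) A" "small TYPE('u) B"
    unfolding A_def B_def by (auto intro: small_UN_base[OF U sm])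
  moreover have "small TYPE('u) (range h)" using small_image U unfolding universe_def by blast
  moreover have "small TYPE('u) {A, B, range h}" by (rule finite_small[OF U]) simp
  ultimately have "small TYPE('u) S" unfolding S_def by (intro small_UN_base[OF U]) auto
  moreover have "infinite S" using range_inj_infinite[OF h] finite_subset[of "range h" S] by (auto simp: S_def)
  moreover have "topspace (src u) \<lesssim> S \<and> topspace (tgt u) \<lesssim> S" if "u \<in> \<U>" for u
    using that by (intro conjI subset_imp_lepoll) (auto simp: S_def A_def B_def)
  ultimately show ?thesis using that by blast
qed

lemma point_space_obj: "universe U \<Longrightarrow> point_space c \<in> Obj (Top0 U)"
  using finite_small[of U "{c}"] by (simp add: Top0_obj_iff point_space_def t0_space_def)

lemma to_point_hom:
  assumes "universe U" "X \<in> Obj (Top0 U)"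
  shows "to_point c X \<in> homset (Top0 U) X (point_space c)"
proof -
  have "continuous_map X (point_space c) (\<lambda>x. c)" by simp
  then have "continuous_map X (point_space c) (\<lambda>x\<in>topspace X. c)" by (rule continuous_map_eq) simp
  then show ?thesis using assms point_space_obj by (simp add: to_point_def Top0_hom_iff)
qed

lemma to_point_unique:
  assumes "f \<in> homset (Top0 U) X (point_space c)" "g \<in> homset (Top0 U) X (point_space c)"
  shows "f = g"
proof (rule Top0_hom_eqI[OF assms])
  fix x assume "x \<in> topspace X"
  then show "fn f x = fn g x" using Top0_fn[OF assms(1)] Top0_fn[OF assms(2)] unfolding topspace_point_space by blast
qed

lemma subspace_hom:
  assumes X: "X \<in> Obj (Top0 U)"
  shows "subtopology X A \<in> Obj (Top0 U)"
    and "SMap (subtopology X A) X (\<lambda>x\<in>topspace (subtopology X A). x) \<in> homset (Top0 U) (subtopology X A) X"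
proof -
  show 1: "subtopology X A \<in> Obj (Top0 U)"
    using X small_subset[of "topspace (subtopology X A)" "topspace X"] t0_space_subtopology by (auto simp: Top0_obj_iff)
  have "continuous_map (subtopology X A) X (\<lambda>x. x)" using continuous_map_from_subtopology[OF continuous_map_id[of X], of A] by (simp add: id_def)
  then have "continuous_map (subtopology X A) X (\<lambda>x\<in>topspace (subtopology X A). x)" by (rule continuous_map_eq) simp
  then show "SMap (subtopology X A) X (\<lambda>x\<in>topspace (subtopology X A). x) \<in> homset (Top0 U) (subtopology X A) X"
    using X 1 by (simp add: Top0_hom_iff)
qed

locale bounded_chain_space = chain_space lt w c for lt :: "'u \<Rightarrow> 'u \<Rightarrow> bool" (infix "\<sqsubset>" 50) and w c :: 'u +
  fixes S :: "'u set"
  assumes univ: "universe TYPE('u)" and small_below: "small TYPE('u) {x. x \<sqsubset> w}"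
    and bounded: "\<lbrakk>B \<subseteq> {x. x \<sqsubset> w}; B \<lesssim> S\<rbrakk> \<Longrightarrow> \<exists>a. a \<sqsubset> w \<and> (\<forall>b\<in>B. b \<sqsubset> a)"
begin

abbreviation TT :: "('u topology, ('u topology, 'u) smap) ordcat" where "TT \<equiv> Top0 TYPE('u)"
abbreviation pt :: "'u topology" where "pt \<equiv> point_space c"

sublocale small_hom_category "TT" "TYPE('u)" by (rule Top0_small_hom[OF univ])

definition below_rel :: "'u rel" where "below_rel = {(a, b). a \<sqsubset> w \<and> b \<sqsubset> w \<and> (a = b \<or> a \<sqsubset> b)}"

lemma Field_below_rel: "Field below_rel = {a. a \<sqsubset> w}" by (auto simp: below_rel_def Field_def)

lemma below_rel_order: "Partial_order below_rel" "small TYPE('u) (Field below_rel)"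
proof -
  have "antisym below_rel" unfolding antisym_def below_rel_def using trans irrefl by blast
  moreover have "Relation.trans below_rel" unfolding trans_def below_rel_def using trans by blast
  ultimately show "Partial_order below_rel"
    unfolding partial_order_on_def preorder_on_def refl_on_def Field_below_rel by (auto simp: below_rel_def)
  show "small TYPE('u) (Field below_rel)" using small_below by (simp add: Field_below_rel)
qed

lemma space_obj: "space \<in> Obj TT"
proof -
  have "small TYPE('u) (\<Union>X\<in>{{w}, {x. x \<sqsubset> w}}. X)"
  proof (rule small_UN_base[OF univ])
    show "small TYPE('u) {{w}, {x. x \<sqsubset> w}}" by (rule finite_small[OF univ]) simp
    show "small TYPE('u) X" if "X \<in> {{w}, {x. x \<sqsubset> w}}" for X
      using that small_below finite_small[OF univ, of "{w}"] by auto
  qed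
  moreover have "(\<Union>X\<in>{{w}, {x. x \<sqsubset> w}}. X) = pts" by (auto simp: pts_def)
  ultimately show ?thesis using t0_space_space by (simp add: Top0_obj_iff)
qed

lemma seg_obj: "seg_space a \<in> Obj TT" unfolding seg_space_def by (rule subspace_hom(1)[OF space_obj])

definition incl :: "'u \<Rightarrow> ('u topology, 'u) smap" where "incl a = SMap (seg_space a) space (\<lambda>x\<in>seg a. x)"
definition step :: "'u \<Rightarrow> 'u \<Rightarrow> ('u topology, 'u) smap" where "step a b = SMap (seg_space a) (seg_space b) (\<lambda>x\<in>seg a. x)"

lemma incl_hom: "incl a \<in> homset TT (seg_space a) space"
  using subspace_hom(2)[OF space_obj, of "seg a"] unfolding seg_space_def[symmetric] incl_def by simp

lemma seg_mono: "(a, b) \<in> below_rel \<Longrightarrow> seg a \<subseteq> seg b"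
  using trans[of a b] by (auto simp: below_rel_def seg_def)

lemma factor_seg:
  assumes h: "h \<in> homset TT X space" and im: "fn h ` topspace X \<subseteq> seg a"
  shows "\<exists>h'\<in>homset TT X (seg_space a). Comp TT (incl a) h' = h \<and> fn h' = fn h"
proof -
  have hh: "continuous_map X space (fn h)" "X \<in> Obj TT" "fn h \<in> extensional (topspace X)" "src h = X" "tgt h = space"
    using h by (auto simp: Top0_hom_iff)
  have "continuous_map X (seg_space a) (fn h)"
    unfolding seg_space_def using hh(1) im by (intro continuous_map_into_subtopology) auto
  then have h': "SMap X (seg_space a) (fn h) \<in> homset TT X (seg_space a)"
    using hh seg_obj by (simp add: Top0_hom_iff)
  moreover have "Comp TT (incl a) (SMap X (seg_space a) (fn h)) = h"
    by (rule Top0_hom_eqI[OF Top0_comp_hom[OF h' incl_hom] h]) (use im in \<open>auto simp: compose_def incl_def\<close>)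
  ultimately show ?thesis by (intro bexI[of _ "SMap X (seg_space a) (fn h)"]) simp_all
qed

lemma factor_small:
  assumes h: "h \<in> homset TT X space" and X: "topspace X \<lesssim> S"
  shows "\<exists>a. a \<sqsubset> w \<and> (\<exists>h'\<in>homset TT X (seg_space a). Comp TT (incl a) h' = h)"
proof -
  let ?B = "fn h ` topspace X \<inter> {x. x \<sqsubset> w}"
  have "?B \<lesssim> S"
    by (rule lepoll_trans[OF subset_imp_lepoll[OF Int_lower1] lepoll_trans[OF image_lepoll X]])
  then obtain a where a: "a \<sqsubset> w" "\<forall>b\<in>?B. b \<sqsubset> a" using bounded[of ?B] by blast
  have "fn h ` topspace X \<subseteq> seg a"
  proof
    fix y assume y: "y \<in> fn h ` topspace X"
    then obtain x where "x \<in> topspace X" "y = fn h x" by blast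
    then have p: "y \<in> pts" using Top0_fn[OF h] unfolding topspace_space by blast
    have "\<not> a \<sqsubset> y" if "y \<noteq> w"
    proof -
      have "y \<sqsubset> a" using p that a(2) y by (simp add: pts_def)
      then show ?thesis using trans[of y a y] irrefl[of y] by blast
    qed
    then show "y \<in> seg a" using p by (auto simp: seg_def)
  qed
  then show ?thesis using factor_seg[OF h] a by blast
qed

lemma step_hom: "(a, b) \<in> below_rel \<Longrightarrow> step a b \<in> homset TT (seg_space a) (seg_space b)"
  and incl_step: "(a, b) \<in> below_rel \<Longrightarrow> Comp TT (incl b) (step a b) = incl a"
proof -
  assume ab: "(a, b) \<in> below_rel"
  obtain h' where h': "h' \<in> homset TT (seg_space a) (seg_space b)" "Comp TT (incl b) h' = incl a" "fn h' = fn (incl a)"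
    using factor_seg[OF incl_hom, of a b] seg_mono[OF ab] by (auto simp: incl_def)
  then have "h' = step a b" by (simp add: Top0_hom_iff step_def incl_def smap.expand)
  then show "step a b \<in> homset TT (seg_space a) (seg_space b)" "Comp TT (incl b) (step a b) = incl a" using h' by auto
qed

lemma incl_reflects:
  assumes "d \<in> homset TT Y (seg_space a)" "d' \<in> homset TT Y (seg_space a)" "Le TT (Comp TT (incl a) d) (Comp TT (incl a) d')"
  shows "Le TT d d'"
proof -
  have s: "src d = Y" "src d' = Y" "tgt d = seg_space a" using assms by (auto simp: Top0_hom_iff)
  have "specialises (seg_space a) (fn d' x) (fn d x)" if x: "x \<in> topspace Y" for x
  proof -
    have dx: "fn d x \<in> seg a" "fn d' x \<in> seg a" using Top0_fn[OF assms(1) x] Top0_fn[OF assms(2) x] by simp_all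
    have "x \<in> topspace (src (Comp TT (incl a) d))" using x s by simp
    then have "specialises (tgt (Comp TT (incl a) d)) (fn (Comp TT (incl a) d') x) (fn (Comp TT (incl a) d) x)"
      using assms(3) unfolding Top0_simps(5) by blast
    then have "specialises space (fn d' x) (fn d x)" using dx x s by (simp add: compose_def incl_def)
    then show ?thesis using dx unfolding specialises_def seg_space_def openin_subtopology by blast
  qed
  then show ?thesis using s by simp
qed

abbreviation space_arr :: "('u topology, 'u) smap" where "space_arr \<equiv> to_point c space"
definition seg_leg :: "'u \<Rightarrow> ('u topology, 'u) smap square" where "seg_leg a = Square (seg_arr a) space_arr (incl a) (Idt TT pt)"
definition seg_step :: "'u \<Rightarrow> 'u \<Rightarrow> ('u topology, 'u) smap square" where
  "seg_step a b = Square (seg_arr a) (seg_arr b) (step a b) (Idt TT pt)"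

lemma point_arr [simp]: "Dom TT (to_point c X) = X" "Cod TT (to_point c X) = pt"
  by (simp_all add: to_point_def)

lemma seg_arr_hom: "seg_arr a \<in> homset TT (seg_space a) pt" and space_arr_hom: "space_arr \<in> homset TT space pt"
  by (rule to_point_hom[OF univ seg_obj]) (rule to_point_hom[OF univ space_obj])

lemma over_point_square:
  assumes "f \<in> homset TT X Y" "X \<in> Obj TT" "Y \<in> Obj TT"
  shows "Square (to_point c X) (to_point c Y) f (Idt TT pt) \<in> homset (arrow_cat TT) (to_point c X) (to_point c Y)"
proof -
  note X = to_point_hom[OF univ assms(2), of c] and Y = to_point_hom[OF univ assms(3), of c]
  note i = Top0_idt_hom[OF point_space_obj[OF univ], of c]
  show ?thesis
    by (rule Square_homI)
      (use homset_arr[OF X] homset_arr[OF Y] assms i to_point_unique[OF Top0_comp_hom[OF X i] Top0_comp_hom[OF assms(1) Y]]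
        in \<open>simp_all only: point_arr\<close>)
qed

lemma seg_leg_hom: "seg_leg a \<in> homset (arrow_cat TT) (seg_arr a) space_arr"
  unfolding seg_leg_def by (rule over_point_square[OF incl_hom seg_obj space_obj])

lemma seg_step_hom: "(a, b) \<in> below_rel \<Longrightarrow> seg_step a b \<in> homset (arrow_cat TT) (seg_arr a) (seg_arr b)"
  unfolding seg_step_def by (rule over_point_square[OF step_hom seg_obj seg_obj])

lemma idt_pt_comp: "Comp TT (Idt TT pt) (Idt TT pt) = Idt TT pt"
  using idt_comp[OF Top0_idt_hom[OF point_space_obj[OF univ]]] .

lemma seg_diagram: "poset_diagram (arrow_cat TT) below_rel seg_arr seg_step"
  unfolding poset_diagram_def
proof (intro conjI ballI)
  fix a assume a: "a \<in> Field below_rel"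
  show "seg_arr a \<in> Obj (arrow_cat TT)" using homset_arr[OF seg_arr_hom] by simp
  have "step a a = Idt TT (seg_space a)" by (simp add: step_def)
  then show "seg_step a a = Idt (arrow_cat TT) (seg_arr a)" unfolding seg_step_def arrow_cat_simps(4) point_arr by simp
next
  fix ab assume "ab \<in> below_rel"
  then obtain a b where ab: "ab = (a, b)" "(a, b) \<in> below_rel" by (cases ab) auto
  show "case ab of (a, b) \<Rightarrow> seg_step a b \<in> homset (arrow_cat TT) (seg_arr a) (seg_arr b)" using seg_step_hom ab by simp
  have "Comp (arrow_cat TT) (seg_step b d) (seg_step a b) = seg_step a d" if bd: "(b, d) \<in> below_rel" for d
  proof -
    have "Comp TT (step b d) (step a b) = step a d"
      by (rule Top0_hom_eqI[OF Top0_comp_hom[OF step_hom[OF ab(2)] step_hom[OF bd]] step_hom])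
        (use seg_mono[OF ab(2)] ab(2) bd trans in \<open>auto simp: step_def compose_def below_rel_def\<close>)
    then show ?thesis unfolding arrow_cat_simps(5) seg_step_def square.sel idt_pt_comp by simp
  qed
  then show "case ab of (a, b) \<Rightarrow> \<forall>c. (b, c) \<in> below_rel \<longrightarrow> Comp (arrow_cat TT) (seg_step b c) (seg_step a b) = seg_step a c"
    using ab by simp
qed

lemma seg_cocone: "poset_cocone (arrow_cat TT) below_rel seg_arr seg_step space_arr seg_leg"
  unfolding poset_cocone_def
proof (intro conjI ballI)
  show "space_arr \<in> Obj (arrow_cat TT)" using homset_arr[OF space_arr_hom] by simp
  show "seg_leg a \<in> homset (arrow_cat TT) (seg_arr a) space_arr" for a by (rule seg_leg_hom)
  fix ab assume "ab \<in> below_rel"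
  then obtain a b where ab: "ab = (a, b)" "(a, b) \<in> below_rel" by (cases ab) auto
  have "Comp (arrow_cat TT) (seg_leg b) (seg_step a b) = seg_leg a"
    unfolding arrow_cat_simps(5) seg_step_def seg_leg_def square.sel idt_pt_comp incl_step[OF ab(2)] by simp
  then show "case ab of (a, b) \<Rightarrow> Comp (arrow_cat TT) (seg_leg b) (seg_step a b) = seg_leg a" using ab by simp
qed

lemma factor_square:
  assumes sq: "Square u space_arr h k \<in> Arr (arrow_cat TT)" and X: "topspace (src u) \<lesssim> S"
  shows "\<exists>a h'. a \<sqsubset> w \<and> Square u (seg_arr a) h' k \<in> Arr (arrow_cat TT) \<and> Comp TT (incl a) h' = h"
proof -
  have u: "u \<in> Arr TT" and h: "h \<in> homset TT (src u) space" and k: "k \<in> homset TT (tgt u) pt"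
    using sq[unfolded Square_arr_iff point_arr] unfolding Top0_simps(1,2) by blast+
  obtain a h' where a: "a \<sqsubset> w" "h' \<in> homset TT (src u) (seg_space a)" "Comp TT (incl a) h' = h"
    using factor_small[OF h X] by blast
  have "u \<in> homset TT (src u) (tgt u)" using homset_self[OF u] by simp
  then have "Comp TT k u = Comp TT (seg_arr a) h'"
    using to_point_unique[OF Top0_comp_hom[OF _ k] Top0_comp_hom[OF a(2) seg_arr_hom]] by blast
  then have "Square u (seg_arr a) h' k \<in> Arr (arrow_cat TT)"
    using u a(2) k homset_arr[OF seg_arr_hom[of a]] unfolding Square_arr_iff point_arr unfolding Top0_simps(1,2) by blast
  then show ?thesis using a by blast
qed

lemma comparison_seg_colimit:
  assumes u: "u \<in> Arr TT" and sm: "topspace (src u) \<lesssim> S" "topspace (tgt u) \<lesssim> S"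
  shows "poset_colimit (arrow_cat (Ord_cat TYPE('u))) below_rel (\<lambda>a. comparison TT u (seg_arr a))
    (\<lambda>a b. comparison_sq TT (Idt (arrow_cat TT) u) (seg_step a b)) (comparison TT u space_arr)
    (\<lambda>a. comparison_sq TT (Idt (arrow_cat TT) u) (seg_leg a))"
proof (rule comparison_colimit[OF seg_diagram seg_cocone u])
  have st: "stop (seg_leg a) = incl a" "sbot (seg_leg a) = Idt TT pt" for a by (simp_all only: seg_leg_def square.sel)
  show "\<exists>d. (a, d) \<in> below_rel \<and> (b, d) \<in> below_rel" if "a \<in> Field below_rel" "b \<in> Field below_rel" for a b
    using that total[of a b] unfolding Field_below_rel by (auto simp: below_rel_def)
  show "\<exists>a\<in>Field below_rel. \<exists>d'\<in>homset TT (Cod TT u) (Dom TT (seg_arr a)). Comp TT (stop (seg_leg a)) d' = d"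
    if "d \<in> homset TT (Cod TT u) (Dom TT space_arr)" for d
    using factor_small[of d "tgt u"] that sm(2) unfolding st Field_below_rel point_arr unfolding Top0_simps(1,2) by blast
  show "\<exists>a\<in>Field below_rel. \<exists>h' k'. Square u (seg_arr a) h' k' \<in> Arr (arrow_cat TT) \<and>
      Comp TT (stop (seg_leg a)) h' = h \<and> Comp TT (sbot (seg_leg a)) k' = k"
    if sq: "Square u space_arr h k \<in> Arr (arrow_cat TT)" for h k
  proof -
    have "k \<in> homset TT (Cod TT u) pt" using sq unfolding Square_arr_iff point_arr by blast
    then have "Comp TT (Idt TT pt) k = k" by (rule idt_comp)
    then show ?thesis using factor_square[OF sq sm(1)] unfolding st Field_below_rel by blast
  qed
  show "Le TT d d'" if "d \<in> homset TT Y (Dom TT (seg_arr a))" "d' \<in> homset TT Y (Dom TT (seg_arr a))"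
      "Le TT (Comp TT (stop (seg_leg a)) d) (Comp TT (stop (seg_leg a)) d')" for a Y d d'
    using incl_reflects that unfolding st point_arr by blast
  show "Le TT d d'" if "d \<in> homset TT Y (Cod TT (seg_arr a))" "d' \<in> homset TT Y (Cod TT (seg_arr a))" for a Y d d'
    using le_refl[OF homset_arr[OF that(1)]] to_point_unique[of d _ Y c d'] that unfolding point_arr by blast
qed

lemma seg_step_preserves:
  assumes ab: "(a, b) \<in> below_rel"
  shows "preserves filter_struct (seg_arr a, seg_alg a) (seg_arr b, seg_alg b) (seg_step a b)"
proof -
  have lt: "a \<sqsubset> w" "b \<sqsubset> w" using ab by (auto simp: below_rel_def)
  have "(\<lambda>x\<in>seg a. x) (seg_alg a z) = seg_alg b (K_map (seg_space a) (seg_space b) (\<lambda>x\<in>seg a. x) (fn (Idt TT pt)) z)"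
    if z: "z \<in> topspace (KS a)" for z
  proof -
    have "K_map (seg_space a) (seg_space b) (\<lambda>x\<in>seg a. x) (fn (Idt TT pt)) z =
      (filter_map (seg_space a) (seg_space b) (\<lambda>x\<in>seg a. x) (fst z), c)"
      using z[unfolded topspace_K_space_point] by (simp add: K_map_def split_beta)
    moreover have "seg_alg a z \<in> seg a" using seg_alg_in[OF lt(1) z] by blast
    ultimately show ?thesis using seg_alg_map[OF lt seg_mono[OF ab] z] by simp
  qed
  then show ?thesis
    unfolding filter_struct_def arrow_struct.simps prod.case to_point_def smap.sel seg_step_def square.sel step_def by blast
qed

lemma space_arr_not_algebra: "\<not> pointed_algebra (src space_arr) (tgt space_arr) (fn space_arr) p"
  using no_pointed_algebra unfolding to_point_def smap.sel .

lemma not_generated: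
  assumes J: "internal_category J" and P: "internal_functor J (sq TT) P"
    and sm: "\<And>u. u \<in> onObj (onVer P) ` Obj (Ver J) \<Longrightarrow> topspace (src u) \<lesssim> S \<and> topspace (tgt u) \<lesssim> S"
    and M: "algebraic_struct (Ord_cat TYPE('u)) T M below_rel"
  shows "\<not> iso_over (struct_intcat TT filter_struct) forget (struct_intcat TT (lift_struct TT M J P)) forget"
proof
  assume iso: "iso_over (struct_intcat TT filter_struct) forget (struct_intcat TT (lift_struct TT M J P)) forget"
  obtain \<tau> where t1: "\<And>f p. \<lbrakk>f \<in> Arr TT; carries filter_struct f p\<rbrakk> \<Longrightarrow> carries (lift_struct TT M J P) f (\<tau> f p)"
    and t2: "\<And>f p g q s. \<lbrakk>f \<in> Arr TT; carries filter_struct f p; g \<in> Arr TT; carries filter_struct g q;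
       s \<in> homset (arrow_cat TT) f g; preserves filter_struct (f, p) (g, q) s\<rbrakk>
       \<Longrightarrow> preserves (lift_struct TT M J P) (f, \<tau> f p) (g, \<tau> g q) s"
    and t3: "\<And>f \<phi>. \<lbrakk>f \<in> Arr TT; carries (lift_struct TT M J P) f \<phi>\<rbrakk> \<Longrightarrow> \<exists>p. carries filter_struct f p"
    by (rule iso_over_structD[OF iso]) (rule that)
  have lt: "a \<sqsubset> w" if "a \<in> Field below_rel" for a using that by (simp add: Field_below_rel)
  have PV: "ord_functor (Ver J) (arrow_cat TT) (onVer P)" using internal_functor.functor_onVer[OF P] by (simp add: sq_def)
  have "\<exists>\<psi>. carries (lift_struct TT M J P) space_arr \<psi>"
  proof (rule lift_struct_colimit[OF M J P seg_diagram seg_cocone])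
    fix u assume u: "u \<in> onObj (onVer P) ` Obj (Ver J)"
    then have "u \<in> Arr TT" using ord_functor.obj_map[OF PV] by auto
    then show "poset_colimit (arrow_cat (Ord_cat TYPE('u))) below_rel (\<lambda>a. comparison TT u (seg_arr a))
       (\<lambda>a b. comparison_sq TT (Idt (arrow_cat TT) u) (seg_step a b)) (comparison TT u space_arr)
       (\<lambda>a. comparison_sq TT (Idt (arrow_cat TT) u) (seg_leg a))"
      using comparison_seg_colimit sm[OF u] by blast
  next
    show "carries (lift_struct TT M J P) (seg_arr a) (\<tau> (seg_arr a) (seg_alg a))" if "a \<in> Field below_rel" for a
      using t1[OF homset_arr[OF seg_arr_hom] seg_alg_carries[OF lt[OF that]]] .
    fix a b assume ab: "(a, b) \<in> below_rel"
    then have "a \<sqsubset> w" "b \<sqsubset> w" by (auto simp: below_rel_def)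
    then show "preserves (lift_struct TT M J P) (seg_arr a, \<tau> (seg_arr a) (seg_alg a)) (seg_arr b, \<tau> (seg_arr b) (seg_alg b)) (seg_step a b)"
      using t2[OF homset_arr[OF seg_arr_hom] seg_alg_carries homset_arr[OF seg_arr_hom] seg_alg_carries seg_step_hom[OF ab] seg_step_preserves[OF ab]]
      by blast
  qed
  then obtain p where "carries filter_struct space_arr p" using t3[OF homset_arr[OF space_arr_hom]] by blast
  then have "pointed_algebra (src space_arr) (tgt space_arr) (fn space_arr) p"
    unfolding filter_struct_def arrow_struct.simps monad_algebra_def by blast
  then show False using space_arr_not_algebra by blast
qed

lemma right_class_not_rlp:
  assumes sm: "\<And>i. i \<in> I \<Longrightarrow> topspace (src i) \<lesssim> S"
  shows "filter_right_class TYPE('u) \<noteq> {f \<in> Arr TT. \<forall>i\<in>I. has_rlp TT i f}"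
proof
  assume eq: "filter_right_class TYPE('u) = {f \<in> Arr TT. \<forall>i\<in>I. has_rlp TT i f}"
  have seg: "has_rlp TT i (seg_arr a)" if "a \<sqsubset> w" "i \<in> I" for a i
  proof -
    have "carries filter_struct (seg_arr a) (seg_alg a)" using seg_alg_carries[OF that(1)] .
    then have "seg_arr a \<in> filter_right_class TYPE('u)"
      using homset_arr[OF seg_arr_hom] unfolding filter_right_class_def filter_struct_def arrow_struct.simps monad_algebra_def by blast
    then show ?thesis using eq that(2) by blast
  qed
  have "has_rlp TT i space_arr" if i: "i \<in> I" for i
    unfolding has_rlp_def
  proof (intro allI impI)
    fix h k assume sq: "Square i space_arr h k \<in> Arr (arrow_cat TT)"
    then have k: "k \<in> homset TT (Cod TT i) pt" and iA: "i \<in> Arr TT" unfolding Square_arr_iff point_arr by blast+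
    obtain a h' where a: "a \<sqsubset> w" "Square i (seg_arr a) h' k \<in> Arr (arrow_cat TT)" "Comp TT (incl a) h' = h"
      using factor_square[OF sq sm[OF i]] by blast
    obtain d where d: "d \<in> homset TT (Cod TT i) (seg_space a)" "Comp TT d i = h'"
      using seg[OF a(1) i] a(2) unfolding has_rlp_def point_arr by blast
    have "Comp TT (Comp TT (incl a) d) i = h"
      using comp_assoc[OF homset_self[OF iA] d(1) incl_hom] d(2) a(3) by metis
    moreover have dd: "Comp TT (incl a) d \<in> homset TT (Cod TT i) space" using Top0_comp_hom[OF d(1) incl_hom] .
    moreover have "Comp TT space_arr (Comp TT (incl a) d) = k" using to_point_unique[OF Top0_comp_hom[OF dd space_arr_hom] k] .
    ultimately show "\<exists>d\<in>homset TT (Cod TT i) (Dom TT space_arr). Comp TT d i = h \<and> Comp TT space_arr d = k"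
      unfolding point_arr by blast
  qed
  then have "space_arr \<in> filter_right_class TYPE('u)" using eq homset_arr[OF space_arr_hom] by blast
  then show False using space_arr_not_algebra unfolding filter_right_class_def by blast
qed

end

lemma exists_bounded_chain_space:
  fixes \<U> :: "('u topology, 'u) smap set"
  assumes U: "universe TYPE('u)" and "small TYPE('u) \<U>" and "\<U> \<subseteq> Arr (Top0 TYPE('u))"
  obtains lt and w :: 'u and S where "bounded_chain_space lt w S"
    "\<And>u. u \<in> \<U> \<Longrightarrow> topspace (src u) \<lesssim> S \<and> topspace (tgt u) \<lesssim> S"
proof -
  obtain S :: "'u set" where S: "small TYPE('u) S" "infinite S"
    "\<And>u. u \<in> \<U> \<Longrightarrow> topspace (src u) \<lesssim> S \<and> topspace (tgt u) \<lesssim> S"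
    using bounding_set[OF assms] by blast
  obtain lt and w :: 'u where "chain_space lt w" "small TYPE('u) {x. lt x w}"
    "\<And>B. \<lbrakk>B \<subseteq> {x. lt x w}; B \<lesssim> S\<rbrakk> \<Longrightarrow> \<exists>a. lt a w \<and> (\<forall>b\<in>B. lt b a)"
    using exists_chain_space[OF U S(1,2)] by blast
  then have "bounded_chain_space lt w S"
    using U by (intro bounded_chain_space.intro bounded_chain_space_axioms.intro)
  then show ?thesis using that S(3) by blast
qed

lemma not_cofibrantly_generated:
  assumes U: "universe TYPE('u)"
    and M: "\<And>r :: 'u rel. \<lbrakk>Partial_order r; small TYPE('u) (Field r)\<rbrakk> \<Longrightarrow> algebraic_struct (Ord_cat TYPE('u)) T M r"
  shows "\<not> cofibrantly_generated TYPE('u) (Top0 TYPE('u)) filter_struct M"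
proof
  assume "cofibrantly_generated TYPE('u) (Top0 TYPE('u)) filter_struct M"
  then obtain J :: "('u, 'u, 'u, 'u) intcat" and P where J: "internal_category J" "small_intcat TYPE('u) J"
    "internal_functor J (sq (Top0 TYPE('u))) P"
    "iso_over (struct_intcat (Top0 TYPE('u)) filter_struct) forget (struct_intcat (Top0 TYPE('u)) (lift_struct (Top0 TYPE('u)) M J P)) forget"
    unfolding cofibrantly_generated_def by blast
  let ?\<U> = "onObj (onVer P) ` Obj (Ver J)"
  have "small TYPE('u) ?\<U>" using J(2) small_image unfolding small_intcat_def small_cat_def by blast
  moreover have "?\<U> \<subseteq> Arr (Top0 TYPE('u))"
    using ord_functor.obj_map[OF internal_functor.functor_onVer[OF J(3)]] by (auto simp: sq_def)
  ultimately obtain lt and w :: 'u and S where c: "bounded_chain_space lt w S"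
    and s: "\<And>u. u \<in> ?\<U> \<Longrightarrow> topspace (src u) \<lesssim> S \<and> topspace (tgt u) \<lesssim> S"
    using exists_bounded_chain_space[OF U] by metis
  interpret bounded_chain_space lt w undefined S by (rule c)
  show False using not_generated[OF J(1,3) s M[OF below_rel_order]] J(4) by blast
qed

theorem theorem11p1:
  assumes "universe TYPE('u)"
  shows "(\<forall>W. ord_awfs (Ord_cat TYPE('u)) W \<and> cocontinuous_awfs TYPE('u) (Ord_cat TYPE('u)) W \<longrightarrow>
            \<not> cofibrantly_generated TYPE('u) (Top0 TYPE('u)) filter_struct
                (awfs_struct (Ord_cat TYPE('u)) W))
       \<and> \<not> cofibrantly_generated TYPE('u) (Top0 TYPE('u)) filter_struct (rali_struct (Ord_cat TYPE('u)))
       \<and> \<not> cofibrantly_generated TYPE('u) (Top0 TYPE('u)) filter_struct (split_epi_struct (Ord_cat TYPE('u)))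
       \<and> \<not> (\<exists>I. I \<subseteq> Arr (Top0 TYPE('u)) \<and> small TYPE('u) I \<and>
              filter_right_class TYPE('u) = {f \<in> Arr (Top0 TYPE('u)). \<forall>i\<in>I. has_rlp (Top0 TYPE('u)) i f})"
proof (intro conjI allI impI)
  let ?O = "Ord_cat TYPE('u)"
  fix W :: "(('u topology, 'u) smap hom_elem rel, ('u topology, 'u) smap hmap) awfs"
  assume W: "ord_awfs ?O W \<and> cocontinuous_awfs TYPE('u) ?O W"
  note A = ord_category.arrow_category[OF Ord_category]
  have T: "ord_functor (arrow_cat ?O) (arrow_cat ?O) (R_functor W)"
    using ord_monad.functor_T[OF ord_awfs.R_monad[OF conjunct1[OF W]]] .
  show "\<not> cofibrantly_generated TYPE('u) (Top0 TYPE('u)) filter_struct (awfs_struct ?O W)"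
  proof (rule not_cofibrantly_generated[OF assms])
    fix r :: "'u rel" assume r: "Partial_order r" "small TYPE('u) (Field r)"
    show "algebraic_struct ?O (R_functor W) (awfs_struct ?O W) r"
      using cocontinuous_poset_colimit[OF assms conjunct2[OF W, unfolded cocontinuous_awfs_def] T A A r]
      by (rule awfs_algebraic_struct[OF Ord_category conjunct1[OF W]])
  qed
next
  show "\<not> cofibrantly_generated TYPE('u) (Top0 TYPE('u)) filter_struct (rali_struct (Ord_cat TYPE('u)))"
    using not_cofibrantly_generated[OF assms ord_category.rali_algebraic_struct[OF Ord_category]] .
  show "\<not> cofibrantly_generated TYPE('u) (Top0 TYPE('u)) filter_struct (split_epi_struct (Ord_cat TYPE('u)))"
    using not_cofibrantly_generated[OF assms ord_category.split_epi_algebraic_struct[OF Ord_category]] .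
  show "\<not> (\<exists>I. I \<subseteq> Arr (Top0 TYPE('u)) \<and> small TYPE('u) I \<and>
      filter_right_class TYPE('u) = {f \<in> Arr (Top0 TYPE('u)). \<forall>i\<in>I. has_rlp (Top0 TYPE('u)) i f})"
  proof
    assume "\<exists>I. I \<subseteq> Arr (Top0 TYPE('u)) \<and> small TYPE('u) I \<and>
      filter_right_class TYPE('u) = {f \<in> Arr (Top0 TYPE('u)). \<forall>i\<in>I. has_rlp (Top0 TYPE('u)) i f}"
    then obtain I where I: "I \<subseteq> Arr (Top0 TYPE('u))" "small TYPE('u) I"
      "filter_right_class TYPE('u) = {f \<in> Arr (Top0 TYPE('u)). \<forall>i\<in>I. has_rlp (Top0 TYPE('u)) i f}" by blast
    obtain lt and w :: 'u and S where c: "bounded_chain_space lt w S"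
      and s: "\<And>u. u \<in> I \<Longrightarrow> topspace (src u) \<lesssim> S \<and> topspace (tgt u) \<lesssim> S"
      using exists_bounded_chain_space[OF assms I(2,1)] by blast
    interpret bounded_chain_space lt w undefined S by (rule c)
    show False using right_class_not_rlp[of I] s I(3) by blast
  qed
qed

end
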